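(* Let $H$ be a fixed graph that is regular and strictly $2$-balanced. Then, as $n\to\infty$, \[ \mathbb{E}\big[e(\mathbb{M}_n(H))\big] = \Omega\Big( n^{2 - (v_H-2)/(e_H-1)}\, (\ln\ln n)^{1/(e_H-1)} \Big), \] where the implied constant depends only on $H$.
   Context: For a graph $F$, $v_F$ and $e_F$ denote its numbers of vertices and edges. A graph $H$ is strictly $2$-balanced if $v_H, e_H \ge 3$ and for every proper subgraph $F \subsetneq H$ with $v_F \ge 3$ we have $(e_H-1)/(v_H-2) > (e_F-1)/(v_F-2)$. The random graph $\mathbb{M}_n(H)$ is defined by the following process: assign to each edge $f$ of the complete graph $K_n$ on vertex set $\{1,\dots,n\}$ an independent birthtime $\beta(f)$, uniform on $[0,1]$ (almost surely all distinct). Starting from the empty graph on $\{1,\dots,n\}$, traverse the edges of $K_n$ in increasing order of birthtime and add each traversed edge to the current graph unless its addition creates a (not necessarily induced) copy of $H$. The final graph is $\mathbb{M}_n(H)$ (a maximal $H$-free graph), and $e(\mathbb{M}_n(H))$ is its number of edges. *)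

theory Defs
  imports "HOL-Probability.Probability"
begin

definition graph :: "'a set \<Rightarrow> 'a set set \<Rightarrow> bool" where
  "graph V E \<longleftrightarrow> finite V \<and> (\<forall>e\<in>E. e \<subseteq> V \<and> card e = 2)"

definition regular :: "'a set \<Rightarrow> 'a set set \<Rightarrow> bool" where
  "regular V E \<longleftrightarrow> (\<exists>d. \<forall>v\<in>V. card {e\<in>E. v \<in> e} = d)"

definition subgraph :: "'a set \<Rightarrow> 'a set set \<Rightarrow> 'a set \<Rightarrow> 'a set set \<Rightarrow> bool" where
  "subgraph VF EF V E \<longleftrightarrow> VF \<subseteq> V \<and> EF \<subseteq> E \<and> (\<forall>e\<in>EF. e \<subseteq> VF)"

definition strictly_2_balanced :: "'a set \<Rightarrow> 'a set set \<Rightarrow> bool" where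
  "strictly_2_balanced V E \<longleftrightarrow>
     card V \<ge> 3 \<and> card E \<ge> 3 \<and>
     (\<forall>VF EF. subgraph VF EF V E \<and> (VF, EF) \<noteq> (V, E) \<and> card VF \<ge> 3 \<longrightarrow>
        (real (card E) - 1) / (real (card V) - 2) > (real (card EF) - 1) / (real (card VF) - 2))"

definition has_copy :: "'a set \<Rightarrow> 'a set set \<Rightarrow> nat \<Rightarrow> nat set set \<Rightarrow> bool" where
  "has_copy V E n G \<longleftrightarrow>
     (\<exists>\<phi>. inj_on \<phi> V \<and> \<phi> ` V \<subseteq> {1..n} \<and> (\<forall>e\<in>E. \<phi> ` e \<in> G))"

definition Kn_edges :: "nat \<Rightarrow> nat set set" where
  "Kn_edges n = {{i, j} | i j. 1 \<le> i \<and> i < j \<and> j \<le> n}"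

definition Kn_edge_list :: "nat \<Rightarrow> nat set list" where
  "Kn_edge_list n = concat (map (\<lambda>j. map (\<lambda>i. {i, j}) [1..<j]) [1..<n+1])"

text \<open>The H-free process: traverse edges by increasing birthtime (ties, a null event,
  broken by a fixed stable order) and add each edge unless it creates a copy of H.\<close>
definition free_process :: "'a set \<Rightarrow> 'a set set \<Rightarrow> nat \<Rightarrow> (nat set \<Rightarrow> real) \<Rightarrow> nat set set" where
  "free_process V E n \<beta> =
     foldl (\<lambda>G f. if has_copy V E n (insert f G) then G else insert f G) {}
           (sort_key \<beta> (Kn_edge_list n))"

definition birth_space :: "nat \<Rightarrow> (nat set \<Rightarrow> real) measure" where
  "birth_space n = PiM (Kn_edges n) (\<lambda>_. uniform_measure lborel {0..1})"

definition expected_edges :: "'a set \<Rightarrow> 'a set set \<Rightarrow> nat \<Rightarrow> real" where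
  "expected_edges V E n =
     (\<integral>\<beta>. real (card (free_process V E n \<beta>)) \<partial>birth_space n)"

end

(* Birthtimes are discretised to N slots. Let s(t) be the probability that a given edge is not blocked by
   accepted edges born before t, and Phi(t) the average of s over times before t, the probability to be
   accepted before t. An edge f becomes blocked at time t when some copy of H through f is completed
   except for f. If the edges of this copy were independent, this would give
   s' >= - A * s^2 * Phi^(k - 1) with k = e_H - 1 and A ~ n^(v_H - 2), that is s >= exp (- C * A * Phi^k) and
   Phi >= const * n^(-1/d) * (ln K)^(1/k) at time K * n^(-1/d), where d = k / (v_H - 2).
   Only this upper bound on the joint probability is needed, with a small additive error. The status of
   an edge is determined by chains of copies with decreasing birthtimes that start at the edge. Swapping one
   birthtime after the other with an independent sample shows that two edges of a copy decorrelate up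
   to the probability that chains starting at both of them meet; by strict balance such a cycle of
   copies has polynomially small expected number. Chains longer than L contribute a factor
   1 / L!, and the number of shorter ones is n^o(1) as long as K is a small power of ln n. *)
theory Submission
  imports Defs "HOL-Real_Asymp.Real_Asymp"
begin

section \<open>Copies of a balanced graph\<close>

text \<open>The double logarithm results from two conflicting demands on the depth \<open>L\<close>.
  The error \<open>1 / L!\<close> must beat the number of early chains of length \<open>L\<close>,
  which grows like \<open>(const * K ^ k) ^ L\<close>, so \<open>L\<close> has to exceed a large
  multiple of \<open>K ^ k\<close>. The number of ways to glue \<open>2 * L\<close> copies together,
  a power of \<open>L\<close> and \<open>K\<close> per copy, must stay below the power of
  \<open>n\<close> gained by strict balance, so \<open>L\<close> stays below
  \<open>ln n / ln ln n\<close>. Hence \<open>K\<close> is a power of \<open>ln n\<close>, and the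
  gain \<open>ln K\<close> has order \<open>ln ln n\<close>. Strict balance acts twice:
  probabilistically, since overlaps in more than an edge are rare, and deterministically, since a
  tree of copies glued along edges contains no further copy. The edges of a copy \<open>B\<close>
  with prescribed birthtimes influence each other through \<open>B\<close> itself. All comparisons
  are therefore made relative to a root copy \<open>B\<close>: its birthtimes are overwritten, each
  of its edges is tested at a time not later than some other edge of \<open>B\<close>, and only
  configurations outside \<open>B\<close> are charged.\<close>

lemma regular_covers:
  assumes "graph V E" "regular V E" "E \<noteq> {}"
  shows "\<Union>E = V"
proof
  show "\<Union>E \<subseteq> V" using assms(1) by (auto simp: graph_def)
  show "V \<subseteq> \<Union>E"
  proof
    fix x assume x: "x \<in> V"
    obtain r where r: "\<And>v. v \<in> V \<Longrightarrow> card {e\<in>E. v \<in> e} = r"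
      using assms(2) unfolding regular_def by blast
    have finE: "finite E"
      by (rule finite_subset[of _ "Pow V"]) (use assms(1) in \<open>auto simp: graph_def\<close>)
    obtain e where e: "e \<in> E" using assms(3) by blast
    then have "card e = 2" "e \<subseteq> V" using assms(1) by (auto simp: graph_def)
    then obtain y where y: "y \<in> e" "y \<in> V" by (cases "e = {}") auto
    have "{e\<in>E. y \<in> e} \<noteq> {}" using e y by auto
    moreover have "finite {e\<in>E. y \<in> e}" using finE by simp
    ultimately have "r \<noteq> 0" using r[OF y(2)] by (metis card_0_eq)
    then have "{e\<in>E. x \<in> e} \<noteq> {}" using r[OF x] by (metis card.empty)
    then show "x \<in> \<Union>E" by auto
  qed
qed

lemma in_Kn_edges: "e \<in> Kn_edges n \<longleftrightarrow> e \<subseteq> {1..n} \<and> card e = 2"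
proof
  assume "e \<in> Kn_edges n"
  then show "e \<subseteq> {1..n} \<and> card e = 2" by (auto simp: Kn_edges_def)
next
  assume a: "e \<subseteq> {1..n} \<and> card e = 2"
  then obtain x y where xy: "e = {x, y}" "x \<noteq> y" by (meson card_2_iff)
  consider "x < y" | "y < x" using xy by linarith
  then show "e \<in> Kn_edges n"
  proof cases
    case 1 then show ?thesis using xy a unfolding Kn_edges_def by auto
  next
    case 2
    then have "e = {y, x}" "1 \<le> y" "y < x" "x \<le> n" using xy a by auto
    then show ?thesis unfolding Kn_edges_def by blast
  qed
qed

lemma finite_Kn_edges [simp]: "finite (Kn_edges n)"
proof (rule finite_subset)
  show "Kn_edges n \<subseteq> Pow {1..n}" by (meson PowI in_Kn_edges subsetI)
qed simp

lemma image_Collect_mem: "Y \<subseteq> g ` A \<Longrightarrow> g ` {x\<in>A. g x \<in> Y} = Y"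
  by auto

locale balanced_graph =
  fixes VH :: "'a set" and EH :: "'a set set"
  assumes graph: "graph VH EH" and regular: "regular VH EH" and balanced: "strictly_2_balanced VH EH"
begin

definition "vH = card VH"
definition "eH = card EH"

lemma finite_VH [simp]: "finite VH" using graph by (simp add: graph_def)
lemma EH_sub: "e \<in> EH \<Longrightarrow> e \<subseteq> VH" using graph by (simp add: graph_def)
lemma EH_card: "e \<in> EH \<Longrightarrow> card e = 2" using graph by (simp add: graph_def)
lemma EH_finite: "e \<in> EH \<Longrightarrow> finite e" using EH_card by (metis card.infinite zero_neq_numeral)
lemma finite_EH [simp]: "finite EH"
  by (rule finite_subset[of _ "Pow VH"]) (use EH_sub in auto)
lemma vH_ge: "vH \<ge> 3" and eH_ge: "eH \<ge> 3"
  using balanced by (auto simp: strictly_2_balanced_def vH_def eH_def)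
lemma EH_ne: "EH \<noteq> {}" using eH_ge by (auto simp: eH_def)
text \<open>A copy is stored below as its set of edges. A regular graph with an edge has no isolated
  vertices, so this set determines the vertices of the copy.\<close>

lemma Union_EH: "\<Union>EH = VH" using regular_covers[OF graph regular EH_ne] .

lemma balance_strict:
  assumes "S \<subseteq> VH" "F \<subseteq> EH" "\<And>e. e \<in> F \<Longrightarrow> e \<subseteq> S" "F \<noteq> EH \<or> S \<noteq> VH" "card S \<ge> 3"
  shows "(real (card F) - 1) * (real vH - 2) < (real eH - 1) * (real (card S) - 2)"
proof -
  have "(real (card EH) - 1) / (real (card VH) - 2) > (real (card F) - 1) / (real (card S) - 2)"
    using balanced[unfolded strictly_2_balanced_def subgraph_def, THEN conjunct2, THEN conjunct2,
        rule_format, of S F] assms by blast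
  moreover have "real vH - 2 > 0" "real (card S) - 2 > 0" using vH_ge assms(5) by auto
  ultimately show ?thesis by (simp add: vH_def eH_def field_simps)
qed

lemma balance:
  assumes "S \<subseteq> VH" "F \<subseteq> EH" "\<And>e. e \<in> F \<Longrightarrow> e \<subseteq> S" "card S \<ge> 3"
  shows "(real (card F) - 1) * (real vH - 2) \<le> (real eH - 1) * (real (card S) - 2)"
proof (cases "F = EH \<and> S = VH")
  case True then show ?thesis by (simp add: vH_def eH_def)
next
  case False then show ?thesis using balance_strict[OF assms(1,2,3)] assms(4) by auto
qed

text \<open>Two adjacent edges span three vertices and have ratio 1, so strict balance puts
  \<open>H\<close> above 1. Without adjacent edges \<open>H\<close> is a matching, and two of its
  edges have the same ratio as \<open>H\<close> itself, contradicting strict balance.\<close>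

lemma density_gt_1: "real vH - 2 < real eH - 1"
proof (cases "\<exists>e\<in>EH. \<exists>e'\<in>EH. e \<noteq> e' \<and> e \<inter> e' \<noteq> {}")
  case True
  then obtain e e' where e: "e \<in> EH" "e' \<in> EH" "e \<noteq> e'" "e \<inter> e' \<noteq> {}" by blast
  have fin: "finite e" "finite e'" using e EH_finite by auto
  have "card (e \<inter> e') \<noteq> 0" using e fin by auto
  moreover have "card (e \<inter> e') \<noteq> 2"
    by (metis EH_card e(1,2,3) fin inf_le1 inf_le2 card_subset_eq)
  moreover have "card (e \<inter> e') \<le> 2" by (metis EH_card card_mono e(1) fin(1) inf_le1)
  ultimately have c: "card (e \<inter> e') = 1" by linarith
  have "card (e \<union> e') = 3" using card_Un_Int[OF fin] EH_card e c by auto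
  moreover have "card {e, e'} = 2" using e by simp
  moreover have "{e,e'} \<noteq> EH" using eH_ge calculation(2) by (auto simp: eH_def)
  ultimately show ?thesis
    using balance_strict[of "e \<union> e'" "{e,e'}"] e EH_sub by auto
next
  case False
  then have disj: "pairwise disjnt EH" by (auto simp: pairwise_def disjnt_def)
  have "card (\<Union>EH) = (\<Sum>e\<in>EH. card e)"
    by (rule card_Union_disjoint[OF disj]) (use EH_finite in auto)
  then have v: "vH = 2 * eH" using EH_card by (simp add: Union_EH vH_def eH_def)
  obtain F where F: "F \<subseteq> EH" "card F = 2" using eH_ge unfolding eH_def
    by (metis obtain_subset_with_card_n numeral_2_eq_2 numeral_3_eq_3 Suc_leD)
  have "card (\<Union>F) = (\<Sum>e\<in>F. card e)"
    by (rule card_Union_disjoint) (use disj F EH_finite pairwise_subset in auto)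
  also have "\<dots> = (\<Sum>e\<in>F. 2)" by (rule sum.cong) (use F EH_card in auto)
  also have "\<dots> = 4" using F by simp
  finally have c4: "card (\<Union>F) = 4" .
  have "F \<noteq> EH" using F eH_ge by (auto simp: eH_def)
  moreover have "\<Union>F \<subseteq> VH" using F EH_sub by auto
  ultimately have "(real (card F) - 1) * (real vH - 2) < (real eH - 1) * (real (card (\<Union>F)) - 2)"
    using c4 F by (intro balance_strict) auto
  then show ?thesis using v c4 F by simp
qed

section \<open>Embeddings and copies in the complete graph\<close>

definition emb :: "nat \<Rightarrow> ('a \<Rightarrow> nat) set" where
  "emb n = {\<phi> \<in> VH \<rightarrow>\<^sub>E {1..n}. inj_on \<phi> VH}"
definition img :: "('a \<Rightarrow> nat) \<Rightarrow> nat set set" where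
  "img \<phi> = (\<lambda>e. \<phi> ` e) ` EH"
definition copies :: "nat \<Rightarrow> nat set set set" where
  "copies n = img ` emb n"

lemma emb_inj: "\<phi> \<in> emb n \<Longrightarrow> inj_on \<phi> VH"
  and emb_range: "\<phi> \<in> emb n \<Longrightarrow> \<phi> ` VH \<subseteq> {1..n}"
  by (auto simp: emb_def)

lemma finite_emb [simp]: "finite (emb n)"
  by (rule finite_subset[of _ "VH \<rightarrow>\<^sub>E {1..n}"]) (auto simp: emb_def intro: finite_PiE)

lemma finite_copies [simp]: "finite (copies n)" by (simp add: copies_def)

lemma img_inj: "inj_on \<phi> VH \<Longrightarrow> inj_on (\<lambda>e. \<phi> ` e) EH"
  by (rule inj_on_subset[OF inj_on_image_Pow]) (use EH_sub in auto)

lemma card_img: "\<phi> \<in> emb n \<Longrightarrow> card (img \<phi>) = eH"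
  unfolding img_def eH_def by (intro card_image img_inj emb_inj)

lemma Union_img: "\<Union>(img \<phi>) = \<phi> ` VH"
  unfolding img_def Union_EH[symmetric] by auto

lemma copy_card: "C \<in> copies n \<Longrightarrow> card C = eH"
  unfolding copies_def using card_img by auto

lemma copy_finite: "C \<in> copies n \<Longrightarrow> finite C"
  unfolding copies_def img_def by auto

lemma copy_edges:
  assumes "C \<in> copies n" shows "C \<subseteq> Kn_edges n"
proof
  fix e assume e: "e \<in> C"
  obtain \<phi> where \<phi>: "\<phi> \<in> emb n" "C = img \<phi>" using assms by (auto simp: copies_def)
  then obtain h where h: "h \<in> EH" "e = \<phi> ` h" using e by (auto simp: img_def)
  have "inj_on \<phi> h" using emb_inj[OF \<phi>(1)] EH_sub[OF h(1)] by (rule inj_on_subset)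
  then have "card e = 2" using h EH_card card_image by metis
  moreover have "e \<subseteq> {1..n}" using emb_range[OF \<phi>(1)] EH_sub h by auto
  ultimately show "e \<in> Kn_edges n" by (simp add: in_Kn_edges)
qed

lemma copy_vertices:
  assumes "C \<in> copies n" shows "finite (\<Union>C)" "card (\<Union>C) = vH"
proof -
  obtain \<phi> where \<phi>: "\<phi> \<in> emb n" "C = img \<phi>" using assms by (auto simp: copies_def)
  show "finite (\<Union>C)" "card (\<Union>C) = vH"
    using \<phi> by (auto simp: Union_img vH_def intro: card_image emb_inj)
qed

lemma has_copy_iff: "has_copy VH EH n G \<longleftrightarrow> (\<exists>C\<in>copies n. C \<subseteq> G)"
proof
  assume "has_copy VH EH n G"
  then obtain \<phi> where \<phi>: "inj_on \<phi> VH" "\<phi> ` VH \<subseteq> {1..n}" "\<And>e. e \<in> EH \<Longrightarrow> \<phi> ` e \<in> G"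
    unfolding has_copy_def by blast
  have eq: "restrict \<phi> VH ` e = \<phi> ` e" if "e \<in> EH" for e using EH_sub[OF that] by (auto simp: image_iff)
  have "restrict \<phi> VH \<in> emb n" unfolding emb_def using \<phi> by (auto simp: inj_on_def)
  moreover have "img (restrict \<phi> VH) \<subseteq> G" unfolding img_def using eq \<phi>(3) by auto
  ultimately show "\<exists>C\<in>copies n. C \<subseteq> G" by (auto simp: copies_def)
next
  assume "\<exists>C\<in>copies n. C \<subseteq> G"
  then obtain \<phi> where "\<phi> \<in> emb n" "img \<phi> \<subseteq> G" by (auto simp: copies_def)
  then show "has_copy VH EH n G" unfolding has_copy_def
    by (intro exI[of _ \<phi>]) (auto simp: emb_def img_def)
qed

lemma edge_card2: "e \<in> Kn_edges n \<Longrightarrow> card e = 2 \<and> finite e"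
  by (auto simp: in_Kn_edges intro: card_ge_0_finite)

text \<open>A copy crossing the cut \<open>f\<close> would consist of two proper pieces, each too sparse by strict balance.\<close>

lemma glued_copy:
  assumes D: "D \<in> copies n" and C: "C \<in> copies n" and UE: "U \<subseteq> Kn_edges n"
    and f: "f \<in> U" "f \<in> C" and cut: "\<Union>C \<inter> \<Union>U = f" and sub: "D \<subseteq> U \<union> C"
  shows "D \<subseteq> U \<or> D = C"
proof (rule ccontr)
  assume "\<not> ?thesis"
  then have nU: "\<not> D \<subseteq> U" and DC: "D \<noteq> C" by auto
  have nC: "\<not> D \<subseteq> C"
    using DC card_subset_eq[OF copy_finite[OF C]] copy_card[OF C] copy_card[OF D] by metis
  obtain \<phi> where \<phi>: "\<phi> \<in> emb n" "D = img \<phi>" using D by (auto simp: copies_def)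
  obtain \<psi> where \<psi>: "\<psi> \<in> emb n" "C = img \<psi>" using C by (auto simp: copies_def)
  note inj = emb_inj[OF \<phi>(1)]
  define E1 where "E1 = {e\<in>EH. \<phi> ` e \<in> U}"
  define E2 where "E2 = {e\<in>EH. \<phi> ` e \<in> C}"
  define S1 where "S1 = {x\<in>VH. \<phi> x \<in> \<Union>U}"
  define S2 where "S2 = {x\<in>VH. \<phi> x \<in> \<Union>C}"
  have EHeq: "EH = E1 \<union> E2" using sub \<phi>(2) unfolding E1_def E2_def img_def by auto
  have E1sub: "\<And>e. e \<in> E1 \<Longrightarrow> e \<subseteq> S1" and E2sub: "\<And>e. e \<in> E2 \<Longrightarrow> e \<subseteq> S2"
    unfolding E1_def E2_def S1_def S2_def using EH_sub by blast+
  have E1ne: "E1 \<noteq> EH" and E2ne: "E2 \<noteq> EH" using nU nC \<phi>(2) unfolding E1_def E2_def img_def by auto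
  have fin: "finite E1" "finite E2" "finite S1" "finite S2" unfolding E1_def E2_def S1_def S2_def by auto
  have S12: "S1 \<union> S2 = VH"
  proof
    show "VH \<subseteq> S1 \<union> S2"
    proof
      fix x assume "x \<in> VH"
      then obtain e where "e \<in> EH" "x \<in> e" using Union_EH by blast
      then show "x \<in> S1 \<union> S2" using EHeq E1sub E2sub by blast
    qed
  qed (auto simp: S1_def S2_def)
  have capf: "\<phi> ` (S1 \<inter> S2) \<subseteq> f" using cut unfolding S1_def S2_def by auto
  have fc: "card f = 2" "finite f" using edge_card2 UE f by blast+
  have injS: "inj_on \<phi> (S1 \<inter> S2)" by (rule inj_on_subset[OF inj]) (use S12 in auto)
  have cap2: "card (S1 \<inter> S2) \<le> 2"
    using card_mono[OF fc(2) capf] card_image[OF injS] fc by simp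
  have vsum: "card S1 + card S2 = vH + card (S1 \<inter> S2)"
    using card_Un_Int[OF fin(3,4)] S12 by (simp add: vH_def)
  have esum: "card E1 + card E2 = eH + card (E1 \<inter> E2)"
    using card_Un_Int[OF fin(1,2)] by (simp add: eH_def flip: EHeq)
  have capE: "\<phi> ` e = f" if "e \<in> E1 \<inter> E2" for e
  proof -
    have "\<phi> ` e \<subseteq> f" using that cut unfolding E1_def E2_def by auto
    moreover have "card (\<phi> ` e) = 2" using that UE edge_card2 unfolding E1_def by blast
    ultimately show ?thesis using fc by (metis card_subset_eq)
  qed
  have capE': "e = S1 \<inter> S2 \<and> card (S1 \<inter> S2) = 2" if "e \<in> E1 \<inter> E2" for e
  proof -
    have sub: "e \<subseteq> S1 \<inter> S2" using that E1sub E2sub by blast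
    have "card e = 2" using that EH_card unfolding E1_def by auto
    then show ?thesis using sub cap2 fin card_seteq[of "S1 \<inter> S2" e] by auto
  qed
  have E1e: "E1 \<noteq> {}" and E2e: "E2 \<noteq> {}" using EHeq E1ne E2ne by auto
  have S1c: "card S1 \<ge> 2" and S2c: "card S2 \<ge> 2"
  proof -
    obtain e1 e2 where e: "e1 \<in> E1" "e2 \<in> E2" using E1e E2e by blast
    then have "card e1 = 2" "card e2 = 2" using EHeq EH_card by auto
    then show "card S1 \<ge> 2" "card S2 \<ge> 2"
      using card_mono[OF fin(3) E1sub[OF e(1)]] card_mono[OF fin(4) E2sub[OF e(2)]] by auto
  qed
  have pos: "real vH - 2 > 0" using vH_ge by auto
  define a where "a = real vH - 2"
  define b where "b = real eH - 1"
  have ab: "0 < a" "a < b" using pos density_gt_1 by (auto simp: a_def b_def)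
  have S1VH: "S1 \<subseteq> VH" and S2VH: "S2 \<subseteq> VH" using S12 by auto
  have E1EH: "E1 \<subseteq> EH" and E2EH: "E2 \<subseteq> EH" using EHeq by auto
  have small: "card F \<le> 1" if "F \<subseteq> EH" "\<And>e. e \<in> F \<Longrightarrow> e \<subseteq> S" "card S = 2" for F and S :: "'a set"
  proof -
    have fS: "finite S" using that(3) by (intro card_ge_0_finite) simp
    have "e = S" if "e \<in> F" for e
      using \<open>F \<subseteq> EH\<close> \<open>\<And>e. e \<in> F \<Longrightarrow> e \<subseteq> S\<close>[OF that] \<open>card S = 2\<close> EH_card[of e] card_subset_eq[OF fS, of e] that by auto
    then have "F \<subseteq> {S}" by auto
    then show ?thesis using card_mono[of "{S}" F] by simp
  qed
  have str1: "(real (card E1) - 1) * a < b * (real (card S1) - 2)" if "card S1 \<ge> 3"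
    unfolding a_def b_def by (rule balance_strict) (use S1VH E1EH E1sub E1ne that in auto)
  have str2: "(real (card E2) - 1) * a < b * (real (card S2) - 2)" if "card S2 \<ge> 3"
    unfolding a_def b_def by (rule balance_strict) (use S2VH E2EH E2sub E2ne that in auto)
  have le1: "(real (card E1) - 1) * a \<le> b * (real (card S1) - 2)"
  proof (cases "card S1 \<ge> 3")
    case False
    then have c: "card S1 = 2" using S1c by simp
    then have "real (card E1) - 1 \<le> 0" using small[of E1 S1] E1EH E1sub by auto
    then show ?thesis using c ab by (simp add: mult_nonpos_nonneg)
  qed (use str1 in auto)
  have le2: "(real (card E2) - 1) * a \<le> b * (real (card S2) - 2)"
  proof (cases "card S2 \<ge> 3")
    case False
    then have c: "card S2 = 2" using S2c by simp
    then have "real (card E2) - 1 \<le> 0" using small[of E2 S2] E2EH E2sub by auto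
    then show ?thesis using c ab by (simp add: mult_nonpos_nonneg)
  qed (use str2 in auto)
  \<comment> \<open>Both pieces satisfy the balance inequality, and each case adds the two up. If at
    most one vertex is shared, the outcome is \<open>b \<le> a\<close>, excluded because the ratio
    exceeds 1. If the shared pair is an edge of both pieces, the sums agree exactly, and strictness
    in a piece with at least three vertices decides.\<close>
  consider (small) "card (S1 \<inter> S2) \<le> 1" | (edge) "card (S1 \<inter> S2) = 2" "E1 \<inter> E2 \<noteq> {}"
    | (nonedge) "card (S1 \<inter> S2) = 2" "E1 \<inter> E2 = {}" using cap2 by linarith
  then show False
  proof cases
    case small
    have "E1 \<inter> E2 = {}" using capE' small by fastforce
    then have e: "real (card E1) + real (card E2) = b + 1" using esum by (simp add: b_def flip: of_nat_add)
    have v: "real (card S1) + real (card S2) \<le> a + 3" using vsum small by (simp add: a_def flip: of_nat_add)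
    have "(b - 1) * a = (real (card E1) - 1) * a + (real (card E2) - 1) * a" using e
      by (simp flip: distrib_right)
    also have "\<dots> \<le> b * (real (card S1) - 2) + b * (real (card S2) - 2)" using le1 le2 by linarith
    also have "\<dots> = b * ((real (card S1) + real (card S2)) - 4)" by (simp add: algebra_simps)
    also have "\<dots> \<le> b * (a - 1)" using v ab by (intro mult_left_mono) auto
    finally show False using ab by (simp add: algebra_simps)
  next
    case edge
    then have "E1 \<inter> E2 = {S1 \<inter> S2}" using capE' by blast
    then have e: "real (card E1) + real (card E2) = b + 2" using esum by (simp add: b_def flip: of_nat_add)
    have v: "real (card S1) + real (card S2) = a + 4" using vsum edge by (simp add: a_def flip: of_nat_add)
    have "card S1 \<ge> 3 \<or> card S2 \<ge> 3" using vsum edge vH_ge by linarith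
    then have "(real (card E1) - 1) * a + (real (card E2) - 1) * a < b * (real (card S1) - 2) + b * (real (card S2) - 2)"
      using le1 le2 str1 str2 by linarith
    moreover have "(real (card E1) - 1) * a + (real (card E2) - 1) * a = b * a" using e by (simp flip: distrib_right)
    moreover have "b * (real (card S1) - 2) + b * (real (card S2) - 2) = b * a" using v by (simp flip: distrib_left)
    ultimately show False by simp
  next
    case nonedge
    have e: "real (card E1) + real (card E2) = b + 1" using esum nonedge by (simp add: b_def flip: of_nat_add)
    have v: "real (card S1) + real (card S2) = a + 4" using vsum nonedge by (simp add: a_def flip: of_nat_add)
    have imf: "\<phi> ` (S1 \<inter> S2) = f"
      using card_subset_eq[OF fc(2) capf] card_image[OF injS] nonedge fc by simp
    have hE1: "S1 \<inter> S2 \<notin> E1"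
    proof
      assume "S1 \<inter> S2 \<in> E1"
      then have "S1 \<inter> S2 \<in> E2" using imf f(2) unfolding E1_def E2_def by auto
      then show False using nonedge \<open>S1 \<inter> S2 \<in> E1\<close> by auto
    qed
    have hE2: "S1 \<inter> S2 \<notin> E2"
    proof
      assume "S1 \<inter> S2 \<in> E2"
      then have "S1 \<inter> S2 \<in> E1" using imf f(1) unfolding E1_def E2_def by auto
      then show False using hE1 by simp
    qed
    have big: "card S \<ge> 3" if "F \<noteq> {}" "F \<subseteq> EH" "\<And>e. e \<in> F \<Longrightarrow> e \<subseteq> S" "S1 \<inter> S2 \<notin> F" "S1 \<inter> S2 \<subseteq> S" "finite S"
      for F S
    proof (rule ccontr)
      assume "\<not> card S \<ge> 3"
      obtain e where e: "e \<in> F" using \<open>F \<noteq> {}\<close> by blast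
      have "card e = 2" "e \<subseteq> S" using e that EH_card by auto
      moreover have "card S \<le> 2" using \<open>\<not> card S \<ge> 3\<close> by simp
      ultimately have "e = S" using card_seteq[OF that(6)] by simp
      moreover have "S1 \<inter> S2 = S" using card_seteq[OF that(6,5)] nonedge \<open>card S \<le> 2\<close> by simp
      ultimately show False using e that(4) by simp
    qed
    have S13: "card S1 \<ge> 3" by (rule big[OF E1e E1EH E1sub hE1]) (use fin in auto)
    have S23: "card S2 \<ge> 3" by (rule big[OF E2e E2EH E2sub hE2]) (use fin in auto)
    \<comment> \<open>The two shared vertices are joined by \<open>f\<close> in \<open>C\<close>,
      though by no edge of \<open>D\<close>. So the piece inside \<open>C\<close> can be completed
      by \<open>f\<close>; pulled back to \<open>H\<close> along \<open>\<psi>\<close>, it satisfies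
      the balance inequality with one edge more, which makes up for the lack of a common
      edge.\<close>
    define T where "T = {y\<in>VH. \<psi> y \<in> \<phi> ` S2}"
    define F where "F = {e\<in>EH. \<psi> ` e \<in> insert f ((\<lambda>e. \<phi> ` e) ` E2)}"
    have injpsi: "inj_on \<psi> VH" by (rule emb_inj[OF \<psi>(1)])
    have "\<psi> ` T = \<phi> ` S2"
    proof -
      have "\<phi> ` S2 \<subseteq> \<psi> ` VH" unfolding S2_def \<psi>(2) Union_img by auto
      then show ?thesis unfolding T_def by (rule image_Collect_mem)
    qed
    moreover have "inj_on \<psi> T" by (rule inj_on_subset[OF injpsi]) (auto simp: T_def)
    moreover have "inj_on \<phi> S2" by (rule inj_on_subset[OF inj S2VH])
    ultimately have cT: "card T = card S2" by (metis card_image)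
    have imF: "(\<lambda>e. \<psi> ` e) ` F = insert f ((\<lambda>e. \<phi> ` e) ` E2)"
    proof -
      have "insert f ((\<lambda>e. \<phi> ` e) ` E2) \<subseteq> C" using f(2) unfolding E2_def by auto
      then have "insert f ((\<lambda>e. \<phi> ` e) ` E2) \<subseteq> (\<lambda>e. \<psi> ` e) ` EH" unfolding \<psi>(2) img_def .
      then show ?thesis unfolding F_def by (rule image_Collect_mem)
    qed
    have "inj_on (\<lambda>e. \<psi> ` e) F" by (rule inj_on_subset[OF img_inj[OF injpsi]]) (auto simp: F_def)
    then have "card F = card (insert f ((\<lambda>e. \<phi> ` e) ` E2))" using imF card_image by metis
    also have "\<dots> = Suc (card ((\<lambda>e. \<phi> ` e) ` E2))"
    proof (rule card_insert_disjoint)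
      show "f \<notin> (\<lambda>e. \<phi> ` e) ` E2"
      proof
        assume "f \<in> (\<lambda>e. \<phi> ` e) ` E2"
        then obtain e where e: "e \<in> E2" "\<phi> ` e = f" by auto
        then have "e \<in> E1" using f(1) E2EH unfolding E1_def by auto
        then show False using e nonedge by auto
      qed
    qed (use fin in auto)
    also have "card ((\<lambda>e. \<phi> ` e) ` E2) = card E2"
      by (rule card_image) (rule inj_on_subset[OF img_inj[OF inj] E2EH])
    finally have cF: "card F = Suc (card E2)" .
    have "(real (card F) - 1) * a \<le> b * (real (card T) - 2)" unfolding a_def b_def
    proof (rule balance)
      show "e \<subseteq> T" if "e \<in> F" for e
      proof -
        have "\<psi> ` e = f \<or> (\<exists>g\<in>E2. \<psi> ` e = \<phi> ` g)" using that unfolding F_def by auto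
        then have "\<psi> ` e \<subseteq> \<phi> ` S2" using imf E2sub by blast
        moreover have "e \<subseteq> VH" using that EH_sub unfolding F_def by simp
        ultimately show ?thesis unfolding T_def by auto
      qed
    qed (use cT S23 in \<open>auto simp: T_def F_def\<close>)
    then have s2: "real (card E2) * a \<le> b * (real (card S2) - 2)" using cF cT by simp
    have "(real (card E1) - 1) * a + real (card E2) * a < b * (real (card S1) - 2) + b * (real (card S2) - 2)"
      using str1[OF S13] s2 by linarith
    moreover have "(real (card E1) - 1) * a + real (card E2) * a = b * a" using e by (simp flip: distrib_right)
    moreover have "b * (real (card S1) - 2) + b * (real (card S2) - 2) = b * a" using v by (simp flip: distrib_left)
    ultimately show False by simp
  qed
qed

end

section \<open>Counting probability on finite products\<close>

definition pr :: "'b set \<Rightarrow> ('b \<Rightarrow> bool) \<Rightarrow> real" where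
  "pr A P = real (card {x\<in>A. P x}) / real (card A)"

lemma pr_nonneg [simp]: "pr A P \<ge> 0" by (simp add: pr_def)

lemma pr_le_1: "finite A \<Longrightarrow> pr A P \<le> 1"
  unfolding pr_def by (auto intro!: divide_le_eq_1[THEN iffD2] card_mono simp: card_gt_0_iff)

lemma pr_mono: "finite A \<Longrightarrow> (\<And>x. x \<in> A \<Longrightarrow> P x \<Longrightarrow> Q x) \<Longrightarrow> pr A P \<le> pr A Q"
  unfolding pr_def by (intro divide_right_mono) (auto intro!: card_mono)

lemma pr_cong: "(\<And>x. x \<in> A \<Longrightarrow> P x = Q x) \<Longrightarrow> pr A P = pr A Q"
  unfolding pr_def by (rule arg_cong[where f = "\<lambda>S. real (card S) / real (card A)"]) auto

lemma pr_sum: "finite A \<Longrightarrow> pr A P = (\<Sum>x\<in>A. of_bool (P x)) / real (card A)"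
  unfolding pr_def by (simp add: of_bool_def sum.If_cases Int_def)

lemma pr_Bex:
  assumes "finite A" "finite I"
  shows "pr A (\<lambda>x. \<exists>i\<in>I. P i x) \<le> (\<Sum>i\<in>I. pr A (P i))"
proof -
  have "{x\<in>A. \<exists>i\<in>I. P i x} = (\<Union>i\<in>I. {x\<in>A. P i x})" by auto
  then have "real (card {x\<in>A. \<exists>i\<in>I. P i x}) \<le> (\<Sum>i\<in>I. real (card {x\<in>A. P i x}))"
    using card_UN_le[OF assms(2), of "\<lambda>i. {x\<in>A. P i x}"] by (simp flip: of_nat_sum)
  then show ?thesis unfolding pr_def sum_divide_distrib[symmetric] by (intro divide_right_mono) auto
qed

lemma pr_disj: "finite A \<Longrightarrow> pr A (\<lambda>x. P x \<or> Q x) \<le> pr A P + pr A Q"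
  unfolding pr_sum add_divide_distrib[symmetric] sum.distrib[symmetric]
  by (intro divide_right_mono sum_mono) auto

lemma pr_diff: "finite A \<Longrightarrow> \<bar>pr A P - pr A Q\<bar> \<le> pr A (\<lambda>x. P x \<noteq> Q x)"
proof -
  assume f: "finite A"
  have "\<bar>(\<Sum>x\<in>A. of_bool (P x) :: real) - (\<Sum>x\<in>A. of_bool (Q x))\<bar> \<le> (\<Sum>x\<in>A. of_bool (P x \<noteq> Q x))"
    unfolding sum_subtractf[symmetric] by (rule order_trans[OF sum_abs]) (auto intro!: sum_mono)
  then show ?thesis unfolding pr_sum[OF f] diff_divide_distrib[symmetric] by (simp add: divide_right_mono)
qed

lemma pr_bij: "bij_betw h A B \<Longrightarrow> pr A (\<lambda>x. P (h x)) = pr B P"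
proof -
  assume h: "bij_betw h A B"
  have "bij_betw h {x\<in>A. P (h x)} {y\<in>B. P y}"
    unfolding bij_betw_def
  proof
    show "inj_on h {x\<in>A. P (h x)}" using h by (auto simp: bij_betw_def intro: inj_on_subset)
    show "h ` {x\<in>A. P (h x)} = {y\<in>B. P y}" using h by (auto simp: bij_betw_def)
  qed
  from bij_betw_same_card[OF this] bij_betw_same_card[OF h] show ?thesis
    by (simp add: pr_def)
qed

lemma pr_times: "pr (A \<times> B) (\<lambda>(x, y). P x \<and> Q y) = pr A P * pr B Q"
proof -
  have "{z\<in>A \<times> B. case z of (x, y) \<Rightarrow> P x \<and> Q y} = {x\<in>A. P x} \<times> {y\<in>B. Q y}" by auto
  then show ?thesis by (simp add: pr_def card_cartesian_product)
qed

definition hyb :: "'e set \<Rightarrow> ('e \<Rightarrow> 'c) \<Rightarrow> ('e \<Rightarrow> 'c) \<Rightarrow> 'e \<Rightarrow> 'c" where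
  "hyb S x y = (\<lambda>e. if e \<in> S then x e else y e)"

lemma hyb_PiE: "x \<in> PiE E A \<Longrightarrow> y \<in> PiE E A \<Longrightarrow> hyb S x y \<in> PiE E A"
  unfolding hyb_def PiE_def extensional_def Pi_def by auto

lemma swap_bij:
  "bij_betw (\<lambda>(x, y). (hyb S y x, hyb S x y)) (PiE E A \<times> PiE E A) (PiE E A \<times> PiE E A)"
  by (rule bij_betw_byWitness[where f' = "\<lambda>(x, y). (hyb S y x, hyb S x y)"])
     (auto simp: hyb_PiE, auto simp: hyb_def)

text \<open>Exchanging the \<open>I\<close>-coordinates of two independent samples is a bijection
  that turns \<open>P x\<close> and \<open>Q y\<close> into events of the same sample
  \<open>y\<close>.\<close>

lemma pr_indep:
  assumes fin: "finite (PiE E A)"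
    and P: "\<And>x y. (\<And>e. e \<in> I \<Longrightarrow> x e = y e) \<Longrightarrow> P x = P y"
    and Q: "\<And>x y. (\<And>e. e \<notin> I \<Longrightarrow> x e = y e) \<Longrightarrow> Q x = Q y"
  shows "pr (PiE E A) (\<lambda>x. P x \<and> Q x) = pr (PiE E A) P * pr (PiE E A) Q"
proof -
  let ?W = "PiE E A"
  have P': "P (hyb I y x) = P y" for x y by (rule P) (auto simp: hyb_def)
  have Q': "Q (hyb I y x) = Q x" for x y by (rule Q) (auto simp: hyb_def)
  have "pr ?W P * pr ?W Q = pr (?W \<times> ?W) (\<lambda>(x, y). P x \<and> Q y)" by (rule pr_times[symmetric])
  also have "\<dots> = pr (?W \<times> ?W) (\<lambda>z. case (case z of (x, y) \<Rightarrow> (hyb I y x, hyb I x y)) of (x, y) \<Rightarrow> P x \<and> Q y)"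
    by (rule pr_bij[OF swap_bij, symmetric])
  also have "\<dots> = pr (?W \<times> ?W) (\<lambda>(x, y). True \<and> (P y \<and> Q y))"
    by (rule pr_cong) (auto simp: P' Q')
  also have "\<dots> = pr ?W (\<lambda>_. True) * pr ?W (\<lambda>y. P y \<and> Q y)" by (rule pr_times)
  also have "\<dots> = pr ?W (\<lambda>y. P y \<and> Q y)"
    by (cases "card ?W = 0") (auto simp: pr_def)
  finally show ?thesis by simp
qed

text \<open>Replace the coordinates of the sample seen by \<open>G\<close> one at a time by an independent copy. Exchanging
  \<open>x i\<close> and \<open>y i\<close> preserves the measure, so each replacement only costs the probability that \<open>i\<close> is
  pivotal for both events.\<close>

lemma decorrelation_by_swapping:
  fixes F G :: "('e \<Rightarrow> 'c) \<Rightarrow> bool"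
  assumes fin: "finite E" "finite (PiE E A)"
    and c: "\<And>i S. i \<in> E \<Longrightarrow> S \<subseteq> E - {i} \<Longrightarrow>
       pr (PiE E A \<times> PiE E A) (\<lambda>(x, y). F x \<noteq> F (x(i := y i)) \<and> G (hyb S x y) \<noteq> G ((hyb S x y)(i := x i))) \<le> c i"
  shows "\<bar>pr (PiE E A) (\<lambda>x. F x \<and> G x) - pr (PiE E A) F * pr (PiE E A) G\<bar> \<le> (\<Sum>i\<in>E. c i)"
proof -
  let ?W = "PiE E A"
  have finW: "finite (?W \<times> ?W)" using fin by simp
  \<comment> \<open>\<open>D S\<close> interpolates: for empty \<open>S\<close> the two events see
    independent samples, for \<open>S = E\<close> the same one.\<close>
  define D where "D S = pr (?W \<times> ?W) (\<lambda>(x, y). F x \<and> G (hyb S x y))" for S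
  have step: "\<bar>D (insert i S) - D S\<bar> \<le> c i" if i: "i \<in> E" "S \<subseteq> E - {i}" for i S
  proof -
    define G1 where "G1 = (\<lambda>(x, y). G (hyb (insert i S) x y))"
    define G0 where "G0 = (\<lambda>(x, y). G (hyb S x y))"
    define F0 where "F0 = (\<lambda>(x, y::'e \<Rightarrow> 'c). F x)"
    define F1 where "F1 = (\<lambda>(x, y). F (x(i := y i)))"
    have sw: "hyb {i} y x = x(i := y i)" "hyb {i} x y = y(i := x i)" for x y :: "'e \<Rightarrow> 'c"
      by (auto simp: hyb_def)
    have hS: "hyb S (x(i := y i)) (y(i := x i)) = hyb (insert i S) x y" 
       "hyb (insert i S) (x(i := y i)) (y(i := x i)) = hyb S x y"
       "(hyb S x y)(i := x i) = hyb (insert i S) x y" for x y :: "'e \<Rightarrow> 'c"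
      using i by (auto simp: hyb_def fun_eq_iff)
    have a: "D S = pr (?W \<times> ?W) (\<lambda>z. F0 z \<and> G0 z)" "D (insert i S) = pr (?W \<times> ?W) (\<lambda>z. F0 z \<and> G1 z)"
      unfolding D_def F0_def G0_def G1_def by (auto intro!: pr_cong)
    have "pr (?W \<times> ?W) (\<lambda>z. F1 z \<and> G1 z) = D S"
      unfolding D_def pr_bij[OF swap_bij[of "{i}" E A], where P="\<lambda>(x,y). F x \<and> G (hyb S x y)", symmetric]
      by (rule pr_cong) (auto simp: sw hS F1_def G1_def)
    moreover have "pr (?W \<times> ?W) (\<lambda>z. F1 z \<and> G0 z) = D (insert i S)"
      unfolding D_def pr_bij[OF swap_bij[of "{i}" E A], where P="\<lambda>(x,y). F x \<and> G (hyb (insert i S) x y)", symmetric]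
      by (rule pr_cong) (auto simp: sw hS F1_def G0_def)
    \<comment> \<open>Adding to each difference its swapped form gives the expectation of the
      product of \<open>F0 - F1\<close> and \<open>G1 - G0\<close>, which vanishes unless both
      events change.\<close>
    ultimately have "2 * (D (insert i S) - D S) =
       (pr (?W \<times> ?W) (\<lambda>z. F0 z \<and> G1 z) - pr (?W \<times> ?W) (\<lambda>z. F0 z \<and> G0 z)) +
       (pr (?W \<times> ?W) (\<lambda>z. F1 z \<and> G0 z) - pr (?W \<times> ?W) (\<lambda>z. F1 z \<and> G1 z))" using a by simp
    also have "\<dots> = (\<Sum>z\<in>?W \<times> ?W. (of_bool (F0 z \<and> G1 z) - of_bool (F0 z \<and> G0 z)) +
         (of_bool (F1 z \<and> G0 z) - of_bool (F1 z \<and> G1 z))) / real (card (?W \<times> ?W))"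
      unfolding pr_sum[OF finW] by (simp only: diff_divide_distrib add_divide_distrib sum.distrib sum_subtractf)
    finally have "\<bar>2 * (D (insert i S) - D S)\<bar> = \<bar>(\<Sum>z\<in>?W \<times> ?W. (of_bool (F0 z \<and> G1 z) - of_bool (F0 z \<and> G0 z)) +
         (of_bool (F1 z \<and> G0 z) - of_bool (F1 z \<and> G1 z))) / real (card (?W \<times> ?W))\<bar>"
      by (rule arg_cong)
    then have "2 * \<bar>D (insert i S) - D S\<bar> = \<bar>(\<Sum>z\<in>?W \<times> ?W. (of_bool (F0 z \<and> G1 z) - of_bool (F0 z \<and> G0 z)) +
         (of_bool (F1 z \<and> G0 z) - of_bool (F1 z \<and> G1 z)))\<bar> / real (card (?W \<times> ?W))"
      by (simp only: abs_mult abs_divide abs_numeral abs_of_nat)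
    also have "\<dots> \<le> (\<Sum>z\<in>?W \<times> ?W. of_bool (F0 z \<noteq> F1 z \<and> G0 z \<noteq> G1 z)) / real (card (?W \<times> ?W))"
      by (intro divide_right_mono order_trans[OF sum_abs] sum_mono) auto
    also have "\<dots> = pr (?W \<times> ?W) (\<lambda>z. F0 z \<noteq> F1 z \<and> G0 z \<noteq> G1 z)" by (rule pr_sum[OF finW, symmetric])
    also have "\<dots> = pr (?W \<times> ?W) (\<lambda>(x, y). F x \<noteq> F (x(i := y i)) \<and> G (hyb S x y) \<noteq> G ((hyb S x y)(i := x i)))"
      by (rule pr_cong) (auto simp: F0_def F1_def G0_def G1_def hS)
    also have "\<dots> \<le> c i" by (rule c[OF i])
    finally have "2 * \<bar>D (insert i S) - D S\<bar> \<le> c i" .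
    moreover have "u \<le> w" if "2 * u \<le> w" "0 \<le> u" for u w :: real using that by linarith
    ultimately show ?thesis by (meson abs_ge_zero)
  qed
  have tot: "\<bar>D S - D {}\<bar> \<le> (\<Sum>i\<in>S. c i)" if "S \<subseteq> E" for S
    using finite_subset[OF that fin(1)] that
  proof (induction S rule: finite_induct)
    case (insert i S)
    then have "\<bar>D (insert i S) - D S\<bar> \<le> c i" by (intro step) auto
    then show ?case using insert by auto
  qed simp
  have "D E = pr (?W \<times> ?W) (\<lambda>(x, y). (F x \<and> G x) \<and> True)"
    unfolding D_def
  proof (rule pr_cong)
    fix z assume "z \<in> ?W \<times> ?W"
    then obtain x y where z: "z = (x, y)" "x \<in> ?W" "y \<in> ?W" by auto
    have "hyb E x y = x" unfolding hyb_def
      by (rule ext) (simp add: PiE_arb[OF z(2)] PiE_arb[OF z(3)])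
    then show "(case z of (x, y) \<Rightarrow> F x \<and> G (hyb E x y)) = (case z of (x, y) \<Rightarrow> (F x \<and> G x) \<and> True)"
      using z by simp
  qed
  also have "\<dots> = pr ?W (\<lambda>x. F x \<and> G x)"
    unfolding pr_times by (cases "card ?W = 0") (auto simp: pr_def)
  finally have "D E = pr ?W (\<lambda>x. F x \<and> G x)" .
  moreover have "D {} = pr ?W F * pr ?W G"
    unfolding D_def pr_times[symmetric] by (rule pr_cong) (auto simp: hyb_def)
  ultimately show ?thesis using tot[of E] by simp
qed

section \<open>Early edges under uniform slot times\<close>

abbreviation timings :: "'e set \<Rightarrow> nat \<Rightarrow> ('e \<Rightarrow> nat) set" where
  "timings E N \<equiv> E \<rightarrow>\<^sub>E {..<N}"

lemma finite_timings [simp]: "finite E \<Longrightarrow> finite (timings E N)"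
  by (auto intro: finite_PiE)

lemma pr_box:
  assumes "finite E" "B \<subseteq> E" "\<And>e. e \<in> B \<Longrightarrow> A e \<subseteq> {..<N}" "N > 0"
  shows "pr (timings E N) (\<lambda>x. \<forall>e\<in>B. x e \<in> A e) = (\<Prod>e\<in>B. real (card (A e)) / real N)"
proof -
  have fB: "finite B" using assms(1,2) finite_subset by blast
  have "{x\<in>timings E N. \<forall>e\<in>B. x e \<in> A e} = PiE E (\<lambda>e. if e \<in> B then A e else {..<N})"
    (is "?L = ?R")
  proof
    show "?L \<subseteq> ?R" by (auto simp: PiE_iff extensional_def)
    show "?R \<subseteq> ?L"
    proof
      fix x assume x: "x \<in> ?R"
      have "x e \<in> A e" if "e \<in> B" for e using PiE_mem[OF x, of e] that assms(2) by auto
      moreover have "x e < N" if "e \<in> E" for e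
        using PiE_mem[OF x that] assms(3)[of e] by (auto split: if_splits)
      ultimately show "x \<in> ?L" using x by (auto simp: PiE_iff)
    qed
  qed
  then have "real (card {x\<in>timings E N. \<forall>e\<in>B. x e \<in> A e}) = (\<Prod>e\<in>E. if e \<in> B then real (card (A e)) else real N)"
    by (simp add: card_PiE[OF assms(1)] if_distrib cong: if_cong)
  also have "\<dots> / real (card (timings E N)) = (\<Prod>e\<in>E. (if e \<in> B then real (card (A e)) else real N) / real N)"
    by (simp add: prod_dividef card_PiE[OF assms(1), of "\<lambda>_. {..<N}"])
  also have "\<dots> = (\<Prod>e\<in>E. if e \<in> B then real (card (A e)) / real N else 1)"
    using assms(4) by (intro prod.cong) auto
  also have "\<dots> = (\<Prod>e\<in>B. real (card (A e)) / real N)"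
    using assms(1,2) by (simp add: prod.If_cases Int_absorb1)
  finally show ?thesis unfolding pr_def .
qed

lemma pr_early:
  assumes "finite E" "B \<subseteq> E" "T \<le> N" "N > 0"
  shows "pr (timings E N) (\<lambda>x. \<forall>e\<in>B. x e < T) = (real T / real N) ^ card B"
  using pr_box[OF assms(1,2), of "\<lambda>_. {..<T}" N] assms by simp

text \<open>Each edge of \<open>B\<close> chooses a sample in which it is early. The union bound
  over these \<open>2 ^ card B\<close> choices is the origin of the doubled density.\<close>

lemma pr_early_pair:
  assumes "finite E" "B \<subseteq> E" "T \<le> N" "N > 0"
  shows "pr (timings E N \<times> timings E N) (\<lambda>(x, y). \<forall>e\<in>B. x e < T \<or> y e < T) \<le> (2 * real T / real N) ^ card B"
proof -
  let ?W = "timings E N"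
  have fB: "finite B" using assms finite_subset by auto
  have fW: "finite (?W \<times> ?W)" using assms by simp
  have "pr (?W \<times> ?W) (\<lambda>(x, y). \<forall>e\<in>B. x e < T \<or> y e < T)
     \<le> pr (?W \<times> ?W) (\<lambda>z. \<exists>S\<in>Pow B. case z of (x, y) \<Rightarrow> (\<forall>e\<in>S. x e < T) \<and> (\<forall>e\<in>B - S. y e < T))"
  proof (rule pr_mono[OF fW])
    fix z assume "case z of (x, y) \<Rightarrow> \<forall>e\<in>B. x e < T \<or> y e < T"
    then obtain x y where z: "z = (x, y)" "\<forall>e\<in>B. x e < T \<or> y e < T" by (cases z) auto
    have "{e\<in>B. x e < T} \<in> Pow B" by auto
    moreover have "(\<forall>e\<in>{e\<in>B. x e < T}. x e < T) \<and> (\<forall>e\<in>B - {e\<in>B. x e < T}. y e < T)" using z by auto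
    ultimately show "\<exists>S\<in>Pow B. case z of (x, y) \<Rightarrow> (\<forall>e\<in>S. x e < T) \<and> (\<forall>e\<in>B - S. y e < T)"
      using z(1) by blast
  qed
  also have "\<dots> \<le> (\<Sum>S\<in>Pow B. pr (?W \<times> ?W) (\<lambda>(x, y). (\<forall>e\<in>S. x e < T) \<and> (\<forall>e\<in>B - S. y e < T)))"
    by (rule pr_Bex[OF fW]) (use fB in auto)
  also have "\<dots> = (\<Sum>S\<in>Pow B. (real T / real N) ^ card B)"
  proof (rule sum.cong)
    fix S assume S: "S \<in> Pow B"
    have "pr (?W \<times> ?W) (\<lambda>(x, y). (\<forall>e\<in>S. x e < T) \<and> (\<forall>e\<in>B - S. y e < T))
       = (real T / real N) ^ card S * (real T / real N) ^ card (B - S)"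
      unfolding pr_times by (subst (1 2) pr_early) (use assms S in auto)
    also have "\<dots> = (real T / real N) ^ card B"
      using S fB by (metis PowD card_Diff_subset card_mono finite_subset le_add_diff_inverse power_add)
    finally show "pr (?W \<times> ?W) (\<lambda>(x, y). (\<forall>e\<in>S. x e < T) \<and> (\<forall>e\<in>B - S. y e < T)) = (real T / real N) ^ card B" .
  qed simp
  also have "\<dots> = (2 * real T / real N) ^ card B" using fB by (simp add: card_Pow power_mult_distrib power_divide)
  finally show ?thesis .
qed

text \<open>An increasing assignment on \<open>fs\<close> is determined by its set of values. So
  \<open>fs\<close> contributes at most \<open>T choose length fs\<close> patterns instead of
  \<open>T ^ length fs\<close>, which yields the factorial.\<close>

lemma pr_early_increasing:
  assumes "finite E" "W \<subseteq> E" "set fs \<subseteq> W" "distinct fs" "T \<le> N" "N > 0"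
  shows "pr (timings E N) (\<lambda>x. (\<forall>e\<in>W. x e < T) \<and> sorted_wrt (<) (map x fs))
    \<le> (real T / real N) ^ card W / fact (length fs)"
proof -
  let ?L = "length fs" and ?F = "set fs"
  define A where "A = {x\<in>timings E N. (\<forall>e\<in>W. x e < T) \<and> sorted_wrt (<) (map x fs)}"
  define Z where "Z = PiE (E - ?F) (\<lambda>e. if e \<in> W then {..<T} else {..<N}) \<times> {S. S \<subseteq> {..<T} \<and> card S = ?L}"
  have fW: "finite W" using assms finite_subset by auto
  have inj: "inj_on (\<lambda>x. (restrict x (E - ?F), x ` ?F)) A"
  proof (rule inj_onI)
    fix x y assume x: "x \<in> A" and y: "y \<in> A" and eq: "(restrict x (E - ?F), x ` ?F) = (restrict y (E - ?F), y ` ?F)"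
    have "map y fs = map x fs"
      by (rule strict_sorted_equal) (use x y eq in \<open>auto simp: A_def\<close>)
    then have 1: "x e = y e" if "e \<in> ?F" for e using that by auto
    have 2: "x e = y e" if "e \<in> E - ?F" for e using eq that by (metis prod.inject restrict_apply')
    have xy: "x \<in> timings E N" "y \<in> timings E N" using x y unfolding A_def by blast+
    have 3: "x e = y e" if "e \<notin> E" for e using PiE_arb[OF xy(1) that] PiE_arb[OF xy(2) that] by simp
    show "x = y"
    proof
      fix e show "x e = y e" using 1[of e] 2[of e] 3[of e] by (cases "e \<in> ?F"; cases "e \<in> E") auto
    qed
  qed
  have "(\<lambda>x. (restrict x (E - ?F), x ` ?F)) ` A \<subseteq> Z"
  proof
    fix z assume "z \<in> (\<lambda>x. (restrict x (E - ?F), x ` ?F)) ` A"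
    then obtain x where x: "x \<in> A" "z = (restrict x (E - ?F), x ` ?F)" by auto
    have "distinct (map x fs)" using x unfolding A_def by (auto simp: strict_sorted_iff)
    then have "card (x ` ?F) = ?L" using distinct_card[of "map x fs"] by simp
    then show "z \<in> Z" using x assms(2,3) by (auto simp: Z_def A_def PiE_iff)
  qed
  moreover have "finite Z" unfolding Z_def using assms(1) by (auto intro!: finite_PiE)
  ultimately have "card A \<le> card Z" using card_inj_on_le[OF inj] by blast
  also have "card Z = card (PiE (E - ?F) (\<lambda>e. if e \<in> W then {..<T} else {..<N})) * (T choose ?L)"
    unfolding Z_def by (simp add: card_cartesian_product n_subsets)
  also have "card (PiE (E - ?F) (\<lambda>e. if e \<in> W then {..<T} else {..<N})) = (\<Prod>e\<in>E - ?F. if e \<in> W then T else N)"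
    by (subst card_PiE) (use assms(1) in \<open>auto intro!: prod.cong\<close>)
  also have "\<dots> = T ^ card (W - ?F) * N ^ card (E - W)"
  proof -
    have "(E - ?F) \<inter> W = W - ?F" "(E - ?F) \<inter> - W = E - W" using assms(2,3) by auto
    then show ?thesis using assms(1) by (simp add: prod.If_cases)
  qed
  finally have "card A * fact ?L \<le> T ^ card (W - ?F) * N ^ card (E - W) * ((T choose ?L) * fact ?L)"
    by (simp add: mult_right_mono)
  also have "\<dots> \<le> T ^ card (W - ?F) * N ^ card (E - W) * T ^ ?L"
    by (intro mult_left_mono) (auto simp: binomial_fact_pow)
  also have "\<dots> = T ^ card W * N ^ card (E - W)"
  proof -
    have "card W = card (W - ?F) + ?L" using assms(3,4) fW
      by (metis List.finite_set card_Diff_subset card_mono distinct_card le_add_diff_inverse2)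
    then show ?thesis by (simp add: power_add)
  qed
  finally have "real (card A) * fact ?L \<le> real T ^ card W * real N ^ card (E - W)"
    by (metis (mono_tags) of_nat_fact of_nat_le_iff of_nat_mult of_nat_power)
  moreover have "real (card (timings E N)) = real N ^ card W * real N ^ card (E - W)"
  proof -
    have "card E = card W + card (E - W)" using assms(1,2) fW
      by (metis card_Diff_subset card_mono le_add_diff_inverse)
    then show ?thesis using assms(1) by (simp add: card_PiE power_add)
  qed
  ultimately show ?thesis unfolding pr_def A_def[symmetric] using assms(6)
    by (simp add: field_simps power_divide)
qed

section \<open>Acceptance and chains of copies\<close>

context balanced_graph
begin

text \<open>\<open>acc n d\<close> follows the recursion of the process for \<open>d\<close> levels only and accepts everything below.
  Birthtimes are natural numbers, and an edge can only be blocked by strictly earlier ones; hence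
  \<open>\<beta> f + 1\<close> levels give the full process \<open>Acc\<close>.\<close>

primrec acc :: "nat \<Rightarrow> nat \<Rightarrow> (nat set \<Rightarrow> nat) \<Rightarrow> nat set \<Rightarrow> bool" where
  "acc n 0 \<beta> f = True"
| "acc n (Suc d) \<beta> f = (\<forall>C\<in>copies n. f \<in> C \<longrightarrow> (\<exists>e\<in>C - {f}. \<beta> e \<ge> \<beta> f \<or> \<not> acc n d \<beta> e))"

lemma not_acc_Suc:
  "\<not> acc n (Suc d) \<beta> f \<longleftrightarrow> (\<exists>C\<in>copies n. f \<in> C \<and> (\<forall>e\<in>C - {f}. \<beta> e < \<beta> f \<and> acc n d \<beta> e))"
  unfolding acc.simps by (meson not_le)

lemma acc_stable:
  "d > \<beta> f \<Longrightarrow> d' > \<beta> f \<Longrightarrow> acc n d \<beta> f = acc n d' \<beta> f"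
proof (induction "\<beta> f" arbitrary: f d d' rule: less_induct)
  case less
  obtain c c' where c: "d = Suc c" "d' = Suc c'" using less.prems by (metis Suc_pred less_imp_Suc_add)
  have "acc n c \<beta> e = acc n c' \<beta> e" if "\<not> \<beta> e \<ge> \<beta> f" for e
    using less that c by auto
  then show ?case unfolding c acc.simps by blast
qed

definition Acc :: "nat \<Rightarrow> (nat set \<Rightarrow> nat) \<Rightarrow> nat set \<Rightarrow> bool" where
  "Acc n \<beta> f = acc n (Suc (\<beta> f)) \<beta> f"

lemma acc_eq_Acc: "d > \<beta> f \<Longrightarrow> acc n d \<beta> f = Acc n \<beta> f"
  unfolding Acc_def by (rule acc_stable) auto

lemma Acc_rec: "Acc n \<beta> f \<longleftrightarrow> (\<forall>C\<in>copies n. f \<in> C \<longrightarrow> (\<exists>e\<in>C - {f}. \<beta> e \<ge> \<beta> f \<or> \<not> Acc n \<beta> e))"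
proof -
  have "acc n (\<beta> f) \<beta> e = Acc n \<beta> e" if "\<not> \<beta> e \<ge> \<beta> f" for e
    by (rule acc_eq_Acc) (use that in auto)
  then show ?thesis unfolding Acc_def[of n \<beta> f] acc.simps by blast
qed

text \<open>The status of \<open>f\<close> is decided along edges of strictly decreasing birthtimes,
  so only times below \<open>\<beta> f\<close> enter.\<close>

lemma acc_cong:
  "\<beta> f = \<beta>' f \<Longrightarrow> (\<And>h. \<beta> h < \<beta> f \<or> \<beta>' h < \<beta> f \<Longrightarrow> \<beta> h = \<beta>' h) \<Longrightarrow> acc n d \<beta> f = acc n d \<beta>' f"
proof (induction d arbitrary: f)
  case (Suc d)
  have 1: "\<beta> e \<ge> \<beta> f \<longleftrightarrow> \<beta>' e \<ge> \<beta>' f" for e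
    using Suc.prems by (metis not_less)
  have "acc n d \<beta> e = acc n d \<beta>' e" if "\<not> \<beta> e \<ge> \<beta> f" for e
  proof (rule Suc.IH)
    show "\<beta> e = \<beta>' e" using that Suc.prems(2)[of e] by auto
    show "\<beta> h = \<beta>' h" if "\<beta> h < \<beta> e \<or> \<beta>' h < \<beta> e" for h
      using that \<open>\<not> \<beta> e \<ge> \<beta> f\<close> Suc.prems(2)[of h] by auto
  qed
  then show ?case unfolding acc.simps using 1 by blast
qed simp

lemma Acc_cong:
  "\<beta> f = \<beta>' f \<Longrightarrow> (\<And>h. \<beta> h < \<beta> f \<or> \<beta>' h < \<beta> f \<Longrightarrow> \<beta> h = \<beta>' h) \<Longrightarrow> Acc n \<beta> f = Acc n \<beta>' f"
  unfolding Acc_def using acc_cong[of \<beta> f \<beta>' n "Suc (\<beta> f)"] by simp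

text \<open>An entry \<open>(C, h)\<close> of a chain enters the copy \<open>C\<close> through the current edge and leaves it through \<open>h\<close>;
  \<open>P\<close> is the copy through which the first edge was reached.\<close>

fun chain :: "nat \<Rightarrow> nat set set \<Rightarrow> nat set \<Rightarrow> (nat set set \<times> nat set) list \<Rightarrow> bool" where
  "chain n P f [] = True"
| "chain n P f ((C, h) # cs) \<longleftrightarrow> C \<in> copies n \<and> C \<noteq> P \<and> f \<in> C \<and> h \<in> C \<and> h \<noteq> f \<and> chain n C h cs"

fun decr :: "(nat set \<Rightarrow> nat) \<Rightarrow> nat set \<Rightarrow> (nat set set \<times> nat set) list \<Rightarrow> bool" where
  "decr \<beta> f [] = True"
| "decr \<beta> f ((C, h) # cs) \<longleftrightarrow> (\<forall>e\<in>C - {f}. \<beta> e < \<beta> f) \<and> h \<noteq> f \<and> h \<in> C \<and> decr \<beta> h cs"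

abbreviation span :: "(nat set set \<times> nat set) list \<Rightarrow> nat set set" where
  "span cs \<equiv> \<Union>(fst ` set cs)"

text \<open>The difference is traced downwards: some copy blocks \<open>f\<close> under one timing
  only, so it contains an edge of \<open>J\<close>, where the chain ends, or an edge whose own
  status differs. The third assumption says that \<open>P\<close> cannot block \<open>f\<close>
  under either timing. At the next edge it holds for the copy just used, which contains the later
  edge \<open>f\<close>; hence consecutive copies are distinct.\<close>

lemma pivot_chain:
  assumes "\<And>e. e \<notin> J \<Longrightarrow> \<beta> e = \<beta>' e" "f \<notin> J"
    "\<exists>h\<in>P - {f}. \<beta> h \<ge> \<beta> f \<and> \<beta>' h \<ge> \<beta>' f"
    "acc n d \<beta> f \<noteq> acc n d \<beta>' f"
  shows "\<exists>cs. cs \<noteq> [] \<and> length cs \<le> d \<and> chain n P f cs \<and> snd (last cs) \<in> J \<and>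
      (\<beta> (snd (last cs)) < \<beta> f \<or> \<beta>' (snd (last cs)) < \<beta> f) \<and>
      (\<forall>e\<in>span cs. e = f \<or> e \<in> J \<or> \<beta> e < \<beta> f)"
  using assms(2-4)
proof (induction d arbitrary: f P)
  case (Suc d)
  note eq = assms(1)
  have ff: "\<beta>' f = \<beta> f" using eq Suc.prems(1) by simp
  have "\<exists>C\<in>copies n. f \<in> C \<and> ((\<forall>e\<in>C - {f}. \<beta> e < \<beta> f \<and> acc n d \<beta> e) \<noteq> (\<forall>e\<in>C - {f}. \<beta>' e < \<beta> f \<and> acc n d \<beta>' e))"
    using Suc.prems(3) not_acc_Suc[of n d \<beta> f] not_acc_Suc[of n d \<beta>' f] unfolding ff by metis
  then obtain C where C: "C \<in> copies n" "f \<in> C"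
    "(\<forall>e\<in>C - {f}. \<beta> e < \<beta> f \<and> acc n d \<beta> e) \<noteq> (\<forall>e\<in>C - {f}. \<beta>' e < \<beta> f \<and> acc n d \<beta>' e)" by blast
  have early: "\<beta> e < \<beta> f \<or> \<beta>' e < \<beta> f" if "e \<in> C - {f}" for e using C(3) that by blast
  have CP: "C \<noteq> P"
  proof
    assume "C = P"
    then obtain h where "h \<in> C - {f}" "\<beta> h \<ge> \<beta> f" "\<beta>' h \<ge> \<beta>' f" using Suc.prems(2) by blast
    then show False using early ff by force
  qed
  show ?case
  proof (cases "(C - {f}) \<inter> J = {}")
    case False
    then obtain i where i: "i \<in> C" "i \<noteq> f" "i \<in> J" by blast
    have "chain n P f [(C, i)]" using C CP i by simp
    moreover have "\<forall>e\<in>C. e = f \<or> e \<in> J \<or> \<beta> e < \<beta> f" using early eq by (metis DiffI singletonD)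
    ultimately show ?thesis using i early by (intro exI[of _ "[(C, i)]"]) auto
  next
    case True
    have same: "\<beta> e = \<beta>' e" if "e \<in> C - {f}" for e using True eq that by blast
    have "\<exists>e\<in>C - {f}. acc n d \<beta> e \<noteq> acc n d \<beta>' e" using C(3) same by force
    then obtain e where e: "e \<in> C - {f}" "acc n d \<beta> e \<noteq> acc n d \<beta>' e" by blast
    have eJ: "e \<notin> J" using True e by blast
    have elt: "\<beta> e < \<beta> f" using early[OF e(1)] same[OF e(1)] by simp
    have "\<exists>h\<in>C - {e}. \<beta> h \<ge> \<beta> e \<and> \<beta>' h \<ge> \<beta>' e"
      using C(2) e(1) elt same[OF e(1)] ff by (intro bexI[of _ f]) auto
    from Suc.IH[OF eJ this e(2)] obtain cs where cs: "cs \<noteq> []" "length cs \<le> d" "chain n C e cs"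
      "snd (last cs) \<in> J" "\<beta> (snd (last cs)) < \<beta> e \<or> \<beta>' (snd (last cs)) < \<beta> e"
      "\<forall>h\<in>span cs. h = e \<or> h \<in> J \<or> \<beta> h < \<beta> e" by blast
    have "\<forall>h\<in>C. h = f \<or> \<beta> h < \<beta> f" using early same by force
    then have "\<forall>h\<in>span ((C, e) # cs). h = f \<or> h \<in> J \<or> \<beta> h < \<beta> f"
      using cs(6) elt by fastforce
    then show ?thesis using cs C CP e elt
      by (intro exI[of _ "(C, e) # cs"]) auto
  qed
qed simp

text \<open>The same descent as in \<open>pivot_chain\<close>, comparing two depths. As both are at
  least \<open>L\<close>, neither recursion reaches its default value within fewer than
  \<open>L\<close> steps, so the chain has full length.\<close>

lemma truncation_chain:
  assumes "\<exists>h\<in>P - {f}. \<beta> h \<ge> \<beta> f" "d \<ge> L" "d' \<ge> L" "acc n d \<beta> f \<noteq> acc n d' \<beta> f"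
  shows "\<exists>cs. length cs = L \<and> chain n P f cs \<and> decr \<beta> f cs"
  using assms
proof (induction L arbitrary: f P d d')
  case (Suc L)
  obtain c c' where c: "d = Suc c" "d' = Suc c'" using Suc.prems by (metis Suc_le_D)
  obtain C where C: "C \<in> copies n" "f \<in> C"
    "(\<forall>e\<in>C - {f}. \<beta> e < \<beta> f \<and> acc n c \<beta> e) \<noteq> (\<forall>e\<in>C - {f}. \<beta> e < \<beta> f \<and> acc n c' \<beta> e)"
    using Suc.prems(4) not_acc_Suc[of n c \<beta> f] not_acc_Suc[of n c' \<beta> f] unfolding c by metis
  have early: "\<beta> e < \<beta> f" if "e \<in> C - {f}" for e using C(3) that by blast
  have CP: "C \<noteq> P" using Suc.prems(1) early by force
  obtain e where e: "e \<in> C - {f}" "acc n c \<beta> e \<noteq> acc n c' \<beta> e" using C(3) by blast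
  have "\<exists>h\<in>C - {e}. \<beta> h \<ge> \<beta> e" using C(2) e early[OF e(1)] by (intro bexI[of _ f]) auto
  then obtain cs where cs: "length cs = L" "chain n C e cs" "decr \<beta> e cs"
    using Suc.IH[of C e c c'] Suc.prems c e by auto
  then show ?case using C CP e early by (intro exI[of _ "(C, e) # cs"]) auto
qed auto

lemma decr_early: "decr \<beta> f cs \<Longrightarrow> e \<in> span cs \<Longrightarrow> e = f \<or> \<beta> e < \<beta> f"
proof (induction cs arbitrary: f)
  case (Cons c cs)
  then obtain C h where c: "c = (C, h)" by (cases c)
  then have h: "\<beta> h < \<beta> f" "decr \<beta> h cs" "\<forall>e\<in>C - {f}. \<beta> e < \<beta> f" using Cons.prems by auto
  have "e \<in> C \<or> e \<in> span cs" using Cons.prems(2) c by auto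
  then show ?case
  proof
    assume "e \<in> span cs"
    then show ?thesis using Cons.IH[OF h(2)] h(1) by fastforce
  qed (use h in auto)
qed simp

text \<open>A bad step glues a copy onto more than an edge without being contained in what is present already;
  strict balance makes its expected number polynomially small.\<close>

definition bad_step :: "nat set set \<Rightarrow> nat set set \<Rightarrow> bool" where
  "bad_step U C \<longleftrightarrow> \<not> C \<subseteq> U \<and> card (\<Union>C \<inter> \<Union>U) \<ge> 3"

fun has_bad :: "nat set set \<Rightarrow> nat set set list \<Rightarrow> bool" where
  "has_bad U [] = False"
| "has_bad U (C # Cs) \<longleftrightarrow> bad_step U C \<or> has_bad (U \<union> C) Cs"

fun attached :: "nat \<Rightarrow> nat set set \<Rightarrow> nat set set list \<Rightarrow> bool" where
  "attached n U [] = True"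
| "attached n U (C # Cs) \<longleftrightarrow> C \<in> copies n \<and> C \<inter> U \<noteq> {} \<and> attached n (U \<union> C) Cs"

fun clean :: "nat set set \<Rightarrow> nat set \<Rightarrow> (nat set set \<times> nat set) list \<Rightarrow> bool" where
  "clean U f [] = True"
| "clean U f ((C, h) # cs) \<longleftrightarrow> \<Union>C \<inter> \<Union>U = f \<and> f \<in> U \<and> clean (U \<union> C) h cs"

lemma chain_attached: "chain n P f cs \<Longrightarrow> f \<in> U \<Longrightarrow> attached n U (map fst cs)"
proof (induction cs arbitrary: U P f)
  case (Cons c cs)
  then show ?case by (cases c) auto
qed simp

lemma attached_append:
  "attached n U (Cs @ Ds) \<longleftrightarrow> attached n U Cs \<and> attached n (U \<union> \<Union>(set Cs)) Ds"
  by (induction Cs arbitrary: U) (auto simp: Un_assoc)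

lemma has_bad_append:
  "has_bad U (Cs @ Ds) \<longleftrightarrow> has_bad U Cs \<or> has_bad (U \<union> \<Union>(set Cs)) Ds"
  by (induction Cs arbitrary: U) (auto simp: Un_assoc)

lemma edge_eq: "f \<in> Kn_edges n \<Longrightarrow> h \<in> Kn_edges n \<Longrightarrow> h \<subseteq> f \<Longrightarrow> h = f"
  using edge_card2 card_subset_eq by metis

text \<open>Invariant: \<open>\<S>\<close> lists all copies inside \<open>U\<close>, and none but
  \<open>P\<close> passes through \<open>f\<close>. The next copy differs from \<open>P\<close>,
  hence is not inside \<open>U\<close>, and as the step is not bad it meets \<open>U\<close> in the
  two vertices of \<open>f\<close> only. By \<open>glued_copy\<close> the enlarged union contains no
  unlisted copy, and the exit edge is new, so the new copy is the only one through it.\<close>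

lemma chain_clean:
  assumes "U \<subseteq> Kn_edges n" "\<And>D. D \<in> copies n \<Longrightarrow> D \<subseteq> U \<Longrightarrow> D \<in> \<S>" "\<And>D. D \<in> \<S> \<Longrightarrow> D \<subseteq> U"
    "f \<in> U" "\<And>D. D \<in> \<S> \<Longrightarrow> f \<in> D \<Longrightarrow> D = P" "chain n P f cs" "\<not> has_bad U (map fst cs)"
  shows "(\<forall>D\<in>copies n. D \<subseteq> U \<union> span cs \<longrightarrow> D \<in> \<S> \<union> fst ` set cs) \<and>
    (cs \<noteq> [] \<longrightarrow> snd (last cs) \<notin> U) \<and> clean U f cs \<and>
    (\<forall>e\<in>U. e \<noteq> f \<longrightarrow> e \<notin> span cs)"
  using assms
proof (induction cs arbitrary: U \<S> P f)
  case Nil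
  show ?case using Nil.prems(2) by simp
next
  case (Cons c cs)
  obtain C h where c: "c = (C, h)" by (cases c)
  have C: "C \<in> copies n" "C \<noteq> P" "f \<in> C" "h \<in> C" "h \<noteq> f" "chain n C h cs"
    using Cons.prems(6) c by auto
  have nCU: "\<not> C \<subseteq> U" using Cons.prems(2,5) C(1-3) by blast
  have CE: "C \<subseteq> Kn_edges n" by (rule copy_edges[OF C(1)])
  have fE: "f \<in> Kn_edges n" using C(3) CE by auto
  have cut: "\<Union>C \<inter> \<Union>U = f"
  proof -
    have "f \<subseteq> \<Union>C \<inter> \<Union>U" using C(3) Cons.prems(4) by auto
    moreover have "card (\<Union>C \<inter> \<Union>U) < 3" using Cons.prems(7) nCU by (auto simp: c bad_step_def)
    moreover have "finite (\<Union>C \<inter> \<Union>U)" using copy_vertices[OF C(1)] by auto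
    ultimately show ?thesis using edge_card2[OF fE] card_seteq[of "\<Union>C \<inter> \<Union>U" f] by auto
  qed
  have only_f: "e = f" if "e \<in> C" "e \<in> U" for e
    using that cut edge_eq[OF fE, of e] CE by auto
  have UE': "U \<union> C \<subseteq> Kn_edges n" using Cons.prems(1) CE by auto
  have hU: "h \<notin> U" using only_f C by auto
  have IH: "(\<forall>D\<in>copies n. D \<subseteq> (U \<union> C) \<union> span cs \<longrightarrow> D \<in> insert C \<S> \<union> fst ` set cs) \<and>
    (cs \<noteq> [] \<longrightarrow> snd (last cs) \<notin> U \<union> C) \<and> clean (U \<union> C) h cs \<and>
    (\<forall>e\<in>U \<union> C. e \<noteq> h \<longrightarrow> e \<notin> span cs)"
  proof (rule Cons.IH[OF UE', where P = C])
    show "D \<in> insert C \<S>" if "D \<in> copies n" "D \<subseteq> U \<union> C" for D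
      using glued_copy[OF that(1) C(1) Cons.prems(1) Cons.prems(4) C(3) cut that(2)] Cons.prems(2) that by blast
    show "D \<subseteq> U \<union> C" if "D \<in> insert C \<S>" for D using that Cons.prems(3) by auto
    show "D = C" if "D \<in> insert C \<S>" "h \<in> D" for D using that hU Cons.prems(3) by auto
    show "h \<in> U \<union> C" using C(4) by simp
    show "chain n C h cs" by (rule C(6))
    show "\<not> has_bad (U \<union> C) (map fst cs)" using Cons.prems(7) c by simp
  qed
  have sp: "span (c # cs) = C \<union> span cs" using c by simp
  have "\<forall>D\<in>copies n. D \<subseteq> U \<union> span (c # cs) \<longrightarrow> D \<in> \<S> \<union> fst ` set (c # cs)"
    using IH unfolding sp Un_assoc c by simp
  moreover have "snd (last (c # cs)) \<notin> U" using IH hU c by (cases "cs = []") auto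
  moreover have "clean U f (c # cs)" using IH cut Cons.prems(4) c by simp
  moreover have "\<forall>e\<in>U. e \<noteq> f \<longrightarrow> e \<notin> span (c # cs)"
  proof (intro ballI impI)
    fix e assume e: "e \<in> U" "e \<noteq> f"
    then have "e \<notin> C" "e \<noteq> h" using only_f hU by auto
    then show "e \<notin> span (c # cs)" using IH e(1) unfolding sp by auto
  qed
  ultimately show ?case by blast
qed

text \<open>Without bad steps, two chains that leave a copy \<open>B\<close> through different edges form a tree of
  copies, so they cannot meet.\<close>

lemma two_chains_bad:
  assumes B: "B \<in> copies n" "b1 \<in> B" "b2 \<in> B" "b1 \<noteq> b2"
    and 1: "chain n B b1 cs1" "cs1 \<noteq> []" and 2: "chain n B b2 cs2" "cs2 \<noteq> []"
    and e: "snd (last cs1) = snd (last cs2)"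
  shows "has_bad B (map fst (cs1 @ cs2))"
proof (rule ccontr)
  assume "\<not> ?thesis"
  then have nb: "\<not> has_bad B (map fst cs1)" "\<not> has_bad (B \<union> span cs1) (map fst cs2)"
    by (auto simp: has_bad_append)
  have uniq: "D = B" if "D \<in> copies n" "D \<subseteq> B" for D
    using that copy_card[OF B(1)] copy_card[OF that(1)] card_subset_eq[OF copy_finite[OF B(1)]] by auto
  have A: "(\<forall>D\<in>copies n. D \<subseteq> B \<union> span cs1 \<longrightarrow> D \<in> {B} \<union> fst ` set cs1) \<and>
    (cs1 \<noteq> [] \<longrightarrow> snd (last cs1) \<notin> B) \<and> clean B b1 cs1 \<and>
    (\<forall>e\<in>B. e \<noteq> b1 \<longrightarrow> e \<notin> span cs1)"
    by (rule chain_clean[OF copy_edges[OF B(1)] _ _ B(2) _ 1(1) nb(1)]) (use uniq in auto)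
  have in_copies: "fst ` set cs \<subseteq> copies n" if "chain n P f cs" for P f cs
    using that by (induction n P f cs rule: chain.induct) auto
  have mem: "snd (last cs) \<in> span cs" if "chain n P f cs" "cs \<noteq> []" for P f cs
    using that by (induction n P f cs rule: chain.induct) (auto split: if_splits)
  have "(\<forall>D\<in>copies n. D \<subseteq> (B \<union> span cs1) \<union> span cs2 \<longrightarrow> D \<in> ({B} \<union> fst ` set cs1) \<union> fst ` set cs2) \<and>
    (cs2 \<noteq> [] \<longrightarrow> snd (last cs2) \<notin> B \<union> span cs1) \<and> clean (B \<union> span cs1) b2 cs2 \<and>
    (\<forall>e\<in>B \<union> span cs1. e \<noteq> b2 \<longrightarrow> e \<notin> span cs2)"
  proof (rule chain_clean[OF _ _ _ _ _ 2(1) nb(2)])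
    show "B \<union> span cs1 \<subseteq> Kn_edges n" using B(1) in_copies[OF 1(1)] copy_edges by blast
    \<comment> \<open>The second chain is run on top of the first. \<open>B\<close> remains the only
      listed copy through \<open>b2\<close>, since the first chain uses no edge of \<open>B\<close>
      except \<open>b1\<close>.\<close>
    show "D = B" if "D \<in> {B} \<union> fst ` set cs1" "b2 \<in> D" for D
      using that A B by auto
  qed (use A B in auto)
  then show False using mem[OF 1(1) 1(2)] 2(2) e by auto
qed

lemma chain_clean_base:
  assumes B: "B \<in> copies n" "b \<in> B" and ch: "chain n B b cs" and nb: "\<not> has_bad B (map fst cs)"
  shows "clean B b cs" "cs \<noteq> [] \<Longrightarrow> snd (last cs) \<notin> B"
proof -
  have uniq: "D = B" if "D \<in> copies n" "D \<subseteq> B" for D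
    using that copy_card[OF B(1)] copy_card[OF that(1)] card_subset_eq[OF copy_finite[OF B(1)]] by auto
  have A: "(\<forall>D\<in>copies n. D \<subseteq> B \<union> span cs \<longrightarrow> D \<in> {B} \<union> fst ` set cs) \<and>
    (cs \<noteq> [] \<longrightarrow> snd (last cs) \<notin> B) \<and> clean B b cs \<and>
    (\<forall>e\<in>B. e \<noteq> b \<longrightarrow> e \<notin> span cs)"
    by (rule chain_clean[OF copy_edges[OF B(1)] _ _ B(2) _ ch nb]) (use uniq in auto)
  then show "clean B b cs" "cs \<noteq> [] \<Longrightarrow> snd (last cs) \<notin> B" by auto
qed

end

section \<open>Expected numbers of attached copies\<close>

context balanced_graph
begin

definition early_trace :: "nat set set \<Rightarrow> ('a \<Rightarrow> nat) \<Rightarrow> 'a set" where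
  "early_trace U \<phi> = {x\<in>VH. \<phi> x \<in> \<Union>U}"

text \<open>There are \<open>eH\<close> choices for the edge of \<open>H\<close> that is mapped to
  \<open>f\<close>, at most two images for each of its ends, and at most \<open>n\<close> for every
  other vertex.\<close>

lemma copies_through_edge:
  assumes "f \<in> Kn_edges n"
  shows "card {C\<in>copies n. f \<in> C} \<le> 4 * eH * n ^ (vH - 2)"
proof -
  have "{C\<in>copies n. f \<in> C} \<subseteq> img ` (\<Union>h\<in>EH. {\<phi>\<in>emb n. \<phi> ` h = f})"
    unfolding copies_def by (auto simp: img_def)
  then have "card {C\<in>copies n. f \<in> C} \<le> card (img ` (\<Union>h\<in>EH. {\<phi>\<in>emb n. \<phi> ` h = f}))"
    by (intro card_mono) auto
  also have "\<dots> \<le> card (\<Union>h\<in>EH. {\<phi>\<in>emb n. \<phi> ` h = f})" by (rule card_image_le) auto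
  also have "\<dots> \<le> (\<Sum>h\<in>EH. card {\<phi>\<in>emb n. \<phi> ` h = f})" by (rule card_UN_le) auto
  also have "\<dots> \<le> (\<Sum>h\<in>EH. 4 * n ^ (vH - 2))"
  proof (rule sum_mono)
    fix h assume h: "h \<in> EH"
    have f2: "card f = 2" "finite f" using edge_card2[OF assms] by auto
    have "{\<phi>\<in>emb n. \<phi> ` h = f} \<subseteq> PiE VH (\<lambda>x. if x \<in> h then f else {1..n})"
      unfolding emb_def by (auto simp: PiE_iff extensional_def)
    then have "card {\<phi>\<in>emb n. \<phi> ` h = f} \<le> card (PiE VH (\<lambda>x. if x \<in> h then f else {1..n}))"
      using f2 by (intro card_mono finite_PiE) auto
    also have "\<dots> = (\<Prod>x\<in>VH. if x \<in> h then 2 else n)"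
      using f2 by (simp add: card_PiE if_distrib cong: if_cong)
    also have "\<dots> = 2 ^ card (VH \<inter> h) * n ^ card (VH \<inter> - h)" by (simp add: prod.If_cases)
    also have "VH \<inter> h = h" using EH_sub[OF h] by auto
    also have "VH \<inter> - h = VH - h" by auto
    also have "card (VH - h) = vH - 2"
      using EH_sub[OF h] EH_card[OF h] EH_finite[OF h] by (simp add: card_Diff_subset vH_def)
    finally show "card {\<phi>\<in>emb n. \<phi> ` h = f} \<le> 4 * n ^ (vH - 2)" using EH_card[OF h] by simp
  qed
  also have "\<dots> = 4 * eH * n ^ (vH - 2)" by (simp add: eH_def)
  finally show ?thesis .
qed

text \<open>Embeddings are grouped by the set \<open>S\<close> of vertices that land in
  \<open>U\<close>. There are at most \<open>2 ^ vH\<close> groups, each with at most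
  \<open>w ^ vH * n ^ (vH - card S)\<close> members, so it suffices to bound the contribution of a
  single trace by \<open>X\<close>.\<close>

lemma weighted_copies:
  assumes U: "U \<subseteq> Kn_edges n" and w: "card (\<Union>U) \<le> w" "1 \<le> w" and n: "n \<ge> 1" and q: "0 \<le> q"
    and X: "0 \<le> X"
    and bound: "\<And>\<phi>. \<phi> \<in> emb n \<Longrightarrow> img \<phi> \<in> \<C> \<Longrightarrow>
        real n ^ (vH - card (early_trace U \<phi>)) * q ^ card (img \<phi> - U) \<le> X"
    and sub: "\<C> \<subseteq> copies n"
  shows "(\<Sum>C\<in>\<C>. q ^ card (C - U)) \<le> (2 * real w) ^ vH * X"
proof -
  define \<Phi> where "\<Phi> = {\<phi>\<in>emb n. img \<phi> \<in> \<C>}"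
  have finU: "finite (\<Union>U)" by (rule finite_subset[of _ "{1..n}"]) (use U in \<open>auto simp: in_Kn_edges subset_iff\<close>)
  have fin\<Phi>: "finite \<Phi>" unfolding \<Phi>_def by simp
  have C\<Phi>: "\<C> = img ` \<Phi>" using sub unfolding \<Phi>_def copies_def by auto
  have "(\<Sum>C\<in>\<C>. q ^ card (C - U)) \<le> (\<Sum>\<phi>\<in>\<Phi>. q ^ card (img \<phi> - U))"
    unfolding C\<Phi> using sum_image_le[OF fin\<Phi>, of "\<lambda>C. q ^ card (C - U)" img] q by (simp add: o_def)
  also have "\<dots> = (\<Sum>S\<in>Pow VH. \<Sum>\<phi>\<in>{\<phi>\<in>\<Phi>. early_trace U \<phi> = S}. q ^ card (img \<phi> - U))"
    by (rule sum.group[symmetric]) (auto simp: fin\<Phi> early_trace_def)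
  also have "\<dots> \<le> (\<Sum>S\<in>Pow VH. real w ^ vH * X)"
  proof (rule sum_mono)
    fix S assume S: "S \<in> Pow VH"
    then have finS: "finite S" "card S \<le> vH"
      using finite_subset[OF _ finite_VH, of S] card_mono[OF finite_VH, of S] by (auto simp: vH_def)
    have np: "real n ^ (vH - card S) > 0" using n by simp
    have "{\<phi>\<in>\<Phi>. early_trace U \<phi> = S} \<subseteq> PiE VH (\<lambda>x. if x \<in> S then \<Union>U else {1..n})"
      unfolding \<Phi>_def emb_def early_trace_def by (auto simp: PiE_iff extensional_def)
    then have "card {\<phi>\<in>\<Phi>. early_trace U \<phi> = S} \<le> card (PiE VH (\<lambda>x. if x \<in> S then \<Union>U else {1..n}))"
      using finU by (intro card_mono finite_PiE) auto
    also have "\<dots> = (\<Prod>x\<in>VH. if x \<in> S then card (\<Union>U) else n)"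
      by (simp add: card_PiE if_distrib cong: if_cong)
    also have "\<dots> = card (\<Union>U) ^ card (VH \<inter> S) * n ^ card (VH \<inter> - S)" by (simp add: prod.If_cases)
    also have "VH \<inter> S = S" using S by auto
    also have "VH \<inter> - S = VH - S" by auto
    also have "card (VH - S) = vH - card S" using S finS by (simp add: card_Diff_subset vH_def)
    finally have c: "card {\<phi>\<in>\<Phi>. early_trace U \<phi> = S} \<le> card (\<Union>U) ^ card S * n ^ (vH - card S)" .
    have "card (\<Union>U) ^ card S \<le> w ^ card S" using w by (intro power_mono) auto
    also have "\<dots> \<le> w ^ vH" using w finS by (intro power_increasing) auto
    finally have "card {\<phi>\<in>\<Phi>. early_trace U \<phi> = S} \<le> w ^ vH * n ^ (vH - card S)"
      using c by (meson le_trans mult_le_mono1)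
    then have c': "real (card {\<phi>\<in>\<Phi>. early_trace U \<phi> = S}) \<le> real w ^ vH * real n ^ (vH - card S)"
      by (metis of_nat_le_iff of_nat_mult of_nat_power)
    have "(\<Sum>\<phi>\<in>{\<phi>\<in>\<Phi>. early_trace U \<phi> = S}. q ^ card (img \<phi> - U))
       \<le> real (card {\<phi>\<in>\<Phi>. early_trace U \<phi> = S}) * (X / real n ^ (vH - card S))"
      using bound np by (intro sum_bounded_above) (auto simp: \<Phi>_def field_simps)
    also have "\<dots> \<le> (real w ^ vH * real n ^ (vH - card S)) * (X / real n ^ (vH - card S))"
      using X by (intro mult_right_mono c') auto
    also have "\<dots> = real w ^ vH * X" using n by simp
    finally show "(\<Sum>\<phi>\<in>{\<phi>\<in>\<Phi>. early_trace U \<phi> = S}. q ^ card (img \<phi> - U)) \<le> real w ^ vH * X" .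
  qed
  also have "\<dots> = (2 * real w) ^ vH * X" by (simp add: card_Pow vH_def power_mult_distrib)
  finally show ?thesis .
qed

end

text \<open>Edges born in the first \<open>T\<close> of \<open>N\<close> slots are early. The density is doubled because an edge may be early in
  either of two independent samples. \<open>M\<close> bounds the number of early copies through an edge, \<open>\<eta>\<close> the
  price of an overlap, and \<open>L\<close> is the truncation depth.\<close>

locale sparse_scale = balanced_graph VH EH for VH :: "'a set" and EH :: "'a set set" +
  fixes n N T L :: nat and M \<eta> :: real
  assumes n_pos: "n \<ge> 1" and T_le: "T \<le> N" and N_pos: "N > 0" and q_le_1: "2 * real T / real N \<le> 1"
    and M1: "M \<ge> 1" and eta: "0 \<le> \<eta>" "\<eta> \<le> 1" and q_eta: "2 * real T / real N \<le> \<eta>"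
    and expected_copies: "real n ^ (vH - 2) * (2 * real T / real N) ^ (eH - 1) \<le> M"
    and expected_overlaps: "\<And>S. S \<subseteq> VH \<Longrightarrow> 3 \<le> card S \<Longrightarrow> card S < vH \<Longrightarrow>
       real n ^ (vH - card S) * (2 * real T / real N) ^ (eH - card {e\<in>EH. e \<subseteq> S}) \<le> \<eta>"
begin

definition "q = 2 * real T / real N"
text \<open>The price of attaching one more copy while at most \<open>2 * L\<close> copies are glued
  to a base copy: at most \<open>vH * (2 * L + 1)\<close> vertices are present then.\<close>

definition "\<Lambda> = (2 * (real vH * (2 * real L + 1))) ^ vH * M"

lemma q01: "0 \<le> q" "q \<le> 1" using q_le_1 by (auto simp: q_def)

lemma Lam_ge_1: "\<Lambda> \<ge> 1"
proof -
  have "1 * 1 \<le> real vH * (2 * real L + 1)" using vH_ge by (intro mult_mono) auto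
  then have "1 \<le> 2 * (real vH * (2 * real L + 1))" by simp
  then have "1 \<le> (2 * (real vH * (2 * real L + 1))) ^ vH" by (rule one_le_power)
  then show ?thesis unfolding \<Lambda>_def using M1 by (metis mult_ge1_I)
qed

text \<open>An edge of \<open>H\<close> not inside the trace has an end outside \<open>U\<close>, so
  its image is new. Edges inside the trace may be new as well, hence only an inequality.\<close>

lemma new_edges_ge:
  assumes "\<phi> \<in> emb n"
  shows "eH - card {e\<in>EH. e \<subseteq> early_trace U \<phi>} \<le> card (img \<phi> - U)"
proof -
  have "(\<lambda>e. \<phi> ` e) ` (EH - {e\<in>EH. e \<subseteq> early_trace U \<phi>}) \<subseteq> img \<phi> - U"
    using EH_sub unfolding img_def early_trace_def by auto
  then have "card ((\<lambda>e. \<phi> ` e) ` (EH - {e\<in>EH. e \<subseteq> early_trace U \<phi>})) \<le> card (img \<phi> - U)"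
    by (intro card_mono) (auto simp: img_def)
  moreover have "card ((\<lambda>e. \<phi> ` e) ` (EH - {e\<in>EH. e \<subseteq> early_trace U \<phi>})) = card (EH - {e\<in>EH. e \<subseteq> early_trace U \<phi>})"
    by (rule card_image) (rule inj_on_subset[OF img_inj[OF emb_inj[OF assms]]], auto)
  moreover have "card (EH - {e\<in>EH. e \<subseteq> early_trace U \<phi>}) = eH - card {e\<in>EH. e \<subseteq> early_trace U \<phi>}"
    by (subst card_Diff_subset) (auto simp: eH_def)
  ultimately show ?thesis by simp
qed

lemma overlap_bound:
  assumes "\<phi> \<in> emb n" "card (early_trace U \<phi>) \<ge> 3" "card (early_trace U \<phi>) < vH"
  shows "real n ^ (vH - card (early_trace U \<phi>)) * q ^ card (img \<phi> - U) \<le> \<eta>"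
proof -
  have "q ^ card (img \<phi> - U) \<le> q ^ (eH - card {e\<in>EH. e \<subseteq> early_trace U \<phi>})"
    using new_edges_ge[OF assms(1)] q01 by (intro power_decreasing) auto
  then have "real n ^ (vH - card (early_trace U \<phi>)) * q ^ card (img \<phi> - U)
     \<le> real n ^ (vH - card (early_trace U \<phi>)) * q ^ (eH - card {e\<in>EH. e \<subseteq> early_trace U \<phi>})"
    by (intro mult_left_mono) auto
  also have "\<dots> \<le> \<eta>" unfolding q_def by (rule expected_overlaps) (use assms in \<open>auto simp: early_trace_def\<close>)
  finally show ?thesis .
qed

lemma trace_le: "card (early_trace U \<phi>) \<le> vH"
  unfolding early_trace_def vH_def by (intro card_mono) auto

text \<open>If the trace is a single edge, the weight is the expected number of early copies through
  it, at most \<open>M\<close>. A larger proper trace costs at most \<open>\<eta>\<close>, and a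
  full trace leaves no free vertex, so its weight is at most 1.\<close>

lemma step_sum:
  assumes U: "U \<subseteq> Kn_edges n" and w: "card (\<Union>U) \<le> w" "1 \<le> w"
  shows "(\<Sum>C\<in>{C\<in>copies n. C \<inter> U \<noteq> {}}. q ^ card (C - U)) \<le> (2 * real w) ^ vH * M"
proof (rule weighted_copies[OF U w n_pos q01(1)])
  fix \<phi> assume \<phi>: "\<phi> \<in> emb n" "img \<phi> \<in> {C\<in>copies n. C \<inter> U \<noteq> {}}"
  then obtain h where h: "h \<in> EH" "\<phi> ` h \<in> U" by (auto simp: img_def)
  let ?S = "early_trace U \<phi>"
  have hS: "h \<subseteq> ?S" using h EH_sub unfolding early_trace_def by auto
  have finS: "finite ?S" unfolding early_trace_def by simp
  have "card ?S \<ge> 2" using card_mono[OF finS hS] EH_card h by simp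
  then consider "card ?S = 2" | "card ?S \<ge> 3" "card ?S < vH" | "card ?S = vH"
    using trace_le[of U \<phi>] by linarith
  then show "real n ^ (vH - card ?S) * q ^ card (img \<phi> - U) \<le> M"
  proof cases
    case 1
    then have Sh: "?S = h" using card_subset_eq[OF finS hS] EH_card h by simp
    have "{e\<in>EH. e \<subseteq> ?S} = {h}"
      using h EH_card card_subset_eq[OF EH_finite[OF h(1)]] unfolding Sh by auto
    then have "eH - 1 \<le> card (img \<phi> - U)" using new_edges_ge[OF \<phi>(1), of U] by simp
    then have "q ^ card (img \<phi> - U) \<le> q ^ (eH - 1)" using q01 by (intro power_decreasing) auto
    then have "real n ^ (vH - card ?S) * q ^ card (img \<phi> - U) \<le> real n ^ (vH - 2) * q ^ (eH - 1)"
      unfolding 1 by (intro mult_left_mono) auto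
    also have "\<dots> \<le> M" using expected_copies by (simp add: q_def)
    finally show ?thesis .
  next
    case 2
    show ?thesis using overlap_bound[OF \<phi>(1) 2] eta M1 by linarith
  next
    case 3
    then show ?thesis using order_trans[OF power_le_one[OF q01] M1] by simp
  qed
qed (use M1 in auto)

lemma step_sum_bad:
  assumes U: "U \<subseteq> Kn_edges n" and w: "card (\<Union>U) \<le> w" "1 \<le> w"
  shows "(\<Sum>C\<in>{C\<in>copies n. C \<inter> U \<noteq> {} \<and> bad_step U C}. q ^ card (C - U)) \<le> (2 * real w) ^ vH * \<eta>"
proof (rule weighted_copies[OF U w n_pos q01(1)])
  fix \<phi> assume \<phi>: "\<phi> \<in> emb n" "img \<phi> \<in> {C\<in>copies n. C \<inter> U \<noteq> {} \<and> bad_step U C}"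
  let ?S = "early_trace U \<phi>"
  have "\<phi> ` ?S = \<Union>(img \<phi>) \<inter> \<Union>U" unfolding Union_img early_trace_def by auto
  moreover have "card (\<phi> ` ?S) = card ?S"
    by (rule card_image) (rule inj_on_subset[OF emb_inj[OF \<phi>(1)]], auto simp: early_trace_def)
  ultimately have "card ?S \<ge> 3" using \<phi>(2) by (simp add: bad_step_def)
  then consider "card ?S \<ge> 3" "card ?S < vH" | "card ?S = vH"
    using trace_le[of U \<phi>] by linarith
  then show "real n ^ (vH - card ?S) * q ^ card (img \<phi> - U) \<le> \<eta>"
  proof cases
    case 1
    show ?thesis using overlap_bound[OF \<phi>(1) 1] .
  next
    case 2
    \<comment> \<open>All vertices are old, but at least one edge is new and costs a factor
      \<open>q\<close>.\<close>
    have "finite (img \<phi> - U)" by (auto simp: img_def)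
    moreover have "img \<phi> - U \<noteq> {}" using \<phi>(2) by (auto simp: bad_step_def)
    ultimately have "card (img \<phi> - U) \<ge> 1" by (simp add: Suc_le_eq card_gt_0_iff)
    then have "q ^ card (img \<phi> - U) \<le> q ^ 1" using q01 by (intro power_decreasing) auto
    then show ?thesis using 2 q_eta by (simp add: q_def)
  qed
qed (use eta in auto)

definition att_lists :: "nat set set \<Rightarrow> nat \<Rightarrow> nat set set list set" where
  "att_lists U m = {Cs. length Cs = m \<and> attached n U Cs}"

lemma att_lists_Suc:
  "att_lists U (Suc m) = (\<lambda>(C, Cs). C # Cs) ` (SIGMA C:{C\<in>copies n. C \<inter> U \<noteq> {}}. att_lists (U \<union> C) m)"
  unfolding att_lists_def by (force simp: length_Suc_conv image_iff)

lemma att_lists_0: "att_lists U 0 = {[]}" unfolding att_lists_def by auto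

lemma finite_att_lists [simp]: "finite (att_lists U m)"
  by (induction m arbitrary: U) (auto simp: att_lists_0 att_lists_Suc intro!: finite_SigmaI)

lemma attached_copies: "attached n U Cs \<Longrightarrow> set Cs \<subseteq> copies n"
  by (induction Cs arbitrary: U) auto

text \<open>The weight factorises because every new edge of a list is counted at the first copy that
  contains it.\<close>

lemma att_sum_Suc:
  "(\<Sum>Cs\<in>att_lists U (Suc m). q ^ card (\<Union>(set Cs) - U) * g Cs) =
   (\<Sum>C\<in>{C\<in>copies n. C \<inter> U \<noteq> {}}. q ^ card (C - U) *
     (\<Sum>Cs\<in>att_lists (U \<union> C) m. q ^ card (\<Union>(set Cs) - (U \<union> C)) * g (C # Cs)))"
proof -
  have "(\<Sum>Cs\<in>att_lists U (Suc m). q ^ card (\<Union>(set Cs) - U) * g Cs) =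
    (\<Sum>(C, Cs)\<in>(SIGMA C:{C\<in>copies n. C \<inter> U \<noteq> {}}. att_lists (U \<union> C) m). q ^ card (\<Union>(set (C # Cs)) - U) * g (C # Cs))"
    unfolding att_lists_Suc by (subst sum.reindex) (auto simp: inj_on_def split_def)
  also have "\<dots> = (\<Sum>C\<in>{C\<in>copies n. C \<inter> U \<noteq> {}}. \<Sum>Cs\<in>att_lists (U \<union> C) m. q ^ card (\<Union>(set (C # Cs)) - U) * g (C # Cs))"
    by (subst sum.Sigma) auto
  also have "\<dots> = (\<Sum>C\<in>{C\<in>copies n. C \<inter> U \<noteq> {}}. q ^ card (C - U) *
     (\<Sum>Cs\<in>att_lists (U \<union> C) m. q ^ card (\<Union>(set Cs) - (U \<union> C)) * g (C # Cs)))"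
  proof (rule sum.cong)
    fix C assume C: "C \<in> {C\<in>copies n. C \<inter> U \<noteq> {}}"
    have "q ^ card (\<Union>(set (C # Cs)) - U) = q ^ card (C - U) * q ^ card (\<Union>(set Cs) - (U \<union> C))"
      if "Cs \<in> att_lists (U \<union> C) m" for Cs
    proof -
      have "finite (\<Union>(set Cs))"
        using that attached_copies[of "U \<union> C" Cs] copy_finite unfolding att_lists_def
        by (intro finite_Union) auto
      moreover have "\<Union>(set (C # Cs)) - U = (C - U) \<union> (\<Union>(set Cs) - (U \<union> C))" by auto
      moreover have "finite C" using C copy_finite by auto
      ultimately have "card (\<Union>(set (C # Cs)) - U) = card (C - U) + card (\<Union>(set Cs) - (U \<union> C))"
        by (simp only:) (rule card_Un_disjoint, auto)
      then show ?thesis by (simp add: power_add)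
    qed
    then show "(\<Sum>Cs\<in>att_lists (U \<union> C) m. q ^ card (\<Union>(set (C # Cs)) - U) * g (C # Cs)) =
      q ^ card (C - U) * (\<Sum>Cs\<in>att_lists (U \<union> C) m. q ^ card (\<Union>(set Cs) - (U \<union> C)) * g (C # Cs))"
      unfolding sum_distrib_left by (intro sum.cong) (auto simp: mult.assoc)
  qed simp
  finally show ?thesis .
qed

lemma union_vertices:
  assumes "C \<in> copies n" "U \<subseteq> Kn_edges n" "card (\<Union>U) + Suc m * vH \<le> w"
  shows "U \<union> C \<subseteq> Kn_edges n" "card (\<Union>(U \<union> C)) + m * vH \<le> w"
proof -
  show "U \<union> C \<subseteq> Kn_edges n" using assms copy_edges by auto
  have "card (\<Union>(U \<union> C)) \<le> card (\<Union>U) + card (\<Union>C)" by (simp add: Union_Un_distrib card_Un_le)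
  then show "card (\<Union>(U \<union> C)) + m * vH \<le> w" using assms copy_vertices(2)[OF assms(1)] by simp
qed

lemma att_sum:
  assumes "U \<subseteq> Kn_edges n" "card (\<Union>U) + m * vH \<le> w" "1 \<le> w"
  shows "(\<Sum>Cs\<in>att_lists U m. q ^ card (\<Union>(set Cs) - U)) \<le> ((2 * real w) ^ vH * M) ^ m"
  using assms
proof (induction m arbitrary: U)
  case (Suc m)
  let ?l = "(2 * real w) ^ vH * M"
  have lpos: "0 \<le> ?l" using M1 by simp
  have "(\<Sum>Cs\<in>att_lists U (Suc m). q ^ card (\<Union>(set Cs) - U)) =
    (\<Sum>C\<in>{C\<in>copies n. C \<inter> U \<noteq> {}}. q ^ card (C - U) *
     (\<Sum>Cs\<in>att_lists (U \<union> C) m. q ^ card (\<Union>(set Cs) - (U \<union> C))))"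
    using att_sum_Suc[where U = U and m = m and g = "\<lambda>_. 1"] by simp
  also have "\<dots> \<le> (\<Sum>C\<in>{C\<in>copies n. C \<inter> U \<noteq> {}}. q ^ card (C - U) * ?l ^ m)"
    using Suc.IH union_vertices Suc.prems q01 by (intro sum_mono mult_left_mono) auto
  also have "\<dots> = (\<Sum>C\<in>{C\<in>copies n. C \<inter> U \<noteq> {}}. q ^ card (C - U)) * ?l ^ m" by (simp add: sum_distrib_right)
  also have "\<dots> \<le> ?l * ?l ^ m" using lpos Suc.prems by (intro mult_right_mono step_sum) auto
  finally show ?case by simp
qed (simp add: att_lists_0)

text \<open>Summing over the \<open>m\<close> possible positions of a bad step, that step
  contributes \<open>\<eta>\<close> in place of \<open>M\<close>; since \<open>M \<ge> 1\<close>,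
  the factor \<open>M\<close> may be kept for a uniform bound.\<close>

lemma att_sum_bad:
  assumes "U \<subseteq> Kn_edges n" "card (\<Union>U) + m * vH \<le> w" "1 \<le> w"
  shows "(\<Sum>Cs\<in>att_lists U m. q ^ card (\<Union>(set Cs) - U) * of_bool (has_bad U Cs)) \<le> real m * ((2 * real w) ^ vH * M) ^ m * \<eta>"
  using assms
proof (induction m arbitrary: U)
  case (Suc m)
  let ?l = "(2 * real w) ^ vH * M"
  let ?D = "{C\<in>copies n. C \<inter> U \<noteq> {}}"
  have lpos: "0 \<le> ?l" using M1 by simp
  have "(\<Sum>Cs\<in>att_lists U (Suc m). q ^ card (\<Union>(set Cs) - U) * of_bool (has_bad U Cs)) =
    (\<Sum>C\<in>?D. q ^ card (C - U) *
     (\<Sum>Cs\<in>att_lists (U \<union> C) m. q ^ card (\<Union>(set Cs) - (U \<union> C)) * of_bool (has_bad U (C # Cs))))"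
    by (rule att_sum_Suc)
  also have "\<dots> \<le> (\<Sum>C\<in>?D. q ^ card (C - U) * of_bool (bad_step U C) * ?l ^ m + q ^ card (C - U) * (real m * ?l ^ m * \<eta>))"
  proof (rule sum_mono)
    fix C assume C: "C \<in> ?D"
    let ?f = "\<lambda>Cs. q ^ card (\<Union>(set Cs) - (U \<union> C))"
    have uv: "U \<union> C \<subseteq> Kn_edges n" "card (\<Union>(U \<union> C)) + m * vH \<le> w" using union_vertices[where C = C and U = U and m = m and w = w] C Suc.prems by auto
    have "(\<Sum>Cs\<in>att_lists (U \<union> C) m. ?f Cs * of_bool (has_bad U (C # Cs))) \<le>
      (\<Sum>Cs\<in>att_lists (U \<union> C) m. of_bool (bad_step U C) * ?f Cs + ?f Cs * of_bool (has_bad (U \<union> C) Cs))"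
      using q01 by (intro sum_mono) auto
    also have "\<dots> = of_bool (bad_step U C) * (\<Sum>Cs\<in>att_lists (U \<union> C) m. ?f Cs) + (\<Sum>Cs\<in>att_lists (U \<union> C) m. ?f Cs * of_bool (has_bad (U \<union> C) Cs))"
      by (simp add: sum.distrib sum_distrib_left)
    also have "\<dots> \<le> of_bool (bad_step U C) * ?l ^ m + real m * ?l ^ m * \<eta>"
      using Suc.IH[OF uv Suc.prems(3)] att_sum[OF uv Suc.prems(3)] by (intro add_mono mult_left_mono) auto
    finally have "q ^ card (C - U) * (\<Sum>Cs\<in>att_lists (U \<union> C) m. ?f Cs * of_bool (has_bad U (C # Cs)))
      \<le> q ^ card (C - U) * (of_bool (bad_step U C) * ?l ^ m + real m * ?l ^ m * \<eta>)"
      using q01 by (intro mult_left_mono) auto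
    then show "q ^ card (C - U) * (\<Sum>Cs\<in>att_lists (U \<union> C) m. ?f Cs * of_bool (has_bad U (C # Cs)))
      \<le> q ^ card (C - U) * of_bool (bad_step U C) * ?l ^ m + q ^ card (C - U) * (real m * ?l ^ m * \<eta>)"
      by (simp add: algebra_simps)
  qed
  also have "\<dots> = (\<Sum>C\<in>?D. q ^ card (C - U) * of_bool (bad_step U C)) * ?l ^ m + (\<Sum>C\<in>?D. q ^ card (C - U)) * (real m * ?l ^ m * \<eta>)"
    by (simp only: sum.distrib sum_distrib_right)
  also have "(\<Sum>C\<in>?D. q ^ card (C - U) * of_bool (bad_step U C)) = (\<Sum>C\<in>{C\<in>copies n. C \<inter> U \<noteq> {} \<and> bad_step U C}. q ^ card (C - U))"
    by (rule sum.mono_neutral_cong_right) auto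
  also have "(\<Sum>C\<in>{C\<in>copies n. C \<inter> U \<noteq> {} \<and> bad_step U C}. q ^ card (C - U)) * ?l ^ m + (\<Sum>C\<in>?D. q ^ card (C - U)) * (real m * ?l ^ m * \<eta>)
     \<le> ((2 * real w) ^ vH * \<eta>) * ?l ^ m + ?l * (real m * ?l ^ m * \<eta>)"
    using lpos Suc.prems eta by (intro add_mono mult_right_mono step_sum step_sum_bad) auto
  also have "\<dots> \<le> (?l * \<eta>) * ?l ^ m + ?l * (real m * ?l ^ m * \<eta>)"
  proof -
    have "(2 * real w) ^ vH * \<eta> \<le> ?l * \<eta>"
      using M1 eta mult_left_mono[of 1 M "(2 * real w) ^ vH"] by (intro mult_right_mono) auto
    then have "((2 * real w) ^ vH * \<eta>) * ?l ^ m \<le> (?l * \<eta>) * ?l ^ m"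
      by (rule mult_right_mono) (use lpos in simp)
    then show ?thesis by simp
  qed
  also have "\<dots> = real (Suc m) * ?l ^ Suc m * \<eta>" by (simp add: algebra_simps)
  finally show ?case .
qed (simp add: att_lists_0)

text \<open>The length \<open>2 * L\<close> leaves room for two chains of length at most
  \<open>L\<close> that start at the same copy \<open>B\<close>. Exit edges are dropped, since only
  the union of the copies matters.\<close>

definition bad_lists :: "nat set set \<Rightarrow> nat set set list set" where
  "bad_lists B = {Cs. length Cs \<le> 2 * L \<and> attached n B Cs \<and> has_bad B Cs}"

text \<open>One factor \<open>2 * L + 1\<close> for the length of the list, one for the position of
  its bad step, and one, together with \<open>eH\<close>, for the choice of an edge of the list in
  \<open>pr_bad_list_pair\<close>.\<close>

definition "\<rho> = real eH * (2 * real L + 1) ^ 3 * \<Lambda> ^ (2 * L) * \<eta>"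

lemma rho_nonneg: "\<rho> \<ge> 0" unfolding \<rho>_def using eta Lam_ge_1 by simp

lemma bad_lists_eq: "bad_lists B = (\<Union>m\<in>{..2 * L}. {Cs\<in>att_lists B m. has_bad B Cs})"
  unfolding bad_lists_def att_lists_def by auto

lemma finite_bad_lists [simp]: "finite (bad_lists B)"
proof -
  have "finite (\<Union>m\<in>{..2 * L}. att_lists B m)" by simp
  then show ?thesis by (rule rev_finite_subset) (auto simp: bad_lists_eq)
qed

lemma bad_list_card:
  assumes "Cs \<in> bad_lists B" shows "card (\<Union>(set Cs) - B) \<le> 2 * L * eH" "\<Union>(set Cs) - B \<subseteq> Kn_edges n" "1 \<le> L"
proof -
  have s: "set Cs \<subseteq> copies n" "length Cs \<le> 2 * L" "Cs \<noteq> []"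
    using assms attached_copies unfolding bad_lists_def by auto
  have fin: "finite (\<Union>(set Cs))" using s(1) copy_finite by auto
  have "card (\<Union>(set Cs) - B) \<le> card (\<Union>(set Cs))" by (rule card_mono[OF fin]) auto
  also have "\<dots> \<le> (\<Sum>C\<in>set Cs. card C)" using card_UN_le[of "set Cs" "\<lambda>C. C"] by simp
  also have "\<dots> = (\<Sum>C\<in>set Cs. eH)" using s(1) copy_card by (intro sum.cong) auto
  also have "\<dots> = card (set Cs) * eH" by simp
  also have "\<dots> \<le> 2 * L * eH" using s(2) card_length[of Cs] by (intro mult_right_mono) linarith+
  finally show "card (\<Union>(set Cs) - B) \<le> 2 * L * eH" .
  show "\<Union>(set Cs) - B \<subseteq> Kn_edges n" using s copy_edges by blast
  show "1 \<le> L" using s by (cases L) auto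
qed

lemma bad_lists_sum:
  assumes B: "B \<in> copies n"
  shows "(\<Sum>Cs\<in>bad_lists B. q ^ card (\<Union>(set Cs) - B)) \<le> real (2 * L + 1) * (real (2 * L) * \<Lambda> ^ (2 * L) * \<eta>)"
proof -
  have w1: "1 \<le> vH * (2 * L + 1)" using vH_ge by auto
  have "(\<Sum>Cs\<in>bad_lists B. q ^ card (\<Union>(set Cs) - B)) = (\<Sum>m\<in>{..2 * L}. \<Sum>Cs\<in>{Cs\<in>att_lists B m. has_bad B Cs}. q ^ card (\<Union>(set Cs) - B))"
    unfolding bad_lists_eq
  proof (rule sum.UNION_disjoint)
    show "\<forall>m\<in>{..2 * L}. finite {Cs\<in>att_lists B m. has_bad B Cs}"
      using finite_subset[OF _ finite_att_lists] by fastforce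
  qed (auto simp: att_lists_def)
  also have "\<dots> \<le> (\<Sum>m\<in>{..2 * L}. real (2 * L) * \<Lambda> ^ (2 * L) * \<eta>)"
  proof (rule sum_mono)
    fix m assume m: "m \<in> {..2 * L}"
    have "(\<Sum>Cs\<in>{Cs\<in>att_lists B m. has_bad B Cs}. q ^ card (\<Union>(set Cs) - B)) =
       (\<Sum>Cs\<in>att_lists B m. q ^ card (\<Union>(set Cs) - B) * of_bool (has_bad B Cs))"
      by (rule sum.mono_neutral_cong_left) auto
    also have "\<dots> \<le> real m * ((2 * real (vH * (2 * L + 1))) ^ vH * M) ^ m * \<eta>"
    proof (rule att_sum_bad[OF copy_edges[OF B] _ w1])
      have "m * vH \<le> 2 * L * vH" using m by (intro mult_right_mono) auto
      then show "card (\<Union>B) + m * vH \<le> vH * (2 * L + 1)" using copy_vertices[OF B] by (simp add: algebra_simps)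
    qed
    also have "(2 * real (vH * (2 * L + 1))) ^ vH * M = \<Lambda>" by (simp add: \<Lambda>_def algebra_simps)
    also have "real m * \<Lambda> ^ m * \<eta> \<le> real (2 * L) * \<Lambda> ^ (2 * L) * \<eta>"
      using m Lam_ge_1 eta by (intro mult_right_mono mult_mono power_increasing) auto
    finally show "(\<Sum>Cs\<in>{Cs\<in>att_lists B m. has_bad B Cs}. q ^ card (\<Union>(set Cs) - B)) \<le> real (2 * L) * \<Lambda> ^ (2 * L) * \<eta>" .
  qed
  also have "\<dots> = real (2 * L + 1) * (real (2 * L) * \<Lambda> ^ (2 * L) * \<eta>)" by simp
  finally show ?thesis .
qed

abbreviation "\<Omega> \<equiv> timings (Kn_edges n) N"

lemma finite_Omega: "finite \<Omega>" by simp

lemma pr_bad_list: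
  assumes B: "B \<in> copies n"
  shows "pr \<Omega> (\<lambda>x. \<exists>Cs\<in>bad_lists B. \<forall>e\<in>\<Union>(set Cs) - B. x e < T) \<le> \<rho>"
proof -
  have "pr \<Omega> (\<lambda>x. \<exists>Cs\<in>bad_lists B. \<forall>e\<in>\<Union>(set Cs) - B. x e < T)
     \<le> (\<Sum>Cs\<in>bad_lists B. pr \<Omega> (\<lambda>x. \<forall>e\<in>\<Union>(set Cs) - B. x e < T))"
    by (rule pr_Bex) auto
  also have "\<dots> \<le> (\<Sum>Cs\<in>bad_lists B. q ^ card (\<Union>(set Cs) - B))"
  proof (rule sum_mono)
    fix Cs assume "Cs \<in> bad_lists B"
    then have "pr \<Omega> (\<lambda>x. \<forall>e\<in>\<Union>(set Cs) - B. x e < T) = (real T / real N) ^ card (\<Union>(set Cs) - B)"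
      by (intro pr_early) (use bad_list_card(2) T_le N_pos in auto)
    also have "\<dots> \<le> q ^ card (\<Union>(set Cs) - B)"
      by (intro power_mono) (auto simp: q_def divide_right_mono)
    finally show "pr \<Omega> (\<lambda>x. \<forall>e\<in>\<Union>(set Cs) - B. x e < T) \<le> q ^ card (\<Union>(set Cs) - B)" .
  qed
  also have "\<dots> \<le> real (2 * L + 1) * (real (2 * L) * \<Lambda> ^ (2 * L) * \<eta>)" by (rule bad_lists_sum[OF B])
  also have "\<dots> \<le> \<rho>"
  proof -
    have "real (2 * L + 1) * real (2 * L) \<le> real eH * (2 * real L + 1) ^ 3"
    proof -
      have "real (2 * L + 1) * real (2 * L) \<le> 1 * (2 * real L + 1) ^ 2" by (simp add: power2_eq_square algebra_simps)
      also have "\<dots> \<le> real eH * (2 * real L + 1) ^ 3" using eH_ge by (intro mult_mono power_increasing) auto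
      finally show ?thesis .
    qed
    then show ?thesis unfolding \<rho>_def mult.assoc[symmetric] using Lam_ge_1 eta by (intro mult_right_mono) auto
  qed
  finally show ?thesis .
qed

text \<open>Summing over \<open>i\<close> counts each list once per new edge, that is at most
  \<open>2 * L * eH\<close> times. Thus the sum over all edges of the complete graph costs no power
  of \<open>n\<close>.\<close>

lemma pr_bad_list_pair:
  assumes B: "B \<in> copies n"
  shows "(\<Sum>i\<in>Kn_edges n. pr (\<Omega> \<times> \<Omega>) (\<lambda>(x, y). \<exists>Cs\<in>bad_lists B. i \<in> \<Union>(set Cs) - B \<and> (\<forall>e\<in>\<Union>(set Cs) - B. x e < T \<or> y e < T))) \<le> \<rho>"
proof -
  let ?W = "\<lambda>Cs. \<Union>(set Cs) - B"
  have fin: "finite (\<Omega> \<times> \<Omega>)" by simp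
  have "(\<Sum>i\<in>Kn_edges n. pr (\<Omega> \<times> \<Omega>) (\<lambda>(x, y). \<exists>Cs\<in>bad_lists B. i \<in> ?W Cs \<and> (\<forall>e\<in>?W Cs. x e < T \<or> y e < T)))
    \<le> (\<Sum>i\<in>Kn_edges n. \<Sum>Cs\<in>bad_lists B. of_bool (i \<in> ?W Cs) * q ^ card (?W Cs))"
  proof (rule sum_mono)
    fix i
    have "pr (\<Omega> \<times> \<Omega>) (\<lambda>(x, y). \<exists>Cs\<in>bad_lists B. i \<in> ?W Cs \<and> (\<forall>e\<in>?W Cs. x e < T \<or> y e < T))
      = pr (\<Omega> \<times> \<Omega>) (\<lambda>z. \<exists>Cs\<in>bad_lists B. case z of (x, y) \<Rightarrow> i \<in> ?W Cs \<and> (\<forall>e\<in>?W Cs. x e < T \<or> y e < T))"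
      by (rule pr_cong) auto
    also have "\<dots> \<le> (\<Sum>Cs\<in>bad_lists B. pr (\<Omega> \<times> \<Omega>) (\<lambda>(x, y). i \<in> ?W Cs \<and> (\<forall>e\<in>?W Cs. x e < T \<or> y e < T)))"
      by (rule pr_Bex[OF fin]) simp
    also have "\<dots> \<le> (\<Sum>Cs\<in>bad_lists B. of_bool (i \<in> ?W Cs) * q ^ card (?W Cs))"
    proof (rule sum_mono)
      fix Cs assume Cs: "Cs \<in> bad_lists B"
      have "pr (\<Omega> \<times> \<Omega>) (\<lambda>(x, y). \<forall>e\<in>?W Cs. x e < T \<or> y e < T) \<le> q ^ card (?W Cs)"
        unfolding q_def by (rule pr_early_pair[OF finite_Kn_edges bad_list_card(2)[OF Cs] T_le N_pos])
      then show "pr (\<Omega> \<times> \<Omega>) (\<lambda>(x, y). i \<in> ?W Cs \<and> (\<forall>e\<in>?W Cs. x e < T \<or> y e < T)) \<le> of_bool (i \<in> ?W Cs) * q ^ card (?W Cs)"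
        unfolding pr_def by (cases "i \<in> ?W Cs") (simp_all del: UN_iff Union_iff Diff_iff)
    qed
    finally show "pr (\<Omega> \<times> \<Omega>) (\<lambda>(x, y). \<exists>Cs\<in>bad_lists B. i \<in> ?W Cs \<and> (\<forall>e\<in>?W Cs. x e < T \<or> y e < T))
      \<le> (\<Sum>Cs\<in>bad_lists B. of_bool (i \<in> ?W Cs) * q ^ card (?W Cs))" .
  qed
  also have "\<dots> = (\<Sum>Cs\<in>bad_lists B. (\<Sum>i\<in>Kn_edges n. of_bool (i \<in> ?W Cs)) * q ^ card (?W Cs))"
    by (subst sum.swap) (simp add: sum_distrib_right)
  also have "\<dots> \<le> (\<Sum>Cs\<in>bad_lists B. real (2 * L * eH) * q ^ card (?W Cs))"
  proof (intro sum_mono mult_right_mono)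
    fix Cs assume Cs: "Cs \<in> bad_lists B"
    have "(\<Sum>i\<in>Kn_edges n. of_bool (i \<in> ?W Cs) :: real) = real (card (Kn_edges n \<inter> ?W Cs))"
      by (simp add: of_bool_def sum.If_cases Int_def)
    also have "\<dots> = real (card (?W Cs))" using bad_list_card(2)[OF Cs] by (simp add: Int_absorb1)
    finally show "(\<Sum>i\<in>Kn_edges n. of_bool (i \<in> ?W Cs)) \<le> real (2 * L * eH)"
      using bad_list_card(1)[OF Cs] by linarith
  qed (use q01 in auto)
  also have "\<dots> \<le> real (2 * L * eH) * (real (2 * L + 1) * (real (2 * L) * \<Lambda> ^ (2 * L) * \<eta>))"
    unfolding sum_distrib_left[symmetric] by (intro mult_left_mono bad_lists_sum[OF B]) auto
  also have "\<dots> = (real eH * (real (2 * L) * real (2 * L + 1) * real (2 * L))) * (\<Lambda> ^ (2 * L) * \<eta>)" by simp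
  also have "\<dots> \<le> (real eH * (2 * real L + 1) ^ 3) * (\<Lambda> ^ (2 * L) * \<eta>)"
    unfolding power3_eq_cube using Lam_ge_1 eta by (intro mult_right_mono mult_left_mono mult_mono) auto
  also have "\<dots> = \<rho>" by (simp add: \<rho>_def)
  finally show ?thesis .
qed

section \<open>Long clean chains\<close>

definition chains :: "nat set set \<Rightarrow> nat set \<Rightarrow> nat \<Rightarrow> (nat set set \<times> nat set) list set" where
  "chains P f m = {cs. length cs = m \<and> chain n P f cs}"

lemma chains_bound:
  assumes "f \<in> Kn_edges n"
  shows "finite (chains P f m) \<and> card (chains P f m) \<le> (4 * eH * n ^ (vH - 2) * eH) ^ m"
  using assms
proof (induction m arbitrary: P f)
  case 0
  have "chains P f 0 = {[]}" unfolding chains_def by auto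
  then show ?case by simp
next
  case (Suc m)
  let ?c = "4 * eH * n ^ (vH - 2) * eH"
  let ?I = "SIGMA C:{C\<in>copies n. f \<in> C}. C"
  have finI: "finite ?I" by (intro finite_SigmaI) (auto intro: copy_finite)
  have "card ?I = (\<Sum>C\<in>{C\<in>copies n. f \<in> C}. eH)"
    by (subst card_SigmaI) (auto intro: copy_finite intro!: sum.cong simp del: sum_constant simp: copy_card)
  then have cI: "card ?I \<le> ?c" using copies_through_edge[OF Suc.prems] by simp
  have edge: "h \<in> Kn_edges n" if "(C, h) \<in> ?I" for C h using that copy_edges by auto
  have sub: "chains P f (Suc m) \<subseteq> (\<Union>(C, h)\<in>?I. (#) (C, h) ` chains C h m)"
    unfolding chains_def by (force simp: length_Suc_conv image_iff)
  have fin: "finite (\<Union>(C, h)\<in>?I. (#) (C, h) ` chains C h m)"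
    using finI edge Suc.IH by (auto split: prod.splits)
  have "card (chains P f (Suc m)) \<le> card (\<Union>z\<in>?I. case z of (C, h) \<Rightarrow> (#) (C, h) ` chains C h m)"
    by (rule card_mono[OF fin sub])
  also have "\<dots> \<le> (\<Sum>z\<in>?I. card (case z of (C, h) \<Rightarrow> (#) (C, h) ` chains C h m))" by (rule card_UN_le[OF finI])
  also have "\<dots> \<le> (\<Sum>z\<in>?I. ?c ^ m)"
  proof (rule sum_mono)
    fix z assume z: "z \<in> ?I"
    obtain C h where zz: "z = (C, h)" by (cases z)
    have "card ((#) (C, h) ` chains C h m) \<le> card (chains C h m)"
      using Suc.IH[OF edge[of C h]] z zz by (intro card_image_le) auto
    also have "\<dots> \<le> ?c ^ m" using Suc.IH[OF edge[of C h]] z zz by auto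
    finally show "card (case z of (C, h) \<Rightarrow> (#) (C, h) ` chains C h m) \<le> ?c ^ m" using zz by simp
  qed
  also have "\<dots> \<le> ?c * ?c ^ m" using cI by (simp add: mult_right_mono)
  finally show ?case using finite_subset[OF sub fin] by simp
qed

text \<open>Each copy of a clean chain shares only its entry edge with what precedes, so it adds
  exactly \<open>eH - 1\<close> new edges, and the exit edges are distinct. This is the input needed
  for \<open>pr_early_increasing\<close>.\<close>

lemma clean_chain_edges:
  assumes "chain n P f cs" "clean U f cs" "U \<subseteq> Kn_edges n"
  shows "finite (span cs - U) \<and> span cs \<subseteq> Kn_edges n \<and> card (span cs - U) = length cs * (eH - 1) \<and> distinct (map snd cs) \<and> snd ` set cs \<subseteq> span cs - U"
  using assms
proof (induction cs arbitrary: P f U)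
  case (Cons c cs)
  obtain C h where c: "c = (C, h)" by (cases c)
  have C: "C \<in> copies n" "f \<in> C" "h \<in> C" "h \<noteq> f" "chain n C h cs" using Cons.prems c by auto
  have cl: "\<Union>C \<inter> \<Union>U = f" "f \<in> U" "clean (U \<union> C) h cs" using Cons.prems c by auto
  have CE: "C \<subseteq> Kn_edges n" by (rule copy_edges[OF C(1)])
  have UC: "U \<union> C \<subseteq> Kn_edges n" using CE Cons.prems by auto
  note IH = Cons.IH[OF C(5) cl(3) UC]
  have int: "C \<inter> U = {f}"
  proof -
    have "e = f" if "e \<in> C" "e \<in> U" for e
      using that cl(1) edge_eq[of f n e] CE C(2) by auto
    then show ?thesis using C(2) cl(2) by blast
  qed
  have cCU: "card (C - U) = eH - 1"
  proof -
    have "C - U = C - {f}" using int by auto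
    then show ?thesis using copy_card[OF C(1)] copy_finite[OF C(1)] C(2) by simp
  qed
  have sp: "span (c # cs) - U = (C - U) \<union> (span cs - (U \<union> C))" using c by auto
  have "card (span (c # cs) - U) = card (C - U) + card (span cs - (U \<union> C))"
    unfolding sp by (rule card_Un_disjoint) (use IH copy_finite[OF C(1)] in auto)
  moreover have "finite (span (c # cs) - U)" unfolding sp using IH copy_finite[OF C(1)] by auto
  moreover have "h \<notin> U" using int C by auto
  moreover have "snd ` set cs \<inter> (U \<union> C) = {}" "snd ` set cs \<subseteq> span cs" using IH by auto
  moreover have "h \<in> C - U" using \<open>h \<notin> U\<close> C(3) by simp
  moreover have "h \<notin> snd ` set cs" using C(3) \<open>snd ` set cs \<inter> (U \<union> C) = {}\<close> by blast
  moreover have "snd ` set cs \<subseteq> span (c # cs) - U"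
    using \<open>snd ` set cs \<inter> (U \<union> C) = {}\<close> \<open>snd ` set cs \<subseteq> span cs\<close> unfolding sp by blast
  moreover have "span (c # cs) \<subseteq> Kn_edges n" using IH CE c by simp
  moreover have "distinct (map snd cs)" "card (span cs - (U \<union> C)) = length cs * (eH - 1)" using IH by auto
  ultimately show ?case using cCU c unfolding sp by simp
qed simp

lemma decr_sorted:
  "decr \<beta> f cs \<Longrightarrow> sorted_wrt (<) (map \<beta> (rev (map snd cs))) \<and> (\<forall>h\<in>snd ` set cs. \<beta> h < \<beta> f)"
proof (induction cs arbitrary: f)
  case (Cons c cs)
  obtain C h where c: "c = (C, h)" by (cases c)
  have "\<beta> h < \<beta> f" "decr \<beta> h cs" using Cons.prems c by auto
  with Cons.IH[OF this(2)] c show ?case by (auto simp: sorted_wrt_append intro: less_trans)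
qed simp

definition "\<tau>\<^sub>L = (4 * real eH ^ 2 * M) ^ L / fact L"

text \<open>Each step offers at most \<open>4 * eH * n ^ (vH - 2)\<close> copies and
  \<open>eH\<close> exit edges, and its new edges have weight \<open>q ^ (eH - 1)\<close>; together
  this is at most \<open>4 * eH ^ 2 * M\<close>. The factorial stems from the exit edges, whose
  birthtimes decrease along the chain.\<close>

lemma long_chain_bound:
  assumes B: "B \<in> copies n" "b \<in> B"
  shows "pr \<Omega> (\<lambda>x. \<exists>cs\<in>{cs\<in>chains B b L. clean B b cs}. (\<forall>e\<in>span cs - B. x e < T) \<and> sorted_wrt (<) (map x (rev (map snd cs)))) \<le> \<tau>\<^sub>L"
proof -
  let ?D = "{cs\<in>chains B b L. clean B b cs}"
  have bE: "b \<in> Kn_edges n" using B copy_edges by auto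
  have finD: "finite ?D" using chains_bound[OF bE] by auto
  have "pr \<Omega> (\<lambda>x. \<exists>cs\<in>?D. (\<forall>e\<in>span cs - B. x e < T) \<and> sorted_wrt (<) (map x (rev (map snd cs))))
    \<le> (\<Sum>cs\<in>?D. pr \<Omega> (\<lambda>x. (\<forall>e\<in>span cs - B. x e < T) \<and> sorted_wrt (<) (map x (rev (map snd cs)))))"
    by (rule pr_Bex[OF finite_Omega finD])
  also have "\<dots> \<le> (\<Sum>cs\<in>?D. (q ^ (eH - 1)) ^ L / fact L)"
  proof (rule sum_mono)
    fix cs assume cs: "cs \<in> ?D"
    then have len: "length cs = L" and ch: "chain n B b cs" and cl: "clean B b cs" by (auto simp: chains_def)
    note E = clean_chain_edges[OF ch cl copy_edges[OF B(1)]]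
    have "pr \<Omega> (\<lambda>x. (\<forall>e\<in>span cs - B. x e < T) \<and> sorted_wrt (<) (map x (rev (map snd cs))))
       \<le> (real T / real N) ^ card (span cs - B) / fact (length (rev (map snd cs)))"
      by (rule pr_early_increasing) (use E T_le N_pos in auto)
    also have "\<dots> = ((real T / real N) ^ (eH - 1)) ^ L / fact L"
      using E len by (simp add: mult.commute flip: power_mult)
    also have "\<dots> \<le> (q ^ (eH - 1)) ^ L / fact L"
      by (intro divide_right_mono power_mono) (auto simp: q_def divide_right_mono)
    finally show "pr \<Omega> (\<lambda>x. (\<forall>e\<in>span cs - B. x e < T) \<and> sorted_wrt (<) (map x (rev (map snd cs)))) \<le> (q ^ (eH - 1)) ^ L / fact L" .
  qed
  also have "\<dots> = real (card ?D) * ((q ^ (eH - 1)) ^ L / fact L)" by simp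
  also have "\<dots> \<le> real ((4 * eH * n ^ (vH - 2) * eH) ^ L) * ((q ^ (eH - 1)) ^ L / fact L)"
  proof (intro mult_right_mono)
    have "card ?D \<le> card (chains B b L)" using chains_bound[OF bE] by (intro card_mono) auto
    then show "real (card ?D) \<le> real ((4 * eH * n ^ (vH - 2) * eH) ^ L)"
      using chains_bound[OF bE, of B L] by linarith
  qed (use q01 in auto)
  also have "\<dots> = (4 * real eH ^ 2 * (real n ^ (vH - 2) * q ^ (eH - 1))) ^ L / fact L"
    by (simp add: power_mult_distrib power2_eq_square mult_ac)
  also have "\<dots> \<le> \<tau>\<^sub>L" unfolding \<tau>\<^sub>L_def
    using expected_copies q01 by (intro divide_right_mono power_mono mult_left_mono) (auto simp: q_def)
  finally show ?thesis .
qed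

end

section \<open>Decorrelation within a copy\<close>

context balanced_graph
begin

text \<open>\<open>opn n f t\<close>: the edge \<open>f\<close> is accepted if its birthtime is reset to \<open>t\<close>; this ignores \<open>\<beta> f\<close>.\<close>

definition opn :: "nat \<Rightarrow> nat set \<Rightarrow> nat \<Rightarrow> (nat set \<Rightarrow> nat) \<Rightarrow> bool" where
  "opn n f t \<beta> = Acc n (\<beta>(f := t)) f"

lemma chain_last: "chain n P f cs \<Longrightarrow> cs \<noteq> [] \<Longrightarrow> snd (last cs) \<in> span cs"
  by (induction n P f cs rule: chain.induct) (auto split: if_splits)

end

context sparse_scale
begin

text \<open>Openness truncated at depth \<open>L\<close>: a change of this event is witnessed by a
  chain of at most \<open>L\<close> copies, which makes two such chains a list of length at most
  \<open>2 * L\<close>.\<close>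

definition opL :: "nat set \<Rightarrow> nat \<Rightarrow> (nat set \<Rightarrow> nat) \<Rightarrow> bool" where
  "opL f t \<beta> = acc n L (\<beta>(f := t)) f"

text \<open>This event and the next inspect edges outside \<open>B\<close> only, so overwriting the
  birthtimes on \<open>B\<close> does not affect them.\<close>

definition bad_event :: "nat set set \<Rightarrow> (nat set \<Rightarrow> nat) \<Rightarrow> bool" where
  "bad_event B x \<longleftrightarrow> (\<exists>Cs\<in>bad_lists B. \<forall>e\<in>\<Union>(set Cs) - B. x e < T)"
definition long_event :: "nat set set \<Rightarrow> nat set \<Rightarrow> (nat set \<Rightarrow> nat) \<Rightarrow> bool" where
  "long_event B b x \<longleftrightarrow> (\<exists>cs\<in>{cs\<in>chains B b L. clean B b cs}. (\<forall>e\<in>span cs - B. x e < T) \<and> sorted_wrt (<) (map x (rev (map snd cs))))"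

lemma pr_bad_event: "B \<in> copies n \<Longrightarrow> pr \<Omega> (bad_event B) \<le> \<rho>"
  using pr_bad_list[of B] unfolding bad_event_def by simp
lemma pr_long_event: "B \<in> copies n \<Longrightarrow> b \<in> B \<Longrightarrow> pr \<Omega> (long_event B b) \<le> \<tau>\<^sub>L"
  using long_chain_bound[of B b] unfolding long_event_def by simp

text \<open>A discrepancy between full and truncated acceptance yields a decreasing chain of length
  \<open>L\<close> from \<open>b\<close>. Either it has a bad step, or it is clean; then its exit
  edges avoid \<open>B\<close>, so their times decrease under \<open>x\<close> itself.\<close>

lemma opn_opL_differ:
  assumes B: "B \<in> copies n" "b \<in> B" and \<gamma>: "\<And>e. e \<notin> B \<Longrightarrow> \<gamma> e = x e"
    and t: "t \<le> T" "\<exists>h\<in>B - {b}. \<gamma> h \<ge> t" and d: "opn n b t \<gamma> \<noteq> opL b t \<gamma>"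
  shows "bad_event B x \<or> long_event B b x"
proof -
  let ?\<gamma> = "\<gamma>(b := t)"
  \<comment> \<open>Depth \<open>L + t + 1\<close> exceeds the birthtime \<open>t\<close>, so it
    gives the full process, and it is at least \<open>L\<close>, as the comparison with depth
    \<open>L\<close> requires.\<close>
  have "opn n b t \<gamma> = acc n (L + t + 1) ?\<gamma> b" unfolding opn_def by (rule acc_eq_Acc[symmetric]) simp
  then have "acc n (L + t + 1) ?\<gamma> b \<noteq> acc n L ?\<gamma> b" using d by (simp add: opL_def)
  moreover have "\<exists>h\<in>B - {b}. ?\<gamma> h \<ge> ?\<gamma> b" using t by auto
  ultimately obtain cs where cs: "length cs = L" "chain n B b cs" "decr ?\<gamma> b cs"
    using truncation_chain[of B b ?\<gamma> L "L + t + 1" L n] by auto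
  have early: "x e < T" if "e \<in> span cs - B" for e
  proof -
    have "e \<noteq> b" "e \<notin> B" "e \<in> span cs" using that B by auto
    then show ?thesis using decr_early[OF cs(3), of e] \<gamma>[of e] t(1) by simp
  qed
  show ?thesis
  proof (cases "has_bad B (map fst cs)")
    case True
    have "map fst cs \<in> bad_lists B" unfolding bad_lists_def
      using True cs chain_attached[OF cs(2) B(2)] by auto
    then have "bad_event B x" unfolding bad_event_def using early by (intro bexI[of _ "map fst cs"]) auto
    then show ?thesis by simp
  next
    case False
    have cl: "clean B b cs" by (rule chain_clean_base(1)[OF B cs(2) False])
    have "map ?\<gamma> (rev (map snd cs)) = map x (rev (map snd cs))"
    proof (rule map_cong)
      fix e assume "e \<in> set (rev (map snd cs))"
      then have "e \<notin> B" using clean_chain_edges[OF cs(2) cl copy_edges[OF B(1)]] by auto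
      then show "?\<gamma> e = x e" using \<gamma> B by auto
    qed simp
    then have "sorted_wrt (<) (map x (rev (map snd cs)))"
      using decr_sorted[OF cs(3)] by metis
    then have "long_event B b x" unfolding long_event_def using cl cs early
      by (intro bexI[of _ cs]) (auto simp: chains_def)
    then show ?thesis by simp
  qed
qed

lemma pr_base_early:
  assumes "B \<in> copies n"
  shows "pr \<Omega> (\<lambda>x. \<exists>h\<in>B - {b}. x h < T) \<le> real eH * \<eta>"
proof -
  have fB: "finite (B - {b})" using copy_finite[OF assms] by simp
  have "pr \<Omega> (\<lambda>x. \<exists>h\<in>B - {b}. x h < T) \<le> (\<Sum>h\<in>B - {b}. pr \<Omega> (\<lambda>x. x h < T))"
    by (rule pr_Bex[OF finite_Omega fB])
  also have "\<dots> \<le> (\<Sum>h\<in>B - {b}. \<eta>)"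
  proof (rule sum_mono)
    fix h assume "h \<in> B - {b}"
    then have "pr \<Omega> (\<lambda>x. \<forall>e\<in>{h}. x e < T) = (real T / real N) ^ card {h}"
      by (intro pr_early) (use copy_edges[OF assms] T_le N_pos in auto)
    moreover have "real T / real N \<le> \<eta>"
      using q_eta by (rule order_trans[rotated]) (simp add: divide_right_mono)
    ultimately show "pr \<Omega> (\<lambda>x. x h < T) \<le> \<eta>" by simp
  qed
  also have "\<dots> \<le> real eH * \<eta>"
    using eta card_Diff1_le[of B b] copy_card[OF assms] by (simp add: mult_right_mono)
  finally show ?thesis .
qed

text \<open>The two samples differ only on \<open>B\<close>. If this matters for \<open>b\<close>, a
  chain from \<open>b\<close> returns to another edge of \<open>B\<close>; a clean chain never does,
  so there is a bad step. Excluding early edges in \<open>B - {b}\<close> keeps \<open>B\<close>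
  from blocking \<open>b\<close> in the original sample too.\<close>

lemma opL_ovr_close:
  assumes B: "B \<in> copies n" "b \<in> B" and t: "t \<le> T" "\<exists>h\<in>B - {b}. \<tau> h \<ge> t"
  shows "\<bar>pr \<Omega> (\<lambda>x. opL b t (hyb B \<tau> x)) - pr \<Omega> (\<lambda>x. opL b t x)\<bar> \<le> real eH * \<eta> + \<rho>"
proof -
  have "\<bar>pr \<Omega> (\<lambda>x. opL b t (hyb B \<tau> x)) - pr \<Omega> (\<lambda>x. opL b t x)\<bar>
     \<le> pr \<Omega> (\<lambda>x. opL b t (hyb B \<tau> x) \<noteq> opL b t x)"
    by (rule pr_diff) simp
  also have "\<dots> \<le> pr \<Omega> (\<lambda>x. (\<exists>h\<in>B - {b}. x h < T) \<or> bad_event B x)"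
  proof (rule pr_mono)
    fix x assume d: "opL b t (hyb B \<tau> x) \<noteq> opL b t x"
    show "(\<exists>h\<in>B - {b}. x h < T) \<or> bad_event B x"
    proof (cases "\<exists>h\<in>B - {b}. x h < T")
      case False
      define y where "y = (hyb B \<tau> x)(b := t)"
      define z where "z = x(b := t)"
      obtain h where h: "h \<in> B - {b}" "\<tau> h \<ge> t" using t by blast
      have "x h \<ge> t" using False h t(1) by (meson not_less order_trans)
      then have hh: "\<exists>h\<in>B - {b}. y h \<ge> y b \<and> z h \<ge> z b" using h by (intro bexI[of _ h]) (auto simp: hyb_def y_def z_def)
      have "acc n L y b \<noteq> acc n L z b" using d by (simp add: opL_def y_def z_def)
      moreover have "y e = z e" if "e \<notin> B - {b}" for e using that by (auto simp: hyb_def y_def z_def)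
      moreover have "b \<notin> B - {b}" by simp
      ultimately obtain cs where cs: "cs \<noteq> []" "length cs \<le> L" "chain n B b cs" "snd (last cs) \<in> B - {b}"
        "\<forall>e\<in>span cs. e = b \<or> e \<in> B - {b} \<or> y e < y b"
        using pivot_chain[of "B - {b}" y z b B n L, OF _ _ hh] by blast
      have bad: "has_bad B (map fst cs)"
        using chain_clean_base(2)[OF B cs(3)] cs(1,4) by blast
      have "x e < T" if e: "e \<in> span cs - B" for e
      proof -
        have ne: "e \<noteq> b" "e \<notin> B" "e \<in> span cs" using e B(2) by auto
        then have "y e < y b" using bspec[OF cs(5) ne(3)] by simp
        moreover note ne
        ultimately show ?thesis using t(1) by (simp add: hyb_def y_def)
      qed
      moreover have "map fst cs \<in> bad_lists B" unfolding bad_lists_def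
        using bad cs chain_attached[OF cs(3) B(2)] by auto
      ultimately have "bad_event B x" unfolding bad_event_def by (intro bexI[of _ "map fst cs"]) auto
      then show ?thesis by simp
    qed simp
  qed simp
  also have "\<dots> \<le> pr \<Omega> (\<lambda>x. \<exists>h\<in>B - {b}. x h < T) + pr \<Omega> (bad_event B)" by (rule pr_disj) simp
  also have "\<dots> \<le> real eH * \<eta> + \<rho>" by (intro add_mono pr_base_early pr_bad_event B)
  finally show ?thesis .
qed

lemma opL_opn_close:
  assumes B: "B \<in> copies n" "b \<in> B" and t: "t \<le> T"
  shows "\<bar>pr \<Omega> (\<lambda>x. opL b t x) - pr \<Omega> (\<lambda>x. opn n b t x)\<bar> \<le> real eH * \<eta> + (\<rho> + \<tau>\<^sub>L)"
proof -
  have ne: "B - {b} \<noteq> {}"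
  proof
    assume "B - {b} = {}"
    then have "card B \<le> card {b}" by (intro card_mono) auto
    then show False using copy_card[OF B(1)] eH_ge by simp
  qed
  have "\<bar>pr \<Omega> (\<lambda>x. opL b t x) - pr \<Omega> (\<lambda>x. opn n b t x)\<bar> \<le> pr \<Omega> (\<lambda>x. opL b t x \<noteq> opn n b t x)"
    by (rule pr_diff) simp
  also have "\<dots> \<le> pr \<Omega> (\<lambda>x. (\<exists>h\<in>B - {b}. x h < T) \<or> (bad_event B x \<or> long_event B b x))"
  proof (rule pr_mono)
    fix x assume d: "opL b t x \<noteq> opn n b t x"
    show "(\<exists>h\<in>B - {b}. x h < T) \<or> (bad_event B x \<or> long_event B b x)"
    proof (cases "\<exists>h\<in>B - {b}. x h < T")
      case False
      obtain h where h: "h \<in> B - {b}" using ne by blast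
      then have "x h \<ge> t" using False t by (meson not_less order_trans)
      then show ?thesis using opn_opL_differ[OF B, of x x t] t d h by blast
    qed simp
  qed simp
  also have "\<dots> \<le> pr \<Omega> (\<lambda>x. \<exists>h\<in>B - {b}. x h < T) + (pr \<Omega> (bad_event B) + pr \<Omega> (long_event B b))"
    by (rule order_trans[OF pr_disj add_left_mono[OF pr_disj]]) simp_all
  also have "\<dots> \<le> real eH * \<eta> + (\<rho> + \<tau>\<^sub>L)" by (intro add_mono pr_base_early pr_bad_event pr_long_event B)
  finally show ?thesis .
qed

definition pair_event :: "nat set set \<Rightarrow> nat set \<Rightarrow> (nat set \<Rightarrow> nat) \<times> (nat set \<Rightarrow> nat) \<Rightarrow> bool" where
  "pair_event B i = (\<lambda>(x, y). \<exists>Cs\<in>bad_lists B. i \<in> \<Union>(set Cs) - B \<and> (\<forall>e\<in>\<Union>(set Cs) - B. x e < T \<or> y e < T))"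

lemma pivot_early:
  assumes B: "B \<in> copies n" "b \<in> B" and i: "i \<notin> B" and t: "t \<le> T" "\<exists>h\<in>B - {b}. \<tau> h \<ge> t"
    and d: "opL b t (hyb B \<tau> x) \<noteq> opL b t (hyb B \<tau> (x(i := c)))"
  shows "\<exists>cs. cs \<noteq> [] \<and> length cs \<le> L \<and> chain n B b cs \<and> snd (last cs) = i \<and> (x i < T \<or> c < T) \<and>
     (\<forall>e\<in>span cs - B. e \<noteq> i \<longrightarrow> x e < T)"
proof -
  define y where "y = (hyb B \<tau> x)(b := t)"
  define z where "z = (hyb B \<tau> (x(i := c)))(b := t)"
  have bi: "b \<noteq> i" using B i by auto
  have hh: "\<exists>h\<in>B - {b}. y h \<ge> y b \<and> z h \<ge> z b" using t(2) by (auto simp: hyb_def y_def z_def)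
  have "acc n L y b \<noteq> acc n L z b" using d by (simp add: opL_def y_def z_def)
  moreover have "y e = z e" if "e \<notin> {i}" for e using that by (auto simp: hyb_def y_def z_def)
  moreover have "b \<notin> {i}" using bi by simp
  ultimately have "\<exists>cs. cs \<noteq> [] \<and> length cs \<le> L \<and> chain n B b cs \<and> snd (last cs) \<in> {i} \<and>
      (y (snd (last cs)) < y b \<or> z (snd (last cs)) < y b) \<and>
      (\<forall>e\<in>span cs. e = b \<or> e \<in> {i} \<or> y e < y b)"
    using pivot_chain[of "{i}" y z b B n L, OF _ _ hh] by blast
  then obtain cs where cs: "cs \<noteq> []" "length cs \<le> L" "chain n B b cs" "snd (last cs) = i"
    "y i < y b \<or> z i < y b"
    "\<forall>e\<in>span cs. e = b \<or> e = i \<or> y e < y b" by (metis singletonD)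
  have "x i < T \<or> c < T" using cs(5) i bi[symmetric] t(1) by (simp add: hyb_def y_def z_def) linarith
  moreover have "x e < T" if e: "e \<in> span cs - B" "e \<noteq> i" for e
  proof -
    have ne: "e \<noteq> b" "e \<notin> B" "e \<in> span cs" using e(1) B(2) by auto
    then have "y e < y b" using bspec[OF cs(6) ne(3)] e(2) by simp
    moreover note ne
    ultimately show ?thesis using t(1) by (simp add: hyb_def y_def)
  qed
  ultimately show ?thesis using cs by blast
qed

text \<open>Both chains end in \<open>i\<close>, so \<open>two_chains_bad\<close> finds a bad step
  in their concatenation. Apart from \<open>i\<close>, one chain is early in \<open>x\<close> and
  the other in the hybrid sample, so every new edge is early in \<open>x\<close> or in
  \<open>y\<close>, and \<open>S\<close> disappears from the conclusion.\<close>

lemma both_pivotal: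
  assumes B: "B \<in> copies n" "b1 \<in> B" "b2 \<in> B" "b1 \<noteq> b2"
    and t: "t1 \<le> T" "\<exists>h\<in>B - {b1}. \<tau> h \<ge> t1" "t2 \<le> T" "\<exists>h\<in>B - {b2}. \<tau> h \<ge> t2"
    and d1: "opL b1 t1 (hyb B \<tau> x) \<noteq> opL b1 t1 (hyb B \<tau> (x(i := y i)))"
    and d2: "opL b2 t2 (hyb B \<tau> (hyb S x y)) \<noteq> opL b2 t2 (hyb B \<tau> ((hyb S x y)(i := x i)))"
  shows "pair_event B i (x, y)"
proof -
  have i: "i \<notin> B"
  proof
    assume "i \<in> B"
    then have "hyb B \<tau> (x(i := y i)) = hyb B \<tau> x" by (auto simp: hyb_def)
    then show False using d1 by simp
  qed
  obtain cs1 where cs1: "cs1 \<noteq> []" "length cs1 \<le> L" "chain n B b1 cs1" "snd (last cs1) = i" "x i < T \<or> y i < T"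
     "\<forall>e\<in>span cs1 - B. e \<noteq> i \<longrightarrow> x e < T"
    using pivot_early[OF B(1,2) i t(1,2) d1] by auto
  obtain cs2 where cs2: "cs2 \<noteq> []" "length cs2 \<le> L" "chain n B b2 cs2" "snd (last cs2) = i"
     "\<forall>e\<in>span cs2 - B. e \<noteq> i \<longrightarrow> hyb S x y e < T"
    using pivot_early[OF B(1,3) i t(3,4) d2] by auto
  let ?Cs = "map fst (cs1 @ cs2)"
  have "has_bad B ?Cs" by (rule two_chains_bad[OF B cs1(3,1) cs2(3,1)]) (use cs1 cs2 in simp)
  moreover have "attached n B ?Cs"
    using chain_attached[OF cs1(3) B(2)] chain_attached[OF cs2(3), of "B \<union> span cs1"] B(3)
    by (simp add: attached_append)
  ultimately have mem: "?Cs \<in> bad_lists B" unfolding bad_lists_def using cs1 cs2 by simp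
  have sp: "\<Union>(set ?Cs) = span cs1 \<union> span cs2" by auto
  have "i \<in> span cs1" using chain_last[OF cs1(3,1)] cs1(4) by simp
  moreover have "x e < T \<or> y e < T" if e: "e \<in> (span cs1 \<union> span cs2) - B" for e
  proof (cases "e = i")
    case True
    then show ?thesis using cs1(5) by simp
  next
    case False
    then have "x e < T \<or> hyb S x y e < T" using e cs1(6) cs2(5) by blast
    then show ?thesis by (auto simp: hyb_def split: if_splits)
  qed
  ultimately have "i \<in> \<Union>(set ?Cs) - B \<and> (\<forall>e\<in>\<Union>(set ?Cs) - B. x e < T \<or> y e < T)"
    unfolding sp using i by blast
  then show ?thesis unfolding pair_event_def prod.case by (rule bexI[OF _ mem])
qed

text \<open>The edges of \<open>B\<close> are added one at a time. A coordinate that is pivotal for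
  a conjunction is pivotal for one of its members, so \<open>both_pivotal\<close> applies to this
  member and the new edge. The resulting pair events do not depend on the member, and each addition
  costs \<open>\<rho>\<close>.\<close>

lemma opL_product:
  assumes B: "B \<in> copies n" and t: "\<And>b. b \<in> B \<Longrightarrow> t b \<le> T" "\<And>b. b \<in> B \<Longrightarrow> \<exists>h\<in>B - {b}. \<tau> h \<ge> t b"
    and B': "B' \<subseteq> B"
  shows "\<bar>pr \<Omega> (\<lambda>x. \<forall>b\<in>B'. opL b (t b) (hyb B \<tau> x)) - (\<Prod>b\<in>B'. pr \<Omega> (\<lambda>x. opL b (t b) (hyb B \<tau> x)))\<bar>
     \<le> real (card B') * \<rho>"
  using finite_subset[OF B' copy_finite[OF B]] B'
proof (induction B' rule: finite_induct)
  case empty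
  have "card \<Omega> \<noteq> 0" using N_pos by (simp add: card_PiE)
  then show ?case by (simp add: pr_def)
next
  case (insert b0 B')
  define F where "F = (\<lambda>x. \<forall>b\<in>B'. opL b (t b) (hyb B \<tau> x))"
  define G where "G = (\<lambda>x. opL b0 (t b0) (hyb B \<tau> x))"
  let ?P = "\<Prod>b\<in>B'. pr \<Omega> (\<lambda>x. opL b (t b) (hyb B \<tau> x))"
  have IH: "\<bar>pr \<Omega> F - ?P\<bar> \<le> real (card B') * \<rho>" unfolding F_def using insert by auto
  have "\<bar>pr \<Omega> (\<lambda>x. F x \<and> G x) - pr \<Omega> F * pr \<Omega> G\<bar> \<le> (\<Sum>i\<in>Kn_edges n. pr (\<Omega> \<times> \<Omega>) (pair_event B i))"
  proof (rule decorrelation_by_swapping[OF finite_Kn_edges finite_Omega])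
    fix i S
    show "pr (\<Omega> \<times> \<Omega>) (\<lambda>(x, y). F x \<noteq> F (x(i := y i)) \<and> G (hyb S x y) \<noteq> G ((hyb S x y)(i := x i)))
      \<le> pr (\<Omega> \<times> \<Omega>) (pair_event B i)"
    proof (rule pr_mono)
      fix z assume z: "case z of (x, y) \<Rightarrow> F x \<noteq> F (x(i := y i)) \<and> G (hyb S x y) \<noteq> G ((hyb S x y)(i := x i))"
      obtain x y where xy: "z = (x, y)" by (cases z)
      obtain b1 where b1: "b1 \<in> B'" "opL b1 (t b1) (hyb B \<tau> x) \<noteq> opL b1 (t b1) (hyb B \<tau> (x(i := y i)))"
        using z xy unfolding F_def by auto
      have "b1 \<in> B" "b0 \<in> B" "b1 \<noteq> b0" using insert b1 by auto
      then show "pair_event B i z" unfolding xy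
        using both_pivotal[OF B, of b1 b0 "t b1" \<tau> "t b0" x i y S] t b1(2) z xy unfolding G_def by auto
    qed simp
  qed
  also have "\<dots> \<le> \<rho>" using pr_bad_list_pair[OF B] unfolding pair_event_def .
  finally have s: "\<bar>pr \<Omega> (\<lambda>x. F x \<and> G x) - pr \<Omega> F * pr \<Omega> G\<bar> \<le> \<rho>" .
  have "\<bar>pr \<Omega> F * pr \<Omega> G - ?P * pr \<Omega> G\<bar> = \<bar>pr \<Omega> F - ?P\<bar> * pr \<Omega> G"
    by (simp add: abs_mult flip: left_diff_distrib)
  also have "\<dots> \<le> (real (card B') * \<rho>) * 1" using IH rho_nonneg by (intro mult_mono) (auto simp: pr_le_1)
  finally have "\<bar>pr \<Omega> (\<lambda>x. F x \<and> G x) - ?P * pr \<Omega> G\<bar> \<le> \<rho> + real (card B') * \<rho>" using s by linarith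
  moreover have "pr \<Omega> (\<lambda>x. \<forall>b\<in>insert b0 B'. opL b (t b) (hyb B \<tau> x)) = pr \<Omega> (\<lambda>x. F x \<and> G x)"
    by (rule pr_cong) (auto simp: F_def G_def)
  ultimately show ?case using insert by (simp add: G_def mult.commute algebra_simps)
qed

text \<open>Per edge of \<open>B\<close>: \<open>\<rho> + \<tau>\<^sub>L\<close> for truncating the
  joint event, \<open>\<rho>\<close> for splitting it into a product, and
  \<open>2 * eH * \<eta> + 2 * \<rho> + \<tau>\<^sub>L\<close> for undoing the overwriting and the
  truncation in the factor.\<close>

definition "\<epsilon> = real eH * (4 * \<rho> + 2 * \<tau>\<^sub>L + 2 * real eH * \<eta>)"

lemma tauL_nonneg: "\<tau>\<^sub>L \<ge> 0" unfolding \<tau>\<^sub>L_def using M1 by simp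

text \<open>\<open>\<tau>\<close> prescribes the birthtimes on \<open>B\<close>, and the second assumption on \<open>t\<close> keeps \<open>B\<close> itself from blocking
  any of its edges.\<close>

lemma decorrelation:
  assumes B: "B \<in> copies n" and t: "\<And>b. b \<in> B \<Longrightarrow> t b \<le> T" "\<And>b. b \<in> B \<Longrightarrow> \<exists>h\<in>B - {b}. \<tau> h \<ge> t b"
  shows "pr \<Omega> (\<lambda>x. \<forall>b\<in>B. opn n b (t b) (hyb B \<tau> x)) \<le> (\<Prod>b\<in>B. pr \<Omega> (opn n b (t b))) + \<epsilon>"
proof -
  let ?g = "\<lambda>b. pr \<Omega> (\<lambda>x. opL b (t b) (hyb B \<tau> x))"
  have cB: "real (card B) = real eH" using copy_card[OF B] by simp
  have fB: "finite B" by (rule copy_finite[OF B])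
  have "pr \<Omega> (\<lambda>x. \<forall>b\<in>B. opn n b (t b) (hyb B \<tau> x))
    \<le> pr \<Omega> (\<lambda>x. (\<forall>b\<in>B. opL b (t b) (hyb B \<tau> x)) \<or> (\<exists>b\<in>B. bad_event B x \<or> long_event B b x))"
  proof (rule pr_mono)
    fix x assume a: "\<forall>b\<in>B. opn n b (t b) (hyb B \<tau> x)"
    show "(\<forall>b\<in>B. opL b (t b) (hyb B \<tau> x)) \<or> (\<exists>b\<in>B. bad_event B x \<or> long_event B b x)"
    proof (rule disjCI)
      assume nb: "\<not> (\<exists>b\<in>B. bad_event B x \<or> long_event B b x)"
      show "\<forall>b\<in>B. opL b (t b) (hyb B \<tau> x)"
      proof
        fix b assume b: "b \<in> B"
        have "\<exists>h\<in>B - {b}. hyb B \<tau> x h \<ge> t b" using t(2)[OF b] by (auto simp: hyb_def)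
        then show "opL b (t b) (hyb B \<tau> x)"
          using opn_opL_differ[OF B b, of "hyb B \<tau> x" x "t b"] t(1)[OF b] nb a b by (auto simp: hyb_def)
      qed
    qed
  qed simp
  also have "\<dots> \<le> pr \<Omega> (\<lambda>x. \<forall>b\<in>B. opL b (t b) (hyb B \<tau> x)) + pr \<Omega> (\<lambda>x. \<exists>b\<in>B. bad_event B x \<or> long_event B b x)"
    by (rule pr_disj) simp
  also have "pr \<Omega> (\<lambda>x. \<exists>b\<in>B. bad_event B x \<or> long_event B b x) \<le> (\<Sum>b\<in>B. pr \<Omega> (\<lambda>x. bad_event B x \<or> long_event B b x))"
    by (rule pr_Bex[OF finite_Omega fB])
  also have "\<dots> \<le> (\<Sum>b\<in>B. \<rho> + \<tau>\<^sub>L)"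
    by (intro sum_mono order_trans[OF pr_disj] add_mono pr_bad_event pr_long_event B) auto
  also have "\<dots> = real eH * (\<rho> + \<tau>\<^sub>L)" using cB by simp
  finally have 1: "pr \<Omega> (\<lambda>x. \<forall>b\<in>B. opn n b (t b) (hyb B \<tau> x))
    \<le> pr \<Omega> (\<lambda>x. \<forall>b\<in>B. opL b (t b) (hyb B \<tau> x)) + real eH * (\<rho> + \<tau>\<^sub>L)" by simp
  have "\<bar>pr \<Omega> (\<lambda>x. \<forall>b\<in>B. opL b (t b) (hyb B \<tau> x)) - (\<Prod>b\<in>B. ?g b)\<bar> \<le> real (card B) * \<rho>"
    by (rule opL_product[OF B t]) auto
  then have 2: "pr \<Omega> (\<lambda>x. \<forall>b\<in>B. opL b (t b) (hyb B \<tau> x)) \<le> (\<Prod>b\<in>B. ?g b) + real eH * \<rho>" using cB by auto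
  have "\<bar>(\<Prod>b\<in>B. ?g b) - (\<Prod>b\<in>B. pr \<Omega> (opn n b (t b)))\<bar> \<le> (\<Sum>b\<in>B. \<bar>?g b - pr \<Omega> (opn n b (t b))\<bar>)"
    using norm_prod_diff[of B ?g "\<lambda>b. pr \<Omega> (opn n b (t b))"] by (simp add: pr_le_1)
  also have "\<dots> \<le> (\<Sum>b\<in>B. 2 * real eH * \<eta> + 2 * \<rho> + \<tau>\<^sub>L)"
  proof (rule sum_mono)
    fix b assume b: "b \<in> B"
    show "\<bar>?g b - pr \<Omega> (opn n b (t b))\<bar> \<le> 2 * real eH * \<eta> + 2 * \<rho> + \<tau>\<^sub>L"
      using opL_ovr_close[OF B b t(1)[OF b] t(2)[OF b]] opL_opn_close[OF B b t(1)[OF b]] by linarith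
  qed
  also have "\<dots> = real eH * (2 * real eH * \<eta> + 2 * \<rho> + \<tau>\<^sub>L)" using cB by simp
  finally have "(\<Prod>b\<in>B. ?g b) \<le> (\<Prod>b\<in>B. pr \<Omega> (opn n b (t b))) + real eH * (2 * real eH * \<eta> + 2 * \<rho> + \<tau>\<^sub>L)" by linarith
  with 1 2 show ?thesis unfolding \<epsilon>_def by (simp add: algebra_simps)
qed

end

section \<open>Decay of openness\<close>

lemma pr_partition:
  assumes "finite A" "finite I" "\<And>x. x \<in> A \<Longrightarrow> P x \<Longrightarrow> X x \<in> I"
  shows "pr A P = (\<Sum>t\<in>I. pr A (\<lambda>x. X x = t \<and> P x))"
proof -
  have "(\<Sum>x\<in>A. of_bool (P x) :: real) = (\<Sum>x\<in>A. \<Sum>t\<in>I. of_bool (X x = t \<and> P x))"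
  proof (rule sum.cong)
    fix x assume x: "x \<in> A"
    show "(of_bool (P x) :: real) = (\<Sum>t\<in>I. of_bool (X x = t \<and> P x))"
    proof (cases "P x")
      case True
      then have "(\<Sum>t\<in>I. of_bool (X x = t \<and> P x) :: real) = (\<Sum>t\<in>I. if X x = t then 1 else 0)"
        by (intro sum.cong) auto
      also have "\<dots> = 1" using assms(2,3) x True by (subst sum.delta') auto
      finally show ?thesis using True by simp
    qed simp
  qed simp
  also have "\<dots> = (\<Sum>t\<in>I. \<Sum>x\<in>A. of_bool (X x = t \<and> P x))" by (rule sum.swap)
  finally show ?thesis by (simp add: pr_sum[OF assms(1)] sum_divide_distrib)
qed

text \<open>With the a priori bound \<open>\<phi>\<close> in place of the growing
  \<open>\<Phi>\<close>, this solves \<open>s' \<ge> - c * s ^ 2\<close> for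
  \<open>c = A * \<phi> ^ j\<close>. As \<open>s a / N\<close> is the increment of
  \<open>\<Phi>\<close>, the factors \<open>1 - c * s a / N\<close> multiply up to at least
  \<open>exp (- 2 * c * \<Phi> a)\<close>. The 2 is the price of
  \<open>1 - u \<ge> exp (- 2 * u)\<close>, valid for \<open>u \<le> 1 / 2\<close>, which the bound
  \<open>2 * A * \<phi> ^ j \<le> N\<close> guarantees. The errors \<open>\<delta> / N\<close>
  merely add up.\<close>

lemma discrete_growth:
  fixes s :: "nat \<Rightarrow> real" and A \<delta> N \<phi> :: real
  defines "\<Phi> \<equiv> \<lambda>a. (\<Sum>b<a. s b) / N"
  assumes s: "\<And>a. 0 \<le> s a" "\<And>a. s a \<le> 1" "s 0 = 1" and N: "N > 0" and A: "A \<ge> 0" "\<delta> \<ge> 0"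
    and step: "\<And>a. a < T \<Longrightarrow> s a - s (Suc a) \<le> A * (s a)\<^sup>2 * \<Phi> (Suc a) ^ j / N + \<delta> / N"
    and \<phi>: "\<Phi> T \<le> \<phi>" "2 * A * \<phi> ^ j \<le> N"
  shows "real T / N * (exp (- 2 * A * \<phi> ^ Suc j) - real T * \<delta> / N) \<le> \<Phi> T"
proof -
  have mono: "\<Phi> a \<le> \<Phi> b" if "a \<le> b" for a b
    unfolding \<Phi>_def using s N that by (intro divide_right_mono sum_mono2) auto
  have \<Phi>0: "0 \<le> \<Phi> a" for a unfolding \<Phi>_def using s N by (simp add: sum_nonneg)
  have \<phi>0: "0 \<le> \<phi>" using \<Phi>0[of T] \<phi> by linarith
  let ?c = "A * \<phi> ^ j"
  have c0: "0 \<le> ?c" using A \<phi>0 by simp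
  have lower: "exp (- 2 * ?c * \<Phi> a) - real a * \<delta> / N \<le> s a" if "a \<le> T" for a
    using that
  proof (induction a)
    case 0
    then show ?case using s by (simp add: \<Phi>_def)
  next
    case (Suc a)
    let ?u = "?c * s a / N"
    have "?c * s a \<le> ?c * 1" using c0 s by (intro mult_left_mono) auto
    then have "?c * s a \<le> N / 2" using \<phi>(2) by simp
    then have u: "0 \<le> ?u" "?u \<le> 1 / 2"
      using N mult_nonneg_nonneg[OF c0 s(1)[of a]] by (simp_all add: pos_divide_le_eq)
    have "- ?u - 2 * ?u\<^sup>2 \<le> ln (1 - ?u)" by (rule ln_one_minus_pos_lower_bound[OF u])
    moreover have "2 * ?u\<^sup>2 \<le> ?u" using mult_left_mono[OF u(2) u(1)] by (simp add: power2_eq_square)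
    ultimately have "- 2 * ?u \<le> ln (1 - ?u)" by linarith
    then have eu: "exp (- 2 * ?u) \<le> 1 - ?u" using u by (metis exp_le_cancel_iff exp_ln_iff diff_gt_0_iff_gt le_less_trans half_gt_zero_iff less_numeral_extra(1) field_sum_of_halves less_add_same_cancel1)
    have "A * (s a)\<^sup>2 * \<Phi> (Suc a) ^ j / N \<le> A * (s a)\<^sup>2 * \<phi> ^ j / N"
      using mono[OF Suc.prems] \<phi>(1) \<Phi>0 A N
      by (intro divide_right_mono mult_left_mono power_mono) auto
    also have "\<dots> = s a * ?u" by (simp add: power2_eq_square)
    finally have "s (Suc a) \<ge> s a * (1 - ?u) - \<delta> / N" using step[of a] Suc.prems by (simp add: algebra_simps)
    moreover have "s a * (1 - ?u) \<ge> s a * exp (- 2 * ?u)" using eu s by (intro mult_left_mono) auto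
    moreover have "s a * exp (- 2 * ?u) \<ge> (exp (- 2 * ?c * \<Phi> a) - real a * \<delta> / N) * exp (- 2 * ?u)"
      using Suc by (intro mult_right_mono) auto
    moreover have "real a * \<delta> / N * exp (- 2 * ?u) \<le> real a * \<delta> / N * 1"
      using A N u by (intro mult_left_mono) auto
    moreover have "exp (- 2 * ?c * \<Phi> a) * exp (- 2 * ?u) = exp (- 2 * ?c * \<Phi> (Suc a))"
      unfolding exp_add[symmetric] \<Phi>_def using N by (simp add: field_simps)
    ultimately have "s (Suc a) \<ge> exp (- 2 * ?c * \<Phi> (Suc a)) - real a * \<delta> / N - \<delta> / N"
      by (simp add: left_diff_distrib)
    then show ?case by (simp add: add_divide_distrib algebra_simps)
  qed
  have "(\<Sum>a<T. exp (- 2 * A * \<phi> ^ Suc j) - real T * \<delta> / N) \<le> (\<Sum>a<T. s a)"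
  proof (rule sum_mono)
    fix a assume a: "a \<in> {..<T}"
    have "\<Phi> a \<le> \<phi>" using mono[of a T] \<phi>(1) a by simp
    then have "2 * ?c * \<Phi> a \<le> 2 * ?c * \<phi>" using c0 by (intro mult_left_mono) auto
    then have "exp (- (2 * ?c * \<phi>)) \<le> exp (- (2 * ?c * \<Phi> a))" by simp
    then have "exp (- 2 * A * \<phi> ^ Suc j) \<le> exp (- 2 * ?c * \<Phi> a)" by (simp add: mult_ac)
    moreover have "real a * \<delta> / N \<le> real T * \<delta> / N" using a A N by (intro divide_right_mono mult_right_mono) auto
    ultimately show "exp (- 2 * A * \<phi> ^ Suc j) - real T * \<delta> / N \<le> s a"
      using lower[of a] a unfolding lessThan_iff by linarith
  qed
  then have "real T * (exp (- 2 * A * \<phi> ^ Suc j) - real T * \<delta> / N) \<le> N * \<Phi> T"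
    unfolding \<Phi>_def using N by simp
  then show ?thesis using N by (simp add: field_simps)
qed

section \<open>Symmetry under permutations of the vertices\<close>

context balanced_graph
begin

lemma copies_perm_sub:
  assumes "\<pi> permutes {1..n}" "C \<in> copies n"
  shows "(`) \<pi> ` C \<in> copies n"
proof -
  obtain \<phi> where \<phi>: "\<phi> \<in> emb n" "C = img \<phi>" using assms(2) by (auto simp: copies_def)
  let ?\<psi> = "restrict (\<pi> \<circ> \<phi>) VH"
  have "inj_on (\<pi> \<circ> \<phi>) VH"
    using emb_inj[OF \<phi>(1)] permutes_inj[OF assms(1)] by (intro comp_inj_on) (auto intro: inj_on_subset)
  moreover have "\<pi> (\<phi> x) \<in> {1..n}" if "x \<in> VH" for x
    using permutes_in_image[OF assms(1)] emb_range[OF \<phi>(1)] that by blast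
  ultimately have "?\<psi> \<in> emb n" unfolding emb_def by (auto simp: inj_on_def)
  moreover have "img ?\<psi> = (`) \<pi> ` C"
  proof -
    have "?\<psi> ` e = \<pi> ` \<phi> ` e" if "e \<in> EH" for e using EH_sub[OF that] by (auto simp: image_iff)
    then have "(\<lambda>e. ?\<psi> ` e) ` EH = (\<lambda>e. \<pi> ` \<phi> ` e) ` EH" by (intro image_cong) auto
    also have "\<dots> = (`) \<pi> ` (\<lambda>e. \<phi> ` e) ` EH" by (simp only: image_image[of "(`) \<pi>"])
    finally show ?thesis unfolding \<phi>(2) img_def .
  qed
  ultimately show ?thesis unfolding copies_def by (metis imageI)
qed

lemma copies_perm:
  assumes "\<pi> permutes {1..n}"
  shows "(`) ((`) \<pi>) ` copies n = copies n"
proof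
  show "(`) ((`) \<pi>) ` copies n \<subseteq> copies n" using copies_perm_sub[OF assms] by auto
  show "copies n \<subseteq> (`) ((`) \<pi>) ` copies n"
  proof
    fix C assume C: "C \<in> copies n"
    have "(`) (inv \<pi>) ` C \<in> copies n" using copies_perm_sub[OF permutes_inv[OF assms] C] .
    moreover have "(`) \<pi> ` ((`) (inv \<pi>) ` C) = C"
      using permutes_inverses(1)[OF assms] by (simp add: image_image)
    ultimately show "C \<in> (`) ((`) \<pi>) ` copies n" by (metis imageI)
  qed
qed

lemma acc_perm:
  assumes "\<pi> permutes {1..n}"
  shows "acc n d (\<lambda>e. \<beta> (\<pi> ` e)) f = acc n d \<beta> (\<pi> ` f)"
proof (induction d arbitrary: f)
  case (Suc d)
  have inj: "\<pi> ` a = \<pi> ` b \<longleftrightarrow> a = b" for a b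
    using inj_image_eq_iff[OF permutes_inj[OF assms]] .
  have "acc n (Suc d) \<beta> (\<pi> ` f) \<longleftrightarrow> (\<forall>C\<in>(`) ((`) \<pi>) ` copies n. \<pi> ` f \<in> C \<longrightarrow> (\<exists>e\<in>C - {\<pi> ` f}. \<beta> e \<ge> \<beta> (\<pi> ` f) \<or> \<not> acc n d \<beta> e))"
    unfolding acc.simps copies_perm[OF assms] ..
  also have "\<dots> \<longleftrightarrow> (\<forall>C\<in>copies n. \<pi> ` f \<in> (`) \<pi> ` C \<longrightarrow> (\<exists>e\<in>(`) \<pi> ` C - {\<pi> ` f}. \<beta> e \<ge> \<beta> (\<pi> ` f) \<or> \<not> acc n d \<beta> e))"
    by simp
  also have "\<dots> \<longleftrightarrow> (\<forall>C\<in>copies n. f \<in> C \<longrightarrow> (\<exists>e\<in>C - {f}. \<beta> (\<pi> ` e) \<ge> \<beta> (\<pi> ` f) \<or> \<not> acc n d \<beta> (\<pi> ` e)))"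
  proof (intro ball_cong refl)
    fix C :: "nat set set"
    have "(`) \<pi> ` C - {\<pi> ` f} = (`) \<pi> ` (C - {f})" "\<pi> ` f \<in> (`) \<pi> ` C \<longleftrightarrow> f \<in> C" using inj by auto
    then show "(\<pi> ` f \<in> (`) \<pi> ` C \<longrightarrow> (\<exists>e\<in>(`) \<pi> ` C - {\<pi> ` f}. \<beta> e \<ge> \<beta> (\<pi> ` f) \<or> \<not> acc n d \<beta> e)) \<longleftrightarrow>
      (f \<in> C \<longrightarrow> (\<exists>e\<in>C - {f}. \<beta> (\<pi> ` e) \<ge> \<beta> (\<pi> ` f) \<or> \<not> acc n d \<beta> (\<pi> ` e)))" by simp
  qed
  also have "\<dots> \<longleftrightarrow> acc n (Suc d) (\<lambda>e. \<beta> (\<pi> ` e)) f" unfolding acc.simps Suc.IH ..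
  finally show ?case by simp
qed simp

lemma opn_symmetric:
  assumes f: "f \<in> Kn_edges n" and g: "g \<in> Kn_edges n"
  shows "pr (timings (Kn_edges n) N) (opn n f t) = pr (timings (Kn_edges n) N) (opn n g t)"
proof -
  obtain a b where ab: "f = {a, b}" "a \<noteq> b" using edge_card2[OF f] by (metis card_2_iff)
  obtain c d where cd: "g = {c, d}" "c \<noteq> d" using edge_card2[OF g] by (metis card_2_iff)
  have rng: "a \<in> {1..n}" "b \<in> {1..n}" "c \<in> {1..n}" "d \<in> {1..n}"
    using f g unfolding in_Kn_edges ab cd by auto
  \<comment> \<open>The inner transposition sends \<open>a\<close> to \<open>c\<close>; the outer
    one sends the image of \<open>b\<close> to \<open>d\<close> and leaves \<open>c\<close> alone,
    since \<open>c\<close> is neither this image nor \<open>d\<close>.\<close>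
  define \<pi> where "\<pi> = Transposition.transpose (Transposition.transpose a c b) d \<circ> Transposition.transpose a c"
  have b1: "Transposition.transpose a c b \<in> {1..n}" using rng by (auto simp: Transposition.transpose_def)
  have perm: "\<pi> permutes {1..n}" unfolding \<pi>_def
    by (intro permutes_compose permutes_swap_id) (use rng b1 in auto)
  have im: "\<pi> ` f = g" unfolding \<pi>_def ab cd using ab(2) cd(2) by (auto simp: Transposition.transpose_def)
  have inj: "\<pi> ` x = \<pi> ` y \<longleftrightarrow> x = y" for x y
    using inj_image_eq_iff[OF permutes_inj[OF perm]] .
  have edges: "\<pi> ` e \<in> Kn_edges n \<longleftrightarrow> e \<in> Kn_edges n" for e
  proof -
    have "card (\<pi> ` e) = card e" by (rule card_image) (use permutes_inj[OF perm] inj_on_subset in blast)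
    moreover have "\<pi> ` e \<subseteq> {1..n} \<longleftrightarrow> e \<subseteq> {1..n}" using permutes_in_image[OF perm] by blast
    ultimately show ?thesis by (simp add: in_Kn_edges)
  qed
  have perm': "inv \<pi> permutes {1..n}" by (rule permutes_inv[OF perm])
  have inv1: "\<pi> ` inv \<pi> ` e = e" and inv2: "inv \<pi> ` \<pi> ` e = e" for e
    using permutes_inverses[OF perm] by (simp_all add: image_image)
  let ?W = "timings (Kn_edges n) N" and ?h = "\<lambda>\<beta> e. \<beta> (\<pi> ` e)"
  have "bij_betw ?h ?W ?W"
  proof (rule bij_betw_byWitness[where f' = "\<lambda>\<beta> e. \<beta> (inv \<pi> ` e)"])
    have "inv \<pi> ` e \<in> Kn_edges n \<longleftrightarrow> e \<in> Kn_edges n" for e using edges[of "inv \<pi> ` e"] inv1 by simp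
    then show "(\<lambda>\<beta> e. \<beta> (inv \<pi> ` e)) ` ?W \<subseteq> ?W" by (auto simp: PiE_iff extensional_def)
    show "?h ` ?W \<subseteq> ?W" using edges by (auto simp: PiE_iff extensional_def)
  qed (simp_all add: inv1 inv2)
  then have "pr ?W (\<lambda>\<beta>. opn n f t (?h \<beta>)) = pr ?W (opn n f t)" by (rule pr_bij)
  moreover have "opn n f t (?h \<beta>) = opn n g t \<beta>" for \<beta>
  proof -
    have "(?h \<beta>)(f := t) = (\<lambda>e. (\<beta>(\<pi> ` f := t)) (\<pi> ` e))" using inj by auto
    then have "acc n (Suc t) ((?h \<beta>)(f := t)) f = acc n (Suc t) (\<beta>(\<pi> ` f := t)) (\<pi> ` f)"
      using acc_perm[OF perm, of "Suc t" "\<beta>(\<pi> ` f := t)" f] by (simp only:)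
    then show ?thesis unfolding opn_def Acc_def im[symmetric] by (simp only: fun_upd_same)
  qed
  ultimately show ?thesis by simp
qed

end

section \<open>The difference inequality for openness\<close>

context sparse_scale
begin

definition s :: "nat \<Rightarrow> real" where
  "s t = pr \<Omega> (opn n {1, 2} t)"

definition \<Phi> :: "nat \<Rightarrow> real" where "\<Phi> a = (\<Sum>b<a. s b) / real N"

lemma s_bounds: "0 \<le> s t" "s t \<le> 1" unfolding s_def by (auto simp: pr_le_1)

lemma Phi_nonneg: "0 \<le> \<Phi> a" unfolding \<Phi>_def using s_bounds by (simp add: sum_nonneg)

lemma card_Omega_pos: "card \<Omega> > 0"
  using N_pos by (simp add: card_PiE)

lemma s_0: "s 0 = 1"
proof -
  have "opn n f 0 \<beta>" for f \<beta>
  proof -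
    have "\<exists>e\<in>C - {f}. True" if "C \<in> copies n" "f \<in> C" for C
    proof -
      have "card (C - {f}) = eH - 1" using copy_card[OF that(1)] that(2) copy_finite[OF that(1)] by simp
      then show ?thesis using eH_ge by (metis card.empty all_not_in_conv diff_is_0_eq not_numeral_le_zero le_antisym numeral_le_one_iff order_trans semiring_norm(70))
    qed
    then show ?thesis unfolding opn_def Acc_rec[of n "\<beta>(f := 0)" f] by fastforce
  qed
  then have "{x\<in>\<Omega>. opn n {1, 2} 0 x} = \<Omega>" by blast
  then show ?thesis unfolding s_def pr_def using card_Omega_pos by (simp only: divide_self_if of_nat_eq_0_iff neq0_conv[symmetric] if_False)
qed

lemma s_eq:
  assumes "n \<ge> 2" "f \<in> Kn_edges n" shows "pr \<Omega> (opn n f t) = s t"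
  unfolding s_def by (rule opn_symmetric[OF assms(2)]) (use assms(1) in \<open>auto simp: in_Kn_edges\<close>)

lemma pr_fix:
  assumes "I \<subseteq> Kn_edges n" "\<And>e. e \<in> I \<Longrightarrow> \<tau> e < N"
  shows "pr \<Omega> (\<lambda>x. \<forall>e\<in>I. x e = \<tau> e) = (1 / real N) ^ card I"
  using pr_box[OF finite_Kn_edges assms(1), of "\<lambda>e. {\<tau> e}" N] assms(2) N_pos by simp

text \<open>Resetting \<open>f\<close> to the time \<open>N\<close>, which no other edge attains, removes its influence on the others.\<close>

lemma closing_copy:
  assumes d: "opn n f a \<beta>" "\<not> opn n f (Suc a) \<beta>" and aN: "a < N"
  shows "\<exists>C\<in>{C\<in>copies n. f \<in> C}. \<exists>g\<in>C - {f}. \<beta> g = a \<and> (\<forall>e\<in>C - {f}. \<beta> e \<le> a) \<and>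
     (\<forall>e\<in>C. opn n e (if e = f then a else \<beta> e) (\<beta>(f := N)))"
proof -
  let ?\<gamma> = "\<beta>(f := Suc a)"
  obtain C where C: "C \<in> copies n" "f \<in> C" "\<And>e. e \<in> C - {f} \<Longrightarrow> ?\<gamma> e < Suc a \<and> Acc n ?\<gamma> e"
    using d(2) unfolding opn_def Acc_rec[of n ?\<gamma> f] by (auto simp: not_le)
  have le: "\<beta> e \<le> a" if "e \<in> C - {f}" for e using C(3)[OF that] that by auto
  \<comment> \<open>An edge of \<open>C - {f}\<close> is born no later than \<open>a\<close>, and
    only strictly earlier edges matter for it. So its status is the same for every birthtime of
    \<open>f\<close> from \<open>a\<close> on.\<close>
  have same: "Acc n (\<beta>(f := c)) e" if "e \<in> C - {f}" "c \<ge> a" for e c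
  proof -
    have "Acc n (\<beta>(f := c)) e = Acc n ?\<gamma> e"
    proof (rule Acc_cong)
      show "(\<beta>(f := c)) e = ?\<gamma> e" using that by auto
      fix h assume "(\<beta>(f := c)) h < (\<beta>(f := c)) e \<or> ?\<gamma> h < (\<beta>(f := c)) e"
      then show "(\<beta>(f := c)) h = ?\<gamma> h" using le[OF that(1)] that by (auto split: if_splits)
    qed
    then show ?thesis using C(3)[OF that(1)] by simp
  qed
  \<comment> \<open>Otherwise all of \<open>C - {f}\<close> would be born before \<open>a\<close>,
    and \<open>C\<close> would block \<open>f\<close> already at time \<open>a\<close>.\<close>
  have "\<exists>g\<in>C - {f}. \<not> \<beta> g < a"
  proof (rule ccontr)
    assume "\<not> ?thesis"
    then have "\<forall>e\<in>C - {f}. (\<beta>(f := a)) e < (\<beta>(f := a)) f \<and> Acc n (\<beta>(f := a)) e" using same by auto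
    then have "\<not> Acc n (\<beta>(f := a)) f" unfolding Acc_rec[of n "\<beta>(f := a)" f] using C(1,2) by (meson not_le)
    then show False using d(1) by (simp add: opn_def)
  qed
  then obtain g where g: "g \<in> C - {f}" "\<not> \<beta> g < a" by blast
  then have ga: "\<beta> g = a" using le[OF g(1)] by simp
  have "opn n e (if e = f then a else \<beta> e) (\<beta>(f := N))" if "e \<in> C" for e
  proof (cases "e = f")
    case True
    then show ?thesis using d(1) by (simp add: opn_def)
  next
    case False
    then have "(\<beta>(f := N))(e := \<beta> e) = \<beta>(f := N)" by auto
    then show ?thesis using False same[of e N] that aN by (simp add: opn_def)
  qed
  then show ?thesis using C(1,2) g(1) ga le by (intro bexI[of _ C] bexI[of _ g]) auto
qed

text \<open>The birthtimes on \<open>C - {f}\<close> are fixed to each possible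
  \<open>\<tau>\<close> in turn. With \<open>\<tau>\<close> written in, openness no longer depends
  on these coordinates, so the two parts are independent and \<open>decorrelation\<close> bounds the
  second. The sum over \<open>\<tau>\<close> of the products of \<open>s\<close> factorises:
  \<open>f\<close> and \<open>g\<close> contribute \<open>s a\<close> each, every other edge the sum
  up to \<open>a\<close>, which is \<open>N * \<Phi> (Suc a)\<close>.\<close>

lemma closing_probability:
  assumes n2: "n \<ge> 2" and a: "a < T" and C: "C \<in> copies n" "f \<in> C" and g: "g \<in> C - {f}"
  shows "pr \<Omega> (\<lambda>\<beta>. \<beta> g = a \<and> (\<forall>e\<in>C - {f}. \<beta> e \<le> a) \<and> (\<forall>e\<in>C. opn n e (if e = f then a else \<beta> e) (\<beta>(f := N))))
    \<le> ((s a)\<^sup>2 * \<Phi> (Suc a) ^ (eH - 2) + (real T / real N) ^ (eH - 2) * \<epsilon>) / real N"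
proof -
  let ?I = "C - {f}"
  define D where "D = PiE ?I (\<lambda>e. if e = g then {a} else {..a})"
  have CE: "C \<subseteq> Kn_edges n" by (rule copy_edges[OF C(1)])
  have finI: "finite ?I" using copy_finite[OF C(1)] by simp
  have cI: "card ?I = eH - 1" using copy_card[OF C(1)] C(2) copy_finite[OF C(1)] by simp
  have cIg: "card (?I - {g}) = eH - 2" using cI g finI by simp
  have finD: "finite D" unfolding D_def by (intro finite_PiE finI) auto
  have Dle: "\<tau> e \<le> a" if "\<tau> \<in> D" "e \<in> ?I" for \<tau> e
    using PiE_mem[OF that(1)[unfolded D_def] that(2)] by (auto split: if_splits)
  have Dg: "\<tau> g = a" if "\<tau> \<in> D" for \<tau>
    using PiE_mem[OF that(1)[unfolded D_def] g] by simp
  have eps0: "\<epsilon> \<ge> 0" unfolding \<epsilon>_def using rho_nonneg tauL_nonneg eta by simp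
  let ?Q = "\<lambda>\<tau> x. \<forall>e\<in>C. opn n e ((\<tau>(f := a)) e) (hyb C (\<tau>(f := N)) x)"
  have "pr \<Omega> (\<lambda>\<beta>. \<beta> g = a \<and> (\<forall>e\<in>?I. \<beta> e \<le> a) \<and> (\<forall>e\<in>C. opn n e (if e = f then a else \<beta> e) (\<beta>(f := N))))
    \<le> pr \<Omega> (\<lambda>x. \<exists>\<tau>\<in>D. (\<forall>e\<in>?I. x e = \<tau> e) \<and> ?Q \<tau> x)"
  proof (rule pr_mono)
    fix x assume x: "x g = a \<and> (\<forall>e\<in>?I. x e \<le> a) \<and> (\<forall>e\<in>C. opn n e (if e = f then a else x e) (x(f := N)))"
    let ?\<tau> = "restrict x ?I"
    have "?\<tau> \<in> D" unfolding D_def using x by auto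
    moreover have "\<forall>e\<in>?I. x e = ?\<tau> e" by simp
    moreover have "hyb C (?\<tau>(f := N)) x = x(f := N)" using C(2) by (auto simp: hyb_def)
    moreover have "(?\<tau>(f := a)) e = (if e = f then a else x e)" if "e \<in> C" for e using that by simp
    ultimately have "?\<tau> \<in> D \<and> (\<forall>e\<in>?I. x e = ?\<tau> e) \<and> ?Q ?\<tau> x" using x by simp
    then show "\<exists>\<tau>\<in>D. (\<forall>e\<in>?I. x e = \<tau> e) \<and> ?Q \<tau> x" by blast
  qed simp
  also have "\<dots> \<le> (\<Sum>\<tau>\<in>D. pr \<Omega> (\<lambda>x. (\<forall>e\<in>?I. x e = \<tau> e) \<and> ?Q \<tau> x))"
    by (rule pr_Bex[OF finite_Omega finD])
  also have "\<dots> \<le> (\<Sum>\<tau>\<in>D. (1 / real N) ^ (eH - 1) * (s a * (\<Prod>e\<in>?I. s (\<tau> e)) + \<epsilon>))"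
  proof (rule sum_mono)
    fix \<tau> assume \<tau>: "\<tau> \<in> D"
    have "pr \<Omega> (\<lambda>x. (\<forall>e\<in>?I. x e = \<tau> e) \<and> ?Q \<tau> x) = pr \<Omega> (\<lambda>x. \<forall>e\<in>?I. x e = \<tau> e) * pr \<Omega> (?Q \<tau>)"
    proof (rule pr_indep[OF finite_Omega, of ?I])
      fix x y :: "nat set \<Rightarrow> nat"
      assume "\<And>e. e \<notin> ?I \<Longrightarrow> x e = y e"
      then have "hyb C (\<tau>(f := N)) x = hyb C (\<tau>(f := N)) y" by (auto simp: hyb_def)
      then show "?Q \<tau> x = ?Q \<tau> y" by simp
    qed auto
    also have "pr \<Omega> (\<lambda>x. \<forall>e\<in>?I. x e = \<tau> e) = (1 / real N) ^ (eH - 1)"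
      unfolding cI[symmetric] by (rule pr_fix) (use CE Dle[OF \<tau>] a T_le in fastforce)+
    finally have eq: "pr \<Omega> (\<lambda>x. (\<forall>e\<in>?I. x e = \<tau> e) \<and> ?Q \<tau> x) = (1 / real N) ^ (eH - 1) * pr \<Omega> (?Q \<tau>)" .
    have "pr \<Omega> (?Q \<tau>) \<le> (\<Prod>b\<in>C. pr \<Omega> (opn n b ((\<tau>(f := a)) b))) + \<epsilon>"
    proof (rule decorrelation[OF C(1)])
      \<comment> \<open>For \<open>b = f\<close> the late edge is \<open>g\<close>, born at
        \<open>a\<close> exactly; for every other \<open>b\<close> it is \<open>f\<close>, parked at
        time \<open>N\<close>.\<close>
      fix b assume b: "b \<in> C"
      show "(\<tau>(f := a)) b \<le> T" using Dle[OF \<tau>, of b] a b by (cases "b = f") auto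
      show "\<exists>h\<in>C - {b}. (\<tau>(f := N)) h \<ge> (\<tau>(f := a)) b"
      proof (cases "b = f")
        case True
        then show ?thesis using g Dg[OF \<tau>] by (intro bexI[of _ g]) auto
      next
        case False
        have "\<tau> b \<le> N" using Dle[OF \<tau>, of b] a b False T_le by auto
        then show ?thesis using False C(2) by (intro bexI[of _ f]) auto
      qed
    qed
    also have "(\<Prod>b\<in>C. pr \<Omega> (opn n b ((\<tau>(f := a)) b))) = (\<Prod>b\<in>C. s ((\<tau>(f := a)) b))"
      by (rule prod.cong) (use s_eq[OF n2] CE in auto)
    also have "\<dots> = s a * (\<Prod>e\<in>?I. s (\<tau> e))"
      by (subst prod.remove[OF copy_finite[OF C(1)] C(2)]) (auto intro!: arg_cong2[where f = "(*)"] prod.cong)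
    finally have "pr \<Omega> (?Q \<tau>) \<le> s a * (\<Prod>e\<in>?I. s (\<tau> e)) + \<epsilon>" .
    then show "pr \<Omega> (\<lambda>x. (\<forall>e\<in>?I. x e = \<tau> e) \<and> ?Q \<tau> x) \<le> (1 / real N) ^ (eH - 1) * (s a * (\<Prod>e\<in>?I. s (\<tau> e)) + \<epsilon>)"
      unfolding eq by (rule mult_left_mono) simp
  qed
  also have "\<dots> = (1 / real N) ^ (eH - 1) * (s a * (\<Sum>\<tau>\<in>D. \<Prod>e\<in>?I. s (\<tau> e)) + real (card D) * \<epsilon>)"
    by (simp add: sum_distrib_left sum.distrib distrib_left)
  also have "(\<Sum>\<tau>\<in>D. \<Prod>e\<in>?I. s (\<tau> e)) = (\<Prod>e\<in>?I. \<Sum>t\<in>(if e = g then {a} else {..a}). s t)"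
    unfolding D_def by (rule prod_sum_PiE[symmetric]) (use finI in auto)
  also have "\<dots> = s a * (\<Prod>e\<in>?I - {g}. \<Sum>t\<le>a. s t)"
    by (subst prod.remove[OF finI g]) (auto simp del: prod_constant intro!: arg_cong2[where f = "(*)"] prod.cong)
  also have "\<dots> = s a * (real N * \<Phi> (Suc a)) ^ (eH - 2)"
    using N_pos by (simp add: cIg \<Phi>_def lessThan_Suc_atMost)
  also have "card D = (\<Prod>e\<in>?I. if e = g then 1 else Suc a)"
    unfolding D_def by (subst card_PiE[OF finI], rule prod.cong) auto
  also have "\<dots> = Suc a ^ (eH - 2)"
  proof -
    have "(\<Prod>e\<in>?I. if e = g then 1 else Suc a) = (\<Prod>e\<in>?I - {g}. Suc a)"
      by (subst prod.remove[OF finI g]) (auto simp del: prod_constant intro!: prod.cong)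
    then show ?thesis by (simp add: cIg)
  qed
  also have "(1 / real N) ^ (eH - 1) * (s a * (s a * (real N * \<Phi> (Suc a)) ^ (eH - 2)) + real (Suc a ^ (eH - 2)) * \<epsilon>)
    \<le> (1 / real N) ^ (eH - 1) * (s a * (s a * (real N * \<Phi> (Suc a)) ^ (eH - 2)) + real T ^ (eH - 2) * \<epsilon>)"
    using a eps0 by (intro mult_left_mono add_left_mono mult_right_mono) (auto intro: power_mono simp flip: of_nat_Suc)
  also have "\<dots> = ((s a)\<^sup>2 * \<Phi> (Suc a) ^ (eH - 2) + (real T / real N) ^ (eH - 2) * \<epsilon>) / real N"
  proof -
    have "eH - 1 = Suc (eH - 2)" using eH_ge by simp
    then show ?thesis using N_pos by (simp add: power2_eq_square field_simps)
  qed
  finally show ?thesis .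
qed

text \<open>The bound for the number of copies through an edge, times the \<open>eH - 1\<close>
  choices of an edge \<open>g\<close> of the copy born in the closing slot.\<close>

definition "A\<^sub>0 = 4 * real eH * real n ^ (vH - 2) * (real eH - 1)"

lemma openness_step:
  assumes n2: "n \<ge> 2" and a: "a < T"
  shows "s a - s (Suc a) \<le> A\<^sub>0 * (s a)\<^sup>2 * \<Phi> (Suc a) ^ (eH - 2) / real N + A\<^sub>0 * (real T / real N) ^ (eH - 2) * \<epsilon> / real N"
proof -
  define f :: "nat set" where "f = {1, 2}"
  have f: "f \<in> Kn_edges n" unfolding f_def using n2 by (auto simp: in_Kn_edges)
  let ?X = "((s a)\<^sup>2 * \<Phi> (Suc a) ^ (eH - 2) + (real T / real N) ^ (eH - 2) * \<epsilon>) / real N"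
  have X0: "?X \<ge> 0"
    using Phi_nonneg rho_nonneg tauL_nonneg eta by (simp add: \<epsilon>_def)
  have finC: "finite (C - {f})" if "C \<in> {C\<in>copies n. f \<in> C}" for C using that copy_finite by auto
  let ?E = "\<lambda>C g \<beta>. \<beta> g = a \<and> (\<forall>e\<in>C - {f}. \<beta> e \<le> a) \<and> (\<forall>e\<in>C. opn n e (if e = f then a else \<beta> e) (\<beta>(f := N)))"
  have "s a \<le> pr \<Omega> (\<lambda>\<beta>. opn n f (Suc a) \<beta> \<or> (\<exists>C\<in>{C\<in>copies n. f \<in> C}. \<exists>g\<in>C - {f}. ?E C g \<beta>))"
    unfolding s_def f_def[symmetric] 
  proof (rule pr_mono[OF finite_Omega])
    fix \<beta> assume "opn n f a \<beta>"
    then show "opn n f (Suc a) \<beta> \<or> (\<exists>C\<in>{C\<in>copies n. f \<in> C}. \<exists>g\<in>C - {f}. ?E C g \<beta>)"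
      using closing_copy[of f a \<beta>] a T_le by (cases "opn n f (Suc a) \<beta>") simp_all
  qed
  also have "\<dots> \<le> s (Suc a) + pr \<Omega> (\<lambda>\<beta>. \<exists>C\<in>{C\<in>copies n. f \<in> C}. \<exists>g\<in>C - {f}. ?E C g \<beta>)"
    unfolding s_def f_def[symmetric] by (rule pr_disj) simp
  also have "pr \<Omega> (\<lambda>\<beta>. \<exists>C\<in>{C\<in>copies n. f \<in> C}. \<exists>g\<in>C - {f}. ?E C g \<beta>)
     \<le> (\<Sum>C\<in>{C\<in>copies n. f \<in> C}. pr \<Omega> (\<lambda>\<beta>. \<exists>g\<in>C - {f}. ?E C g \<beta>))"
    by (rule pr_Bex) auto
  also have "\<dots> \<le> (\<Sum>C\<in>{C\<in>copies n. f \<in> C}. \<Sum>g\<in>C - {f}. pr \<Omega> (?E C g))"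
    by (intro sum_mono pr_Bex finite_Omega finC)
  also have "\<dots> \<le> (\<Sum>C\<in>{C\<in>copies n. f \<in> C}. \<Sum>g\<in>C - {f}. ?X)"
    using closing_probability[OF n2 a] by (intro sum_mono) auto
  also have "\<dots> = (\<Sum>C\<in>{C\<in>copies n. f \<in> C}. (real eH - 1) * ?X)"
  proof (rule sum.cong)
    fix C assume C: "C \<in> {C\<in>copies n. f \<in> C}"
    then have "card (C - {f}) = eH - 1" using copy_card copy_finite by auto
    then show "(\<Sum>g\<in>C - {f}. ?X) = (real eH - 1) * ?X" using eH_ge by (simp add: of_nat_diff)
  qed simp
  also have "\<dots> = real (card {C\<in>copies n. f \<in> C}) * ((real eH - 1) * ?X)" by simp
  also have "\<dots> \<le> real (4 * eH * n ^ (vH - 2)) * ((real eH - 1) * ?X)"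
    using copies_through_edge[OF f] X0 eH_ge by (intro mult_right_mono mult_nonneg_nonneg of_nat_mono) auto
  also have "\<dots> = A\<^sub>0 * ?X" by (simp add: A\<^sub>0_def)
  finally show ?thesis by (simp add: add_divide_distrib distrib_left mult.assoc)
qed

lemma Phi_lower_bound:
  assumes "n \<ge> 2" "\<Phi> T \<le> \<phi>" "2 * A\<^sub>0 * \<phi> ^ (eH - 2) \<le> real N"
  shows "real T / real N * (exp (- 2 * A\<^sub>0 * \<phi> ^ (eH - 1)) - A\<^sub>0 * (real T / real N) ^ (eH - 1) * \<epsilon>) \<le> \<Phi> T"
proof -
  have "real T / real N * (exp (- 2 * A\<^sub>0 * \<phi> ^ Suc (eH - 2)) - real T * (A\<^sub>0 * (real T / real N) ^ (eH - 2) * \<epsilon>) / real N) \<le> (\<Sum>b<T. s b) / real N"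
  proof (rule discrete_growth)
    show "0 \<le> A\<^sub>0" using eH_ge by (simp add: A\<^sub>0_def)
    then show "0 \<le> A\<^sub>0 * (real T / real N) ^ (eH - 2) * \<epsilon>"
      using rho_nonneg tauL_nonneg eta by (simp add: \<epsilon>_def)
    show "\<And>a. a < T \<Longrightarrow> s a - s (Suc a) \<le> A\<^sub>0 * (s a)\<^sup>2 * ((\<Sum>b<Suc a. s b) / real N) ^ (eH - 2) / real N + A\<^sub>0 * (real T / real N) ^ (eH - 2) * \<epsilon> / real N"
      using openness_step[OF assms(1)] by (simp add: \<Phi>_def)
  qed (use s_bounds s_0 N_pos assms in \<open>auto simp: \<Phi>_def\<close>)
  moreover have "eH - 1 = Suc (eH - 2)" using eH_ge by simp
  ultimately show ?thesis by (simp add: \<Phi>_def mult_ac)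
qed

text \<open>Given that \<open>f\<close> is born at \<open>t\<close>, it is accepted with probability
  \<open>s t\<close>. Averaging over all slots gives the acceptance probability, and
  \<open>\<Phi> T\<close> keeps only the slots before \<open>T\<close>.\<close>

lemma acceptance_probability:
  assumes "n \<ge> 2" "f \<in> Kn_edges n"
  shows "\<Phi> T \<le> pr \<Omega> (\<lambda>\<beta>. Acc n \<beta> f)"
proof -
  have "pr \<Omega> (\<lambda>\<beta>. \<beta> f = t \<and> Acc n \<beta> f) = s t / real N" if "t < N" for t
  proof -
    have "pr \<Omega> (\<lambda>\<beta>. \<beta> f = t \<and> Acc n \<beta> f) = pr \<Omega> (\<lambda>\<beta>. (\<forall>e\<in>{f}. \<beta> e = t) \<and> opn n f t \<beta>)"
      unfolding opn_def by (rule pr_cong) (metis fun_upd_triv singletonD singletonI)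
    also have "\<dots> = pr \<Omega> (\<lambda>\<beta>. \<forall>e\<in>{f}. \<beta> e = t) * pr \<Omega> (opn n f t)"
    proof (rule pr_indep[OF finite_Omega, of "{f}"])
      fix x y :: "nat set \<Rightarrow> nat" assume "\<And>e. e \<notin> {f} \<Longrightarrow> x e = y e"
      then have "x(f := t) = y(f := t)" by auto
      then show "opn n f t x = opn n f t y" by (simp add: opn_def)
    qed auto
    also have "\<dots> = (1 / real N) ^ card {f} * s t"
      using pr_fix[of "{f}" "\<lambda>_. t"] assms that s_eq[OF assms] by simp
    finally show ?thesis by simp
  qed
  then have "(\<Sum>t<N. s t / real N) = (\<Sum>t<N. pr \<Omega> (\<lambda>\<beta>. \<beta> f = t \<and> Acc n \<beta> f))" by (intro sum.cong) auto
  also have "\<dots> = pr \<Omega> (\<lambda>\<beta>. Acc n \<beta> f)"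
    by (rule pr_partition[symmetric]) (use assms in \<open>auto simp: PiE_iff\<close>)
  finally have "(\<Sum>t<N. s t) / real N = pr \<Omega> (\<lambda>\<beta>. Acc n \<beta> f)" by (simp add: sum_divide_distrib)
  moreover have "\<Phi> T \<le> (\<Sum>t<N. s t) / real N"
    unfolding \<Phi>_def using s_bounds T_le by (intro divide_right_mono sum_mono2) auto
  ultimately show ?thesis by simp
qed

end

section \<open>From continuous to discrete birthtimes\<close>

lemma sort_key_order_cong:
  assumes "\<And>x y. x \<in> set xs \<Longrightarrow> y \<in> set xs \<Longrightarrow> f x \<le> f y \<longleftrightarrow> g x \<le> g y"
  shows "sort_key f xs = sort_key g xs"
  using assms
proof (induction xs)
  case (Cons x xs)
  have ins: "insort_key f x ys = insort_key g x ys" if "set ys \<subseteq> set (x # xs)" for ys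
    using that Cons.prems by (induction ys) auto
  have "sort_key f xs = sort_key g xs" by (rule Cons.IH) (use Cons.prems in auto)
  moreover have "insort_key f x (sort_key g xs) = insort_key g x (sort_key g xs)" by (rule ins) auto
  ultimately show ?case by simp
qed simp

lemma set_Kn_edge_list: "set (Kn_edge_list n) = Kn_edges n"
proof (rule set_eqI)
  fix e :: "nat set"
  have "e \<in> set (Kn_edge_list n) \<longleftrightarrow> (\<exists>j\<in>{1..<n + 1}. \<exists>i\<in>{1..<j}. e = {i, j})"
    unfolding Kn_edge_list_def set_concat set_map set_upt image_image by blast
  also have "\<dots> \<longleftrightarrow> (\<exists>i j. e = {i, j} \<and> 1 \<le> i \<and> i < j \<and> j \<le> n)"
  proof
    assume "\<exists>j\<in>{1..<n + 1}. \<exists>i\<in>{1..<j}. e = {i, j}"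
    then obtain i j where "j < n + 1" "1 \<le> i" "i < j" "e = {i, j}" by auto
    then show "\<exists>i j. e = {i, j} \<and> 1 \<le> i \<and> i < j \<and> j \<le> n" by (intro exI[of _ i] exI[of _ j]) auto
  next
    assume "\<exists>i j. e = {i, j} \<and> 1 \<le> i \<and> i < j \<and> j \<le> n"
    then obtain i j where "j \<le> n" "1 \<le> i" "i < j" "e = {i, j}" by auto
    then show "\<exists>j\<in>{1..<n + 1}. \<exists>i\<in>{1..<j}. e = {i, j}"
      by (intro bexI[of _ j] bexI[of _ i]) auto
  qed
  finally show "e \<in> set (Kn_edge_list n) \<longleftrightarrow> e \<in> Kn_edges n" unfolding Kn_edges_def by blast
qed

lemma distinct_Kn_edge_list: "distinct (Kn_edge_list n)"
proof -
  have inj: "distinct (map (\<lambda>i. {i, j}) [1..<j])" for j :: nat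
    by (auto simp: distinct_map inj_on_def doubleton_eq_iff)
  have "distinct (concat (map (\<lambda>j. map (\<lambda>i. {i, j}) [1..<j]) [1..<m]))" for m :: nat
  proof (induction m)
    case (Suc m)
    show ?case
    proof (cases "m \<ge> 1")
      case True
      have "{i, m} \<noteq> {i', j'}" if "j' < m" "i' < j'" for i i' j' :: nat using that by (auto simp: doubleton_eq_iff)
      then show ?thesis using Suc inj[of m] True by fastforce
    qed simp
  qed simp
  then show ?thesis unfolding Kn_edge_list_def .
qed

lemma card_Kn_edges_le: "card (Kn_edges n) \<le> n ^ 2"
proof -
  have "Kn_edges n \<subseteq> (\<lambda>(i, j). {i, j}) ` ({1..n} \<times> {1..n})" unfolding Kn_edges_def by force
  then have "card (Kn_edges n) \<le> card ({1..n} \<times> {1..n})" by (rule surj_card_le[rotated]) simp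
  then show ?thesis by (simp add: power2_eq_square)
qed

section \<open>The greedy process and the acceptance recursion\<close>

context balanced_graph
begin

lemma greedy_process:
  assumes inj: "inj_on b (Kn_edges n)"
  shows "foldl (\<lambda>G f. if has_copy VH EH n (insert f G) then G else insert f G) {} (sort_key b (Kn_edge_list n))
    = {f\<in>Kn_edges n. Acc n b f}"
proof -
  define xs where "xs = sort_key b (Kn_edge_list n)"
  have xs: "set xs = Kn_edges n" "distinct xs" "sorted (map b xs)"
    unfolding xs_def by (simp_all add: set_Kn_edge_list distinct_Kn_edge_list)
  have "distinct (map b xs)" using xs inj by (simp add: distinct_map)
  then have sorted: "sorted_wrt (<) (map b xs)" using xs by (simp add: strict_sorted_iff)
  let ?step = "\<lambda>G f. if has_copy VH EH n (insert f G) then G else insert f G"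
  have "foldl ?step {} ys = {f\<in>set ys. Acc n b f}" if "xs = ys @ zs" for ys zs
    using that
  proof (induction ys arbitrary: zs rule: rev_induct)
    case (snoc f ys)
    let ?G = "{e\<in>set ys. Acc n b e}"
    have IH: "foldl ?step {} ys = ?G" using snoc by simp
    have before: "e \<in> set ys \<longleftrightarrow> b e < b f" if "e \<in> Kn_edges n" for e
  proof -
      have "e \<in> set ys \<or> e = f \<or> e \<in> set zs" using that xs(1) unfolding snoc.prems by auto
      moreover have "\<forall>x\<in>set ys. b x < b f" "\<forall>x\<in>set zs. b f < b x"
        using sorted unfolding snoc.prems by (auto simp: sorted_wrt_append)
      ultimately show ?thesis by (meson less_asym' less_irrefl)
    qed
    have ysE: "set ys \<subseteq> Kn_edges n" using xs(1) unfolding snoc.prems by auto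
    have "has_copy VH EH n (insert f ?G) \<longleftrightarrow> \<not> Acc n b f"
    proof
      assume "\<not> Acc n b f"
      then obtain C where C: "C \<in> copies n" "f \<in> C" "\<And>e. e \<in> C - {f} \<Longrightarrow> b e < b f \<and> Acc n b e"
        unfolding Acc_rec[of n b f] by (auto simp: not_le)
      have "C \<subseteq> insert f ?G"
      proof
        fix e assume "e \<in> C"
        then show "e \<in> insert f ?G" using C(3)[of e] before[of e] copy_edges[OF C(1)] by auto
      qed
      then show "has_copy VH EH n (insert f ?G)" using has_copy_iff C(1) by blast
    next
      assume "has_copy VH EH n (insert f ?G)"
      then obtain C where C: "C \<in> copies n" "C \<subseteq> insert f ?G" using has_copy_iff by blast
      have rej: "\<not> Acc n b h" if "h \<in> C" "\<And>e. e \<in> C - {h} \<Longrightarrow> b e < b h \<and> Acc n b e" for h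
        unfolding Acc_rec[of n b h] using C(1) that by (meson not_le)
      show "\<not> Acc n b f"
      proof (cases "f \<in> C")
        case True
        show ?thesis
        proof (rule rej[OF True])
          fix e assume "e \<in> C - {f}"
          then have "e \<in> ?G" using C(2) by auto
          then show "b e < b f \<and> Acc n b e" using before[of e] ysE by auto
        qed
      next
        case False
        \<comment> \<open>A copy that avoids \<open>f\<close> would consist of accepted edges, yet
          its latest edge is blocked by the others.\<close>
        have fin: "finite (b ` C)" "b ` C \<noteq> {}"
          using copy_finite[OF C(1)] copy_card[OF C(1)] eH_ge by auto
        obtain h where h: "h \<in> C" "b h = Max (b ` C)" using Max_in[OF fin] by (metis imageE)
        have "\<not> Acc n b h"
        proof (rule rej[OF h(1)])
          fix e assume e: "e \<in> C - {h}"
          have "b e \<le> b h" unfolding h(2) using fin e by (intro Max_ge) auto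
          moreover have "b e \<noteq> b h" using inj_onD[OF inj, of e h] e h(1) copy_edges[OF C(1)] by auto
          moreover have "e \<in> ?G" using C(2) False e by auto
          ultimately show "b e < b h \<and> Acc n b e" by simp
        qed
        then show ?thesis using C(2) False h(1) by auto
      qed
    qed
    then show ?case using IH by auto
  qed simp
  from this[of xs "[]"] show ?thesis using xs(1) unfolding xs_def by simp
qed

end

section \<open>Slots of the uniform birthtimes\<close>

definition slot :: "nat \<Rightarrow> real \<Rightarrow> nat" where
  "slot N x = min (N - 1) (nat \<lfloor>real N * x\<rfloor>)"

lemma slot_mono: "x \<le> y \<Longrightarrow> slot N x \<le> slot N y"
  unfolding slot_def by (intro min.mono nat_mono floor_mono mult_left_mono) auto

lemma slot_less: "N > 0 \<Longrightarrow> slot N x < N"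
  unfolding slot_def by auto

lemma slot_measurable [measurable]: "slot N \<in> borel \<rightarrow>\<^sub>M count_space UNIV"
  unfolding slot_def by measurable

abbreviation "unif01 \<equiv> uniform_measure lborel {0..1::real}"

lemma prob_space_unif01: "prob_space unif01"
  by (rule prob_space_uniform_measure) auto

lemma measure_birth_box:
  assumes "\<And>e. e \<in> Kn_edges n \<Longrightarrow> S e \<in> sets unif01"
  shows "measure (birth_space n) (PiE (Kn_edges n) S) = (\<Prod>e\<in>Kn_edges n. measure unif01 (S e))"
proof -
  interpret p: prob_space unif01 by (rule prob_space_unif01)
  interpret finite_product_prob_space "\<lambda>_. unif01" "Kn_edges n" by standard simp
  show ?thesis unfolding birth_space_def using assms by (rule finite_measure_PiM_emb)
qed

text \<open>Within the unit interval, the slot lies between an open and a closed interval of length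
  \<open>1 / N\<close> with the same ends, so boundary points need no care; the cap in
  \<open>slot\<close> assigns the point 1 to the last slot.\<close>

lemma slot_uniform:
  assumes "j < N"
  shows "measure unif01 {x. slot N x = j} = 1 / real N"
proof -
  let ?S = "{x. slot N x = j}"
  let ?a = "real j / real N" and ?b = "(real j + 1) / real N"
  have N: "real N > 0" using assms by simp
  have b1: "?b \<le> 1" using assms by (simp add: divide_le_eq_1)
  have S: "?S \<in> sets borel" by measurable
  have sub1: "{?a<..<?b} \<subseteq> {0..1} \<inter> ?S"
  proof
    fix x assume x: "x \<in> {?a<..<?b}"
    then have lt: "real j < real N * x" "real N * x < real j + 1" using N by (auto simp: field_simps)
    then have "\<lfloor>real N * x\<rfloor> = int j" by (intro floor_unique) auto
    then have "slot N x = j" using assms by (simp add: slot_def)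
    moreover have "0 \<le> ?a" by simp
    then have "0 \<le> x" using x by (simp only: greaterThanLessThan_iff) linarith
    moreover have "x \<le> 1" using x b1 by auto
    ultimately show "x \<in> {0..1} \<inter> ?S" by auto
  qed
  have sub2: "{0..1} \<inter> ?S \<subseteq> {?a..?b}"
  proof
    fix x assume x: "x \<in> {0..1} \<inter> ?S"
    have x01: "0 \<le> x" "x \<le> 1" and sl: "slot N x = j" using x by auto
    have "j \<le> nat \<lfloor>real N * x\<rfloor>" using sl by (auto simp: slot_def)
    then have "real j \<le> real N * x" using x01 N by (simp add: le_nat_iff le_floor_iff)
    moreover have "real N * x \<le> real j + 1"
    proof (cases "j = N - 1")
      case True
      then have "real j + 1 = real N" using assms by simp
      then show ?thesis using x01 N by (simp add: mult_left_le)
    next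
      case False
      then have "nat \<lfloor>real N * x\<rfloor> = j" using sl by (auto simp: slot_def min_def split: if_splits)
      moreover have "0 \<le> \<lfloor>real N * x\<rfloor>" using x01 N by simp
      ultimately have "\<lfloor>real N * x\<rfloor> = int j" by linarith
      then show ?thesis by linarith
    qed
    ultimately show "x \<in> {?a..?b}" using N by (auto simp: field_simps)
  qed
  have fin: "{0..1} \<inter> ?S \<in> fmeasurable lborel"
    by (rule fmeasurableI2[of "{0..1}"]) (use S in \<open>auto intro!: fmeasurableI\<close>)
  have ab: "?a \<le> ?b" using N by (simp add: divide_right_mono)
  have "measure lborel {?a<..<?b} \<le> measure lborel ({0..1} \<inter> ?S)"
    by (rule measure_mono_fmeasurable[OF sub1 _ fin]) auto
  moreover have "measure lborel ({0..1} \<inter> ?S) \<le> measure lborel {?a..?b}"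
    by (rule measure_mono_fmeasurable[OF sub2]) (use S ab in \<open>auto intro!: fmeasurableI\<close>)
  ultimately have "measure lborel ({0..1} \<inter> ?S) = ?b - ?a" using ab by simp
  moreover have "?b - ?a = 1 / real N" using N by (simp add: field_simps)
  ultimately show ?thesis using S by (subst measure_uniform_measure) auto
qed

context balanced_graph
begin

abbreviation "slots N n \<beta> \<equiv> restrict (\<lambda>e. slot N (\<beta> e)) (Kn_edges n)"

lemma free_process_slots:
  assumes "inj_on (slots N n \<beta>) (Kn_edges n)"
  shows "free_process VH EH n \<beta> = {f\<in>Kn_edges n. Acc n (slots N n \<beta>) f}"
proof -
  have "sort_key \<beta> (Kn_edge_list n) = sort_key (slots N n \<beta>) (Kn_edge_list n)"
  proof (rule sort_key_order_cong, unfold set_Kn_edge_list)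
    fix x y assume xy: "x \<in> Kn_edges n" "y \<in> Kn_edges n"
    show "\<beta> x \<le> \<beta> y \<longleftrightarrow> slots N n \<beta> x \<le> slots N n \<beta> y"
    proof
      assume "\<beta> x \<le> \<beta> y" then show "slots N n \<beta> x \<le> slots N n \<beta> y" using xy slot_mono by simp
    next
      assume a: "slots N n \<beta> x \<le> slots N n \<beta> y"
      show "\<beta> x \<le> \<beta> y"
      proof (rule ccontr)
        assume "\<not> \<beta> x \<le> \<beta> y"
        then have lt: "\<beta> y < \<beta> x" by simp
        then have "slots N n \<beta> y \<le> slots N n \<beta> x" using xy slot_mono[of "\<beta> y" "\<beta> x"] by simp
        then have "slots N n \<beta> x = slots N n \<beta> y" using a by simp
        then have "x = y" using inj_onD[OF assms] xy by blast
        then show False using lt by simp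
      qed
    qed
  qed
  then show ?thesis unfolding free_process_def using greedy_process[OF assms] by simp
qed

lemma free_process_subset: "free_process VH EH n \<beta> \<subseteq> Kn_edges n"
proof -
  have "foldl (\<lambda>G f. if has_copy VH EH n (insert f G) then G else insert f G) G xs \<subseteq> G \<union> set xs" for G xs
  proof (induction xs arbitrary: G)
    case (Cons x xs)
    let ?G = "if has_copy VH EH n (insert x G) then G else insert x G"
    have "?G \<subseteq> insert x G" by auto
    then show ?case using Cons[of ?G] by auto
  qed simp
  from this[of "{}" "sort_key \<beta> (Kn_edge_list n)"] show ?thesis
    unfolding free_process_def by (simp add: set_Kn_edge_list)
qed

lemma measurable_edges [measurable]:
  "e \<in> Kn_edges n \<Longrightarrow> (\<lambda>\<beta>. \<beta> e) \<in> birth_space n \<rightarrow>\<^sub>M borel"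
  using measurable_component_singleton[of e "Kn_edges n" "\<lambda>_. unif01"] unfolding birth_space_def
  by (simp cong: measurable_cong_sets)

text \<open>The process sees the birthtimes only through their weak order \<open>R \<beta>\<close>
  on finitely many edges. So the count is a finite sum of constants \<open>H r\<close> times
  indicators of measurable sets; \<open>SOME\<close> picks a representative of each order.\<close>

lemma measurable_card_free_process:
  "(\<lambda>\<beta>. real (card (free_process VH EH n \<beta>))) \<in> borel_measurable (birth_space n)"
proof -
  let ?E = "Kn_edges n"
  define R where "R \<beta> = {(e, e'). e \<in> ?E \<and> e' \<in> ?E \<and> \<beta> e \<le> (\<beta> e' :: real)}" for \<beta>
  define H where "H r = real (card (free_process VH EH n (SOME \<beta>. R \<beta> = r)))" for r
  have fin: "finite (Pow (?E \<times> ?E))" by simp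
  have same: "free_process VH EH n \<beta> = free_process VH EH n \<beta>'" if "R \<beta> = R \<beta>'" for \<beta> \<beta>'
  proof -
    have "sort_key \<beta> (Kn_edge_list n) = sort_key \<beta>' (Kn_edge_list n)"
    proof (rule sort_key_order_cong, unfold set_Kn_edge_list)
      fix x y assume "x \<in> ?E" "y \<in> ?E"
      then show "\<beta> x \<le> \<beta> y \<longleftrightarrow> \<beta>' x \<le> \<beta>' y" using that unfolding R_def by (auto simp: set_eq_iff)
    qed
    then show ?thesis unfolding free_process_def by simp
  qed
  have HR: "real (card (free_process VH EH n \<beta>)) = H (R \<beta>)" for \<beta>
    unfolding H_def using same[of \<beta> "SOME \<beta>'. R \<beta>' = R \<beta>"] someI[of "\<lambda>\<beta>'. R \<beta>' = R \<beta>" \<beta>] by simp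
  have eq: "real (card (free_process VH EH n \<beta>)) = (\<Sum>r\<in>Pow (?E \<times> ?E). H r * of_bool (\<forall>e\<in>?E. \<forall>e'\<in>?E. \<beta> e \<le> \<beta> e' \<longleftrightarrow> (e, e') \<in> r))" for \<beta>
  proof -
    have "(\<Sum>r\<in>Pow (?E \<times> ?E). H r * of_bool (\<forall>e\<in>?E. \<forall>e'\<in>?E. \<beta> e \<le> \<beta> e' \<longleftrightarrow> (e, e') \<in> r))
      = (\<Sum>r\<in>Pow (?E \<times> ?E). if r = R \<beta> then H r else 0)"
    proof (rule sum.cong)
      fix r assume "r \<in> Pow (?E \<times> ?E)"
      then have "(\<forall>e\<in>?E. \<forall>e'\<in>?E. \<beta> e \<le> \<beta> e' \<longleftrightarrow> (e, e') \<in> r) \<longleftrightarrow> r = R \<beta>" unfolding R_def by auto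
      then show "H r * of_bool (\<forall>e\<in>?E. \<forall>e'\<in>?E. \<beta> e \<le> \<beta> e' \<longleftrightarrow> (e, e') \<in> r) = (if r = R \<beta> then H r else 0)" by simp
    qed simp
    also have "\<dots> = H (R \<beta>)" by (subst sum.delta[OF fin]) (auto simp: R_def)
    finally show ?thesis using HR by simp
  qed
  have "{\<beta> \<in> space (birth_space n). \<beta> e \<le> \<beta> e' \<longleftrightarrow> (e, e') \<in> r} \<in> sets (birth_space n)"
    if e: "e \<in> ?E" "e' \<in> ?E" for e e' and r :: "(nat set \<times> nat set) set"
  proof (cases "(e, e') \<in> r")
    case True
    then show ?thesis using borel_measurable_le[OF measurable_edges[OF e(1)] measurable_edges[OF e(2)]] by simp
  next
    case False
    then show ?thesis using borel_measurable_less[OF measurable_edges[OF e(2)] measurable_edges[OF e(1)]]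
      by (simp add: not_le)
  qed
  then have "{\<beta> \<in> space (birth_space n). \<forall>e\<in>?E. \<forall>e'\<in>?E. \<beta> e \<le> \<beta> e' \<longleftrightarrow> (e, e') \<in> r} \<in> sets (birth_space n)" for r
    by (intro sets.sets_Collect_finite_All) auto
  then show ?thesis unfolding eq of_bool_def
    by (intro borel_measurable_sum borel_measurable_times measurable_If) auto
qed

lemma pr_not_inj:
  assumes "N > 0"
  shows "pr (timings (Kn_edges n) N) (\<lambda>b. \<not> inj_on b (Kn_edges n)) \<le> real n ^ 4 / real N"
proof -
  let ?E = "Kn_edges n" and ?W = "timings (Kn_edges n) N"
  define D where "D = {(e, e'). e \<in> ?E \<and> e' \<in> ?E \<and> e \<noteq> e'}"
  have D: "D \<subseteq> ?E \<times> ?E" unfolding D_def by auto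
  have finD: "finite D" by (rule finite_subset[OF D]) simp
  have "pr ?W (\<lambda>b. \<not> inj_on b ?E) \<le> pr ?W (\<lambda>b. \<exists>p\<in>D. b (fst p) = b (snd p))"
    by (rule pr_mono) (auto simp: inj_on_def D_def)
  also have "\<dots> \<le> (\<Sum>p\<in>D. pr ?W (\<lambda>b. b (fst p) = b (snd p)))" by (rule pr_Bex) (use finD in auto)
  also have "\<dots> = (\<Sum>p\<in>D. 1 / real N)"
  proof (rule sum.cong)
    fix p assume p: "p \<in> D"
    obtain e e' where e: "p = (e, e')" "e \<in> ?E" "e' \<in> ?E" "e \<noteq> e'" using p by (auto simp: D_def)
    have "pr ?W (\<lambda>b. b e = b e') = (\<Sum>t<N. pr ?W (\<lambda>b. b e = t \<and> b e = b e'))"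
      by (rule pr_partition) (use e in \<open>auto simp: PiE_iff\<close>)
    also have "\<dots> = (\<Sum>t<N. 1 / real N ^ 2)"
    proof (rule sum.cong)
      fix t assume t: "t \<in> {..<N}"
      have "pr ?W (\<lambda>b. b e = t \<and> b e = b e') = pr ?W (\<lambda>b. \<forall>h\<in>{e, e'}. b h \<in> {t})"
        by (rule pr_cong) auto
      also have "\<dots> = (\<Prod>h\<in>{e, e'}. real (card {t}) / real N)"
        by (rule pr_box) (use e t assms in auto)
      also have "\<dots> = 1 / real N ^ 2" using e(4) by (simp add: power2_eq_square)
      finally show "pr ?W (\<lambda>b. b e = t \<and> b e = b e') = 1 / real N ^ 2" .
    qed simp
    also have "\<dots> = 1 / real N" using assms by (simp add: power2_eq_square)
    finally show "pr ?W (\<lambda>b. b (fst p) = b (snd p)) = 1 / real N" using e by simp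
  qed simp
  also have "\<dots> = real (card D) / real N" by simp
  also have "card D \<le> n ^ 2 * n ^ 2"
    using card_mono[OF _ D] mult_mono[OF card_Kn_edges_le[of n] card_Kn_edges_le[of n]]
    by (simp add: card_cartesian_product)
  then have "real (card D) / real N \<le> real n ^ 4 / real N"
    by (intro divide_right_mono) (simp_all flip: of_nat_power power_add add: of_nat_mono)
  finally show ?thesis .
qed

text \<open>Without ties the process agrees with \<open>Acc\<close> on the slots. With ties,
  subtracting \<open>n ^ 2\<close>, an upper bound for the number of edges, makes \<open>G\<close>
  nonpositive. So \<open>G\<close> is a lower bound throughout, and ties have probability at most
  \<open>n ^ 4 / N\<close>.\<close>

lemma expected_edges_ge:
  assumes N: "N > 0"
  shows "expected_edges VH EH n \<ge>
    (\<Sum>f\<in>Kn_edges n. pr (timings (Kn_edges n) N) (\<lambda>b. Acc n b f)) - real n ^ 6 / real N"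
proof -
  let ?E = "Kn_edges n" and ?W = "timings (Kn_edges n) N" and ?M = "birth_space n"
  define G where "G b = (\<Sum>f\<in>?E. of_bool (Acc n b f)) - real n ^ 2 * of_bool (\<not> inj_on b ?E)" for b :: "nat set \<Rightarrow> nat"
  interpret M: prob_space ?M unfolding birth_space_def by (rule prob_space_PiM) (rule prob_space_unif01)
  have finW: "finite ?W" by simp
  have inW: "slots N n \<beta> \<in> ?W" for \<beta> using slot_less[OF N] by auto
  have accsum: "(\<Sum>f\<in>?E. of_bool (Acc n b f) :: real) = real (card {f\<in>?E. Acc n b f})" for b
    by (simp add: of_bool_def sum.If_cases Int_def)
  have le: "G (slots N n \<beta>) \<le> real (card (free_process VH EH n \<beta>))" for \<beta>
  proof (cases "inj_on (slots N n \<beta>) ?E")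
    case True
    then show ?thesis unfolding G_def accsum free_process_slots[OF True] by simp
  next
    case False
    have "real (card {f\<in>?E. Acc n (slots N n \<beta>) f}) \<le> real (card ?E)" by (intro of_nat_mono card_mono) auto
    also have "\<dots> \<le> real n ^ 2" using card_Kn_edges_le[of n] by (metis of_nat_le_iff of_nat_power)
    finally have "real (card {f\<in>?E. Acc n (slots N n \<beta>) f}) - real n ^ 2 \<le> 0" by simp
    also have "0 \<le> real (card (free_process VH EH n \<beta>))" by simp
    finally show ?thesis unfolding G_def accsum using False by simp
  qed
  have Gsum: "G (slots N n \<beta>) = (\<Sum>b\<in>?W. G b * indicator (PiE ?E (\<lambda>e. {x. slot N x = b e})) \<beta>)" if "\<beta> \<in> space ?M" for \<beta>
  proof -
    have "(\<Sum>b\<in>?W. G b * indicator (PiE ?E (\<lambda>e. {x. slot N x = b e})) \<beta>) = (\<Sum>b\<in>?W. if b = slots N n \<beta> then G b else 0)"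
    proof (rule sum.cong)
      fix b assume b: "b \<in> ?W"
      have ext: "\<beta> \<in> extensional ?E" using that by (simp add: birth_space_def space_PiM PiE_iff)
      have "\<beta> \<in> PiE ?E (\<lambda>e. {x. slot N x = b e}) \<longleftrightarrow> b = slots N n \<beta>"
      proof
        assume a: "\<beta> \<in> PiE ?E (\<lambda>e. {x. slot N x = b e})"
        show "b = slots N n \<beta>"
        proof
          fix e show "b e = slots N n \<beta> e"
            using PiE_mem[OF a, of e] PiE_arb[OF b, of e] by (cases "e \<in> ?E") auto
        qed
      next
        assume "b = slots N n \<beta>"
        then show "\<beta> \<in> PiE ?E (\<lambda>e. {x. slot N x = b e})" using ext by (simp add: PiE_iff)
      qed
      then show "G b * indicator (PiE ?E (\<lambda>e. {x. slot N x = b e})) \<beta> = (if b = slots N n \<beta> then G b else 0)"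
        by (simp add: indicator_def)
    qed simp
    also have "\<dots> = G (slots N n \<beta>)" using inW by (subst sum.delta[OF finW]) auto
    finally show ?thesis by simp
  qed
  have sets: "{x. slot N x = j} \<in> sets unif01" for j by (simp only: sets_uniform_measure sets_lborel) measurable
  have box: "PiE ?E (\<lambda>e. {x. slot N x = b e}) \<in> sets ?M" for b :: "nat set \<Rightarrow> nat"
    unfolding birth_space_def by (rule sets_PiM_I_finite) (use sets in auto)
  have meas: "measure ?M (PiE ?E (\<lambda>e. {x. slot N x = b e})) = 1 / real (card ?W)" if b: "b \<in> ?W" for b
  proof -
    have "measure ?M (PiE ?E (\<lambda>e. {x. slot N x = b e})) = (\<Prod>e\<in>?E. measure unif01 {x. slot N x = b e})"
      by (rule measure_birth_box) (rule sets)
    also have "\<dots> = (\<Prod>e\<in>?E. 1 / real N)"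
    proof (rule prod.cong)
      fix e assume "e \<in> ?E"
      then have "b e < N" using PiE_mem[OF b, of e] by simp
      then show "measure unif01 {x. slot N x = b e} = 1 / real N" by (rule slot_uniform)
    qed simp
    also have "\<dots> = 1 / real (card ?W)" by (simp add: card_PiE power_one_over)
    finally show ?thesis .
  qed
  have int1: "integrable ?M (\<lambda>\<beta>. real (card (free_process VH EH n \<beta>)))"
  proof (rule M.integrable_const_bound[of _ "real (card ?E)"])
    show "AE \<beta> in ?M. norm (real (card (free_process VH EH n \<beta>))) \<le> real (card ?E)"
      using free_process_subset by (auto intro!: AE_I2 card_mono)
  qed (rule measurable_card_free_process)
  have int2: "integrable ?M (\<lambda>\<beta>. \<Sum>b\<in>?W. G b * indicator (PiE ?E (\<lambda>e. {x. slot N x = b e})) \<beta>)"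
    using box by (intro Bochner_Integration.integrable_sum integrable_mult_right integrable_real_indicator)
       (auto simp: M.emeasure_eq_measure)
  have "(\<Sum>b\<in>?W. G b) / real (card ?W) = (\<Sum>b\<in>?W. G b * measure ?M (PiE ?E (\<lambda>e. {x. slot N x = b e})))"
    unfolding sum_divide_distrib by (rule sum.cong) (use meas in auto)
  also have "\<dots> = (\<integral>\<beta>. (\<Sum>b\<in>?W. G b * indicator (PiE ?E (\<lambda>e. {x. slot N x = b e})) \<beta>) \<partial>?M)"
    using box by (subst Bochner_Integration.integral_sum)
      (auto intro!: integrable_mult_right integrable_real_indicator sum.cong simp: M.emeasure_eq_measure)
  also have "\<dots> \<le> (\<integral>\<beta>. real (card (free_process VH EH n \<beta>)) \<partial>?M)"
    by (rule integral_mono[OF int2 int1]) (subst Gsum[symmetric], simp, rule le)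
  finally have 1: "(\<Sum>b\<in>?W. G b) / real (card ?W) \<le> expected_edges VH EH n" by (simp add: expected_edges_def)
  have "(\<Sum>b\<in>?W. G b) / real (card ?W) = (\<Sum>f\<in>?E. pr ?W (\<lambda>b. Acc n b f)) - real n ^ 2 * pr ?W (\<lambda>b. \<not> inj_on b ?E)"
    unfolding G_def sum_subtractf pr_sum[OF finW] diff_divide_distrib
    by (subst sum.swap) (simp add: sum_divide_distrib sum_distrib_left)
  moreover have "real n ^ 2 * pr ?W (\<lambda>b. \<not> inj_on b ?E) \<le> real n ^ 2 * (real n ^ 4 / real N)"
    by (intro mult_left_mono pr_not_inj N) auto
  moreover have "real n ^ 2 * (real n ^ 4 / real N) = real n ^ 6 / real N" by (simp flip: power_add)
  ultimately show ?thesis using 1 by linarith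
qed

end

section \<open>Asymptotics\<close>

lemma power_div_fact_le_exp: "0 \<le> (y::real) \<Longrightarrow> y ^ m / fact m \<le> exp y"
proof -
  assume y: "0 \<le> y"
  have "(\<Sum>i\<in>{m}. y ^ i /\<^sub>R fact i) \<le> (\<Sum>i. y ^ i /\<^sub>R fact i)"
    by (rule sum_le_suminf[OF summable_exp_generic]) (use y in auto)
  then show ?thesis by (simp add: exp_def divide_inverse mult.commute)
qed

text \<open>The chain length for \<open>r = ln n\<close>. The exponent 3/4 lies above 1/2, so that
  the factorial beats powers of the \<open>sqrt r\<close> in the expected number of copies, and
  below 1, so that \<open>Lr r * ln r\<close> is of smaller order than \<open>r\<close>.\<close>

abbreviation "Lr r \<equiv> nat \<lfloor>(r::real) powr (3 / 4)\<rfloor>"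

lemma Lr_le: "real (Lr r) \<le> r powr (3 / 4)" by simp

lemma of_nat_nat_ge: "of_int z \<le> real (nat z)"
  by linarith

text \<open>The price per copy is polynomial in \<open>r\<close>, hence at most
  \<open>exp (r powr (1 / 8))\<close>. For \<open>2 * Lr r\<close> copies this gives at most
  \<open>exp (2 * r powr (7 / 8))\<close>, which loses against
  \<open>exp (- \<delta> * r)\<close>.\<close>

lemma eventually_rho_small:
  fixes v e :: nat and \<delta> c :: real
  assumes "0 < \<delta>" "0 < c" "v \<ge> 3" "e \<ge> 3"
  shows "\<forall>\<^sub>F r in at_top. r * (real e * (2 * real (Lr r) + 1) ^ 3 * ((2 * (real v * (2 * real (Lr r) + 1))) ^ v * (2 ^ (e - 1) * sqrt r)) ^ (2 * Lr r) * exp (- \<delta> * r)) \<le> c"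
proof -
  define C where "C = 6 * real v"
  define D where "D = real (v + e)"
  have C: "C \<ge> 2" and D: "D > 0" using assms by (auto simp: C_def D_def)
  have e1: "\<forall>\<^sub>F r in at_top. D * ln (C * r) \<le> r powr (1 / 8)"
    using C D by real_asymp
  have "((\<lambda>r. r * (real e * (3 * r) ^ 3 * exp (2 * r powr (7 / 8)) * exp (- \<delta> * r))) \<longlongrightarrow> 0) at_top"
    using assms(1) by real_asymp
  then have e2: "\<forall>\<^sub>F r in at_top. r * (real e * (3 * r) ^ 3 * exp (2 * r powr (7 / 8)) * exp (- \<delta> * r)) < c"
    by (rule order_tendstoD) (use assms in auto)
  show ?thesis using e1 e2 eventually_ge_at_top[of 1]
  proof eventually_elim
    case (elim r)
    let ?L = "real (Lr r)"
    let ?Lam = "(2 * (real v * (2 * ?L + 1))) ^ v * (2 ^ (e - 1) * sqrt r)"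
    have r1: "1 \<le> r" using elim by simp
    have "r powr (3 / 4) \<le> r powr 1" using r1 by (intro powr_mono) auto
    then have "r powr (3 / 4) \<le> r" using r1 by simp
    then have Lle: "2 * ?L + 1 \<le> 3 * r" using Lr_le[of r] r1 by linarith
    have Cr: "1 \<le> C * r" "2 \<le> C * r" "r \<le> C * r" using C r1 mult_mono[of 2 C 1 r] mult_mono[of 1 C r r] by auto
    have "(2 * (real v * (2 * ?L + 1))) ^ v \<le> (C * r) ^ v"
    proof (rule power_mono)
      have "real v * (2 * ?L + 1) \<le> real v * (3 * r)" using Lle by (intro mult_left_mono) auto
      then show "2 * (real v * (2 * ?L + 1)) \<le> C * r" unfolding C_def by linarith
    qed auto
    moreover have "(2::real) ^ (e - 1) * sqrt r \<le> (C * r) ^ (e - 1) * (C * r)"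
    proof (intro mult_mono power_mono)
      have "sqrt r \<le> r" using r1 self_le_power[of r 2] by (intro real_le_lsqrt) auto
      then show "sqrt r \<le> C * r" using Cr(3) by (rule order_trans)
    qed (use Cr r1 in auto)
    ultimately have "?Lam \<le> (C * r) ^ v * ((C * r) ^ (e - 1) * (C * r))"
      by (rule mult_mono) (use r1 Cr in auto)
    also have "\<dots> = (C * r) ^ (v + e)"
      using assms(4) by (simp add: power_add power_eq_if[of "C * r" e])
    also have "\<dots> = exp (D * ln (C * r))"
      unfolding D_def exp_of_nat_mult using Cr by simp
    also have "\<dots> \<le> exp (r powr (1 / 8))" using elim(1) by simp
    finally have Lam: "?Lam \<le> exp (r powr (1 / 8))" .
    have "?Lam ^ (2 * Lr r) \<le> exp (r powr (1 / 8)) ^ (2 * Lr r)"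
      using Lam r1 by (intro power_mono) auto
    also have "\<dots> = exp (2 * ?L * r powr (1 / 8))" by (simp flip: exp_of_nat_mult)
    also have "\<dots> \<le> exp (2 * r powr (7 / 8))"
    proof -
      have "?L * r powr (1 / 8) \<le> r powr (3 / 4) * r powr (1 / 8)" using Lr_le by (intro mult_right_mono) auto
      also have "\<dots> = r powr (7 / 8)" by (simp flip: powr_add)
      finally show ?thesis by simp
    qed
    finally have P: "?Lam ^ (2 * Lr r) \<le> exp (2 * r powr (7 / 8))" .
    have "r * (real e * (2 * ?L + 1) ^ 3 * ?Lam ^ (2 * Lr r) * exp (- \<delta> * r)) \<le>
       r * (real e * (3 * r) ^ 3 * exp (2 * r powr (7 / 8)) * exp (- \<delta> * r))"
      using P Lle r1 by (intro mult_left_mono mult_right_mono mult_mono power_mono) auto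
    then show ?case using elim(2) by simp
  qed
qed

text \<open>As \<open>Lr r\<close> outgrows \<open>sqrt r\<close>, the base is at most
  \<open>exp (- 2) * Lr r\<close>. With \<open>m ^ m / fact m \<le> exp m\<close> the quotient is at
  most \<open>exp (- Lr r)\<close>.\<close>

lemma eventually_tau_small:
  fixes e :: nat and c :: real
  assumes "0 < c"
  shows "\<forall>\<^sub>F r in at_top. r * ((4 * real e ^ 2 * (2 ^ (e - 1) * sqrt r)) ^ Lr r / fact (Lr r)) \<le> c"
proof -
  define X where "X = 4 * real e ^ 2 * 2 ^ (e - 1)"
  have X: "X \<ge> 0" by (simp add: X_def)
  have e1: "\<forall>\<^sub>F r in at_top. exp 2 * X * sqrt r \<le> r powr (3 / 4) / 2" using X by real_asymp
  have "((\<lambda>r::real. r * exp (- (r powr (3 / 4) / 2))) \<longlongrightarrow> 0) at_top" by real_asymp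
  then have e2: "\<forall>\<^sub>F r in at_top. r * exp (- (r powr (3 / 4) / 2)) < c"
    by (rule order_tendstoD) (use assms in auto)
  have e3: "\<forall>\<^sub>F r in at_top. (r::real) powr (3 / 4) \<ge> 2" by real_asymp
  show ?thesis using e1 e2 e3 eventually_ge_at_top[of 1]
  proof eventually_elim
    case (elim r)
    let ?L = "real (Lr r)"
    have "r powr (3 / 4) - 1 < of_int \<lfloor>r powr (3 / 4)\<rfloor>" by linarith
    moreover have "of_int \<lfloor>r powr (3 / 4)\<rfloor> \<le> ?L" by (rule of_nat_nat_ge)
    ultimately have L2: "r powr (3 / 4) / 2 \<le> ?L" using elim(3) by linarith
    then have L0: "0 < ?L" using elim(3) by linarith
    let ?x = "4 * real e ^ 2 * (2 ^ (e - 1) * sqrt r)"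
    have x: "?x = X * sqrt r" by (simp add: X_def)
    have "exp 2 * (X * sqrt r) \<le> ?L" using elim(1) L2 by (simp add: mult.assoc)
    then have "exp (- 2) * (exp 2 * (X * sqrt r)) \<le> exp (- 2) * ?L" by (intro mult_left_mono) auto
    then have xs: "?x \<le> exp (- 2) * ?L" unfolding x by (simp add: mult.assoc[symmetric] flip: exp_add)
    have "?x ^ Lr r / fact (Lr r) \<le> (exp (- 2) * ?L) ^ Lr r / fact (Lr r)"
      using xs elim(4) by (intro divide_right_mono power_mono) auto
    also have "\<dots> = exp (- 2) ^ Lr r * (?L ^ Lr r / fact (Lr r))" by (simp add: power_mult_distrib)
    also have "\<dots> \<le> exp (- 2) ^ Lr r * exp ?L" by (intro mult_left_mono power_div_fact_le_exp) auto
    also have "\<dots> = exp (- ?L)" by (simp flip: exp_of_nat_mult exp_add)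
    also have "\<dots> \<le> exp (- (r powr (3 / 4) / 2))" using L2 by simp
    finally have "r * (?x ^ Lr r / fact (Lr r)) \<le> r * exp (- (r powr (3 / 4) / 2))" using elim(4) by (intro mult_left_mono) auto
    then show ?case using elim(2) by linarith
  qed
qed

lemma card_Kn_edges_ge:
  assumes "n \<ge> 2" shows "real n ^ 2 / 4 \<le> real (card (Kn_edges n))"
proof -
  have "Kn_edges n = {e. e \<subseteq> {1..n} \<and> card e = 2}" using in_Kn_edges by blast
  then have "card (Kn_edges n) = n choose 2" by (simp add: n_subsets)
  then have "real (card (Kn_edges n)) = real n * (real n - 1) / 2"
    using choose_two[of n] assms by (simp add: real_of_nat_div of_nat_diff)
  moreover have "real n * (real n / 2) \<le> real n * (real n - 1)" using assms by (intro mult_left_mono) auto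
  ultimately show ?thesis by (simp add: power2_eq_square)
qed

section \<open>Choice of the parameters as functions of n\<close>

context balanced_graph
begin

definition "kk = real eH - 1"
definition "al = (real vH - 2) / kk"

lemma kk_ge: "kk \<ge> 2" using eH_ge by (simp add: kk_def)
lemma al_bounds: "0 < al" "al < 1"
  using vH_ge kk_ge density_gt_1 by (auto simp: al_def kk_def)
lemma al_kk: "al * kk = real vH - 2" using kk_ge by (simp add: al_def)

text \<open>Strict balance makes every exponent negative, and finitely many vertex sets
  \<open>S\<close> leave a uniform gap.\<close>

lemma overlap_exponent:
  "\<exists>\<delta>>0. 2 * \<delta> \<le> al \<and> (\<forall>S. S \<subseteq> VH \<longrightarrow> 3 \<le> card S \<longrightarrow> card S < vH \<longrightarrow>
     (real vH - real (card S)) - al * (real eH - real (card {e\<in>EH. e \<subseteq> S})) \<le> - 2 * \<delta>)"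
proof -
  define ex where "ex S = al * (real eH - real (card {e\<in>EH. e \<subseteq> S})) - (real vH - real (card S))" for S
  \<comment> \<open>Including \<open>al\<close> yields the bound
    \<open>2 * \<delta> \<le> al\<close>, which later controls the density of a single edge.\<close>
  define Z where "Z = insert al (ex ` {S. S \<subseteq> VH \<and> 3 \<le> card S \<and> card S < vH})"
  have fin: "finite Z" "Z \<noteq> {}" unfolding Z_def by auto
  have pos: "0 < z" if "z \<in> Z" for z
  proof -
    have "0 < ex S" if S: "S \<subseteq> VH" "3 \<le> card S" "card S < vH" for S
    proof -
      let ?F = "{e\<in>EH. e \<subseteq> S}"
      have "S \<noteq> VH" using S by (auto simp: vH_def)
      then have "(real (card ?F) - 1) * (real vH - 2) < (real eH - 1) * (real (card S) - 2)"
        by (intro balance_strict) (use S in auto)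
      then have "0 < (real eH - 1) * (real (card S) - 2) - (real (card ?F) - 1) * (real vH - 2)" by simp
      also have "\<dots> = (al * kk) * (real eH - real (card ?F)) - (real vH - real (card S)) * kk"
        unfolding al_kk by (simp add: kk_def algebra_simps)
      also have "\<dots> = kk * ex S" by (simp add: ex_def algebra_simps)
      finally show ?thesis using kk_ge by (simp add: zero_less_mult_iff)
    qed
    then show ?thesis using that al_bounds unfolding Z_def by auto
  qed
  show ?thesis
  proof (intro exI[of _ "Min Z / 2"] conjI allI impI)
    show "0 < Min Z / 2" using pos Min_in[OF fin] by simp
    show "2 * (Min Z / 2) \<le> al" using Min_le[OF fin(1), of al] by (simp add: Z_def)
    fix S assume "S \<subseteq> VH" "3 \<le> card S" "card S < vH"
    then have "Min Z \<le> ex S" by (intro Min_le fin) (auto simp: Z_def)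
    then show "(real vH - real (card S)) - al * (real eH - real (card {e\<in>EH. e \<subseteq> S})) \<le> - 2 * (Min Z / 2)"
      by (simp add: ex_def)
  qed
qed

text \<open>\<open>n powr - al\<close> is the density at which an edge lies in boundedly many copies. Time runs up to \<open>KK n\<close>
  times this density, on a grid of \<open>NN n\<close> slots fine enough to make ties negligible; \<open>KK n\<close> is a small
  power of \<open>ln n\<close> so that chains of length \<open>Lr (ln n)\<close> are both rare and few.\<close>

definition "KK n = ln (real n) powr (1 / (2 * kk))"
definition "NN n = n ^ (vH + 7)"
definition "TT n = nat \<lfloor>KK n * real n powr (- al) * real (NN n)\<rfloor>"

lemma kk_nat: "kk = real (eH - 1)" using eH_ge by (simp add: kk_def of_nat_diff)

lemma critical_exponent:
  assumes n: "n \<ge> 1" shows "real n ^ (vH - 2) * (real n powr (- al)) ^ (eH - 1) = 1"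
proof -
  have "(real n powr (- al)) ^ (eH - 1) = real n powr (- al * kk)"
    unfolding kk_nat using n by (subst powr_realpow[symmetric]) (auto simp: powr_powr)
  moreover have "real n ^ (vH - 2) = real n powr (al * kk)"
    unfolding al_kk using n vH_ge by (subst powr_realpow[symmetric]) (auto simp: of_nat_diff)
  ultimately show ?thesis using n by (simp flip: powr_add)
qed

text \<open>The exponent in \<open>KK\<close> is made for this: the expected number of early copies
  through an edge is of order at most \<open>KK n ^ (eH - 1)\<close> and has to stay well below the
  chain length \<open>Lr (ln (real n))\<close>.\<close>

lemma KK_power: "ln (real n) \<ge> 1 \<Longrightarrow> KK n ^ (eH - 1) = sqrt (ln (real n))"
proof -
  assume r: "ln (real n) \<ge> 1"
  have "KK n ^ (eH - 1) = KK n powr kk" unfolding kk_nat using r by (intro powr_realpow[symmetric]) (simp add: KK_def)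
  also have "\<dots> = ln (real n) powr (1 / 2)" using kk_ge by (simp add: KK_def powr_powr)
  finally show ?thesis using r by (simp add: powr_half_sqrt)
qed

lemma KK_ge_1: "ln (real n) \<ge> 1 \<Longrightarrow> KK n \<ge> 1"
  unfolding KK_def using kk_ge by (intro ge_one_powr_ge_zero) auto

lemma TT_le: "n \<ge> 1 \<Longrightarrow> real (TT n) / real (NN n) \<le> KK n * real n powr (- al)"
proof -
  assume n: "n \<ge> 1"
  have N: "real (NN n) > 0" using n by (simp add: NN_def)
  have "real (TT n) \<le> KK n * real n powr (- al) * real (NN n)"
    unfolding TT_def by (simp add: KK_def)
  then show ?thesis using N by (simp add: pos_divide_le_eq)
qed

text \<open>Rounding down costs at most a factor 2 once the rounded number is at least 2. The
  exponent of \<open>NN\<close> ensures this, because \<open>al < 1\<close>.\<close>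

lemma TT_ge:
  assumes n: "n \<ge> 2" and r: "ln (real n) \<ge> 1"
  shows "KK n * real n powr (- al) / 2 \<le> real (TT n) / real (NN n)"
proof -
  let ?x = "KK n * real n powr (- al) * real (NN n)"
  have N: "real (NN n) > 0" using n by (simp add: NN_def)
  have "real n powr 1 \<le> real n powr (- al) * real n powr 7"
    unfolding powr_add[symmetric] using n al_bounds by (intro powr_mono) auto
  also have "real n powr 7 = real n ^ 7" using n powr_realpow[of "real n" 7] by simp
  also have "real n powr (- al) * real n ^ 7 \<le> real n powr (- al) * real (NN n)"
  proof (rule mult_left_mono)
    have "real n ^ 7 \<le> real n ^ (vH + 7)" using n by (intro power_increasing) auto
    then show "real n ^ 7 \<le> real (NN n)" by (simp add: NN_def)
  qed simp
  also have "\<dots> \<le> KK n * (real n powr (- al) * real (NN n))"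
    using mult_right_mono[OF KK_ge_1[OF r], of "real n powr (- al) * real (NN n)"] by simp
  finally have "2 \<le> ?x" using n by (simp add: mult.assoc)
  then have "?x / 2 \<le> real (TT n)" unfolding TT_def by linarith
  then show ?thesis using N by (simp add: field_simps)
qed

text \<open>The gap \<open>2 * \<delta>\<close> is split: one half absorbs all powers of
  \<open>2 * KK n\<close>, the other remains as \<open>n powr (- \<delta>)\<close>. The condition
  \<open>2 * \<delta> \<le> al\<close> does the same for the density of a single edge.\<close>

lemma scale_exists:
  assumes d: "0 < \<delta>" "2 * \<delta> \<le> al"
      "\<And>S. S \<subseteq> VH \<Longrightarrow> 3 \<le> card S \<Longrightarrow> card S < vH \<Longrightarrow>
       (real vH - real (card S)) - al * (real eH - real (card {e\<in>EH. e \<subseteq> S})) \<le> - 2 * \<delta>"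
    and n: "n \<ge> 2" and r: "ln (real n) \<ge> 1" and K: "(2 * KK n) ^ eH \<le> real n powr \<delta>"
  shows "sparse_scale VH EH n (NN n) (TT n) (2 ^ (eH - 1) * sqrt (ln (real n))) (real n powr (- \<delta>))"
proof -
  let ?q = "2 * real (TT n) / real (NN n)"
  have K1: "1 \<le> 2 * KK n" using KK_ge_1[OF r] by simp
  have N: "NN n > 0" using n by (simp add: NN_def)
  have q0: "0 \<le> ?q" by simp
  have q: "?q \<le> 2 * KK n * real n powr (- al)" using TT_le[of n] n by simp
  have "2 * KK n \<le> (2 * KK n) ^ eH" using K1 eH_ge by (intro self_le_power) auto
  then have "2 * KK n \<le> real n powr \<delta>" using K by simp
  then have "2 * KK n * real n powr (- al) \<le> real n powr \<delta> * real n powr (- al)" by (intro mult_right_mono) auto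
  also have "\<dots> \<le> real n powr (- \<delta>)" unfolding powr_add[symmetric] using n d by (intro powr_mono) auto
  finally have qeta: "?q \<le> real n powr (- \<delta>)" using q by simp
  have eta1: "real n powr (- \<delta>) \<le> 1" using powr_mono[of "- \<delta>" 0 "real n"] n d by simp
  show ?thesis
  proof unfold_locales
    show "TT n \<le> NN n" using order_trans[OF qeta eta1] N by (simp add: pos_divide_le_eq)
    show "?q \<le> 1" using qeta eta1 by simp
    have "1 \<le> sqrt (ln (real n))" using r by simp
    then show "1 \<le> 2 ^ (eH - 1) * sqrt (ln (real n))"
      using mult_mono[of 1 "2 ^ (eH - 1) :: real" 1 "sqrt (ln (real n))"] by simp
    have "real n ^ (vH - 2) * ?q ^ (eH - 1) \<le> real n ^ (vH - 2) * (2 * KK n * real n powr (- al)) ^ (eH - 1)"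
      using q by (intro mult_left_mono power_mono) auto
    also have "\<dots> = (2 ^ (eH - 1) * KK n ^ (eH - 1)) * (real n ^ (vH - 2) * (real n powr (- al)) ^ (eH - 1))"
      by (simp add: power_mult_distrib)
    also have "real n ^ (vH - 2) * (real n powr (- al)) ^ (eH - 1) = 1"
      using critical_exponent[of n] n by simp
    finally show "real n ^ (vH - 2) * ?q ^ (eH - 1) \<le> 2 ^ (eH - 1) * sqrt (ln (real n))"
      using KK_power[OF r] by simp
    fix S assume S: "S \<subseteq> VH" "3 \<le> card S" "card S < vH"
    let ?F = "{e\<in>EH. e \<subseteq> S}"
    have F: "card ?F \<le> eH" unfolding eH_def by (intro card_mono) auto
    have "real n ^ (vH - card S) * ?q ^ (eH - card ?F) \<le> real n ^ (vH - card S) * (2 * KK n * real n powr (- al)) ^ (eH - card ?F)"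
      using q by (intro mult_left_mono power_mono) auto
    also have "\<dots> = (2 * KK n) ^ (eH - card ?F) * (real n ^ (vH - card S) * (real n powr (- al)) ^ (eH - card ?F))"
      by (simp add: power_mult_distrib)
    also have "\<dots> \<le> real n powr \<delta> * real n powr (- 2 * \<delta>)"
    proof (rule mult_mono)
      have "(2 * KK n) ^ (eH - card ?F) \<le> (2 * KK n) ^ eH" using K1 by (intro power_increasing) auto
      then show "(2 * KK n) ^ (eH - card ?F) \<le> real n powr \<delta>" using K by simp
      have "(real n powr (- al)) ^ (eH - card ?F) = real n powr (- al * (real eH - real (card ?F)))"
        using n F by (subst powr_realpow[symmetric]) (auto simp: powr_powr of_nat_diff)
      moreover have "real n ^ (vH - card S) = real n powr (real vH - real (card S))"
        using n S by (subst powr_realpow[symmetric]) (auto simp: of_nat_diff)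
      ultimately have "real n ^ (vH - card S) * (real n powr (- al)) ^ (eH - card ?F)
        = real n powr ((real vH - real (card S)) - al * (real eH - real (card ?F)))"
        by (simp flip: powr_add)
      also have "\<dots> \<le> real n powr (- 2 * \<delta>)" using d(3)[OF S] n by (intro powr_mono) auto
      finally show "real n ^ (vH - card S) * (real n powr (- al)) ^ (eH - card ?F) \<le> real n powr (- 2 * \<delta>)" .
    qed auto
    also have "\<dots> = real n powr (- \<delta>)" by (simp flip: powr_add)
    finally show "real n ^ (vH - card S) * ?q ^ (eH - card ?F) \<le> real n powr (- \<delta>)" .
  qed (use n N qeta eta1 in auto)
qed

text \<open>This and the next two definitions restate \<open>\<rho>\<close>,
  \<open>\<tau>\<^sub>L\<close> and \<open>\<epsilon>\<close> in terms of \<open>r = ln n\<close>,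
  so that their decay is a matter of one real variable.\<close>

definition "rho_at \<delta> r = real eH * (2 * real (Lr r) + 1) ^ 3 *
  ((2 * (real vH * (2 * real (Lr r) + 1))) ^ vH * (2 ^ (eH - 1) * sqrt r)) ^ (2 * Lr r) * exp (- \<delta> * r)"
definition "tau_at r = (4 * real eH ^ 2 * (2 ^ (eH - 1) * sqrt r)) ^ Lr r / fact (Lr r)"
definition "eps_at \<delta> r = real eH * (4 * rho_at \<delta> r + 2 * tau_at r + 2 * real eH * exp (- \<delta> * r))"

lemma eventually_eps_small:
  assumes "0 < \<delta>" "0 < c"
  shows "\<forall>\<^sub>F r in at_top. r * eps_at \<delta> r \<le> c"
proof -
  define D where "D = real eH * (6 + 2 * real eH)"
  define c' where "c' = c / D"
  have den: "D > 0" using eH_ge by (simp add: D_def)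
  have c': "0 < c'" using assms den by (simp add: c'_def)
  have "((\<lambda>r. r * exp (- \<delta> * r)) \<longlongrightarrow> 0) at_top" using assms(1) by real_asymp
  then have e3: "\<forall>\<^sub>F r in at_top. r * exp (- \<delta> * r) < c'" by (rule order_tendstoD) (rule c')
  show ?thesis
    using eventually_rho_small[OF assms(1) c' vH_ge eH_ge] eventually_tau_small[OF c', of eH] e3
    unfolding rho_at_def[symmetric] tau_at_def[symmetric]
  proof eventually_elim
    case (elim r)
    have "r * eps_at \<delta> r = real eH * (4 * (r * rho_at \<delta> r) + 2 * (r * tau_at r) + 2 * real eH * (r * exp (- \<delta> * r)))"
      by (simp add: eps_at_def algebra_simps)
    also have "\<dots> \<le> real eH * (4 * c' + 2 * c' + 2 * real eH * c')"
      using elim by (intro mult_left_mono add_mono) auto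
    also have "\<dots> = c' * D" by (simp add: D_def algebra_simps)
    also have "\<dots> = c" using den by (simp add: c'_def)
    finally show ?case .
  qed
qed

text \<open>\<open>kap\<close> is chosen such that \<open>2 * A\<^sub>0 * \<phi> ^ (eH - 1)\<close> below equals \<open>ln (KK n) / 2\<close>.\<close>

definition "kap = (1 / (16 * real eH * kk)) powr (1 / kk)"

lemma kap_bounds: "0 < kap" "kap \<le> 1" "kap ^ (eH - 1) = 1 / (16 * real eH * kk)"
proof -
  have p: "0 < 16 * real eH * kk" using eH_ge kk_ge by simp
  show pos: "0 < kap" using eH_ge kk_ge by (auto simp: kap_def)
  have "1 * 1 \<le> real eH * kk" using eH_ge kk_ge by (intro mult_mono) auto
  then have "1 \<le> 16 * real eH * kk" by simp
  then have "1 / (16 * real eH * kk) \<le> 1" using p by (subst divide_le_eq_1_pos)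
  then show "kap \<le> 1" unfolding kap_def using p kk_ge by (intro powr_le1) auto
  have "kap ^ (eH - 1) = kap powr kk" unfolding kk_nat using pos by (rule powr_realpow[symmetric])
  also have "\<dots> = 1 / (16 * real eH * kk)" unfolding kap_def using kk_ge p by (simp add: powr_powr)
  finally show "kap ^ (eH - 1) = 1 / (16 * real eH * kk)" .
qed

text \<open>Either \<open>\<Phi> T\<close> exceeds \<open>\<phi>\<close>, or openness never drops much below \<open>KK n powr (-1/2)\<close>, and then
  \<open>\<Phi> T\<close> is of order \<open>n powr - al * KK n powr (1/2)\<close>, which is larger than \<open>\<phi>\<close>.\<close>

lemma expected_edges_at:
  assumes scale: "sparse_scale VH EH n (NN n) (TT n) (2 ^ (eH - 1) * sqrt (ln (real n))) (real n powr (- \<delta>))"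
    and n: "n \<ge> 2" and r: "ln (real n) \<ge> 1" and l: "ln (KK n) \<ge> 1"
    and big: "8 * real eH ^ 2 * real n ^ (vH - 2) \<le> real (NN n)"
    and phi1: "real n powr (- al) * ln (KK n) powr (1 / kk) \<le> 1"
    and win: "ln (KK n) powr (1 / kk) < KK n powr (1 / 2) / 4"
    and err: "ln (real n) * eps_at \<delta> (ln (real n)) \<le> 1 / (8 * real eH * kk)"
  shows "real n ^ 2 / 4 * (kap * real n powr (- al) * ln (KK n) powr (1 / kk)) - 1 \<le> expected_edges VH EH n"
proof -
  interpret sparse_scale VH EH n "NN n" "TT n" "Lr (ln (real n))" "2 ^ (eH - 1) * sqrt (ln (real n))" "real n powr (- \<delta>)"
    by (rule scale)
  let ?K = "KK n" and ?l = "ln (KK n)"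
  define \<phi> where "\<phi> = kap * real n powr (- al) * ?l powr (1 / kk)"
  define p where "p = real (TT n) / real (NN n)"
  have K1: "1 \<le> ?K" by (rule KK_ge_1[OF r])
  have n0: "real n > 0" using n by simp
  have phi0: "0 \<le> \<phi>" using kap_bounds by (simp add: \<phi>_def)
  have phile: "\<phi> \<le> 1"
  proof -
    have "\<phi> = kap * (real n powr (- al) * ?l powr (1 / kk))" by (simp add: \<phi>_def)
    also have "\<dots> \<le> 1 * 1" using kap_bounds phi1 by (intro mult_mono) auto
    finally show ?thesis by simp
  qed
  have nk: "(real n powr (- al)) ^ (eH - 1) * real n ^ (vH - 2) = 1"
    using critical_exponent[of n] n by (simp add: mult.commute)
  have A0: "A\<^sub>0 = 4 * real eH * kk * real n ^ (vH - 2)" by (simp add: A\<^sub>0_def kk_def)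
  have exponent: "2 * A\<^sub>0 * \<phi> ^ (eH - 1) = ?l / 2"
  proof -
    have "(?l powr (1 / kk)) ^ (eH - 1) = (?l powr (1 / kk)) powr kk"
      unfolding kk_nat using l by (intro powr_realpow[symmetric]) simp
    also have "\<dots> = ?l" using l kk_ge by (simp add: powr_powr)
    finally have "2 * A\<^sub>0 * \<phi> ^ (eH - 1) = 8 * real eH * kk * kap ^ (eH - 1) * ((real n powr (- al)) ^ (eH - 1) * real n ^ (vH - 2)) * ?l"
      by (simp add: A0 \<phi>_def power_mult_distrib mult_ac)
    also have "\<dots> = ?l / 2" unfolding nk kap_bounds(3) using eH_ge kk_ge by (simp add: field_simps)
    finally show ?thesis .
  qed
  \<comment> \<open>The grid is fine enough that openness loses at most half of its value in one
    slot, apart from the additive error.\<close>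
  have small: "2 * A\<^sub>0 * \<phi> ^ (eH - 2) \<le> real (NN n)"
  proof -
    have A0': "0 \<le> A\<^sub>0" using kk_ge by (simp add: A0)
    have "2 * A\<^sub>0 * \<phi> ^ (eH - 2) \<le> 2 * A\<^sub>0 * 1"
      using A0' phi0 phile by (intro mult_left_mono power_le_one) auto
    also have "\<dots> = 8 * real eH * kk * real n ^ (vH - 2)" by (simp add: A0)
    also have "\<dots> \<le> 8 * real eH * real eH * real n ^ (vH - 2)" by (intro mult_right_mono mult_left_mono) (auto simp: kk_def)
    finally show ?thesis using big by (simp add: power2_eq_square)
  qed
  have ple: "p \<le> ?K * real n powr (- al)" unfolding p_def by (rule TT_le) (use n in simp)
  have pge: "?K * real n powr (- al) / 2 \<le> p" unfolding p_def by (rule TT_ge[OF n r])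
  have p0: "0 \<le> p" by (simp add: p_def)
  have eps: "ln (real n) * \<epsilon> \<le> 1 / (8 * real eH * kk)"
  proof -
    have "real n powr (- \<delta>) = exp (- \<delta> * ln (real n))" using n by (simp add: powr_def)
    then have "\<epsilon> = eps_at \<delta> (ln (real n))"
      unfolding \<epsilon>_def \<rho>_def \<Lambda>_def \<tau>\<^sub>L_def eps_at_def rho_at_def tau_at_def by (simp only:)
    then show ?thesis using err by simp
  qed
  have eps0: "0 \<le> \<epsilon>" unfolding \<epsilon>_def using rho_nonneg tauL_nonneg by simp
  \<comment> \<open>Here \<open>A\<^sub>0 * p ^ (eH - 1)\<close> is at most a constant times
    \<open>sqrt (ln n)\<close>, and \<open>\<epsilon>\<close> at most a constant over
    \<open>ln n\<close>. The remaining \<open>1 / sqrt (ln n)\<close> is at most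
    \<open>KK n powr (- 1 / 2)\<close>, so the error takes at most half of the main term.\<close>
  have error: "A\<^sub>0 * p ^ (eH - 1) * \<epsilon> \<le> ?K powr (- 1 / 2) / 2"
  proof -
    have "A\<^sub>0 * p ^ (eH - 1) \<le> A\<^sub>0 * (?K * real n powr (- al)) ^ (eH - 1)"
      using p0 ple kk_ge by (intro mult_left_mono power_mono) (auto simp: A0)
    also have "\<dots> = 4 * real eH * kk * ?K ^ (eH - 1) * ((real n powr (- al)) ^ (eH - 1) * real n ^ (vH - 2))"
      by (simp add: A0 power_mult_distrib mult_ac)
    also have "\<dots> = 4 * real eH * kk * sqrt (ln (real n))" unfolding nk KK_power[OF r] by simp
    finally have "A\<^sub>0 * p ^ (eH - 1) * \<epsilon> \<le> 4 * real eH * kk * sqrt (ln (real n)) * \<epsilon>"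
      using eps0 by (intro mult_right_mono) auto
    also have "\<dots> = 4 * real eH * kk * (ln (real n) * \<epsilon>) / sqrt (ln (real n))"
      using r real_sqrt_mult_self[of "ln (real n)"] by (simp add: field_simps)
    also have "\<dots> \<le> 4 * real eH * kk * (1 / (8 * real eH * kk)) / sqrt (ln (real n))"
      using eps kk_ge r by (intro divide_right_mono mult_left_mono) auto
    also have "\<dots> = (1 / sqrt (ln (real n))) / 2" using eH_ge kk_ge by simp
    also have "1 / sqrt (ln (real n)) = ln (real n) powr (- (1 / 2))"
      using r by (simp add: powr_minus powr_half_sqrt inverse_eq_divide)
    also have "\<dots> \<le> ln (real n) powr (1 / (2 * kk) * (- 1 / 2))"
      using r kk_ge by (intro powr_mono) (auto simp: field_simps)
    also have "\<dots> = ?K powr (- 1 / 2)" unfolding KK_def by (simp only: powr_powr)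
    finally show ?thesis by simp
  qed
  have "\<phi> \<le> \<Phi> (TT n)"
  proof (rule ccontr)
    assume "\<not> ?thesis"
    then have lt: "\<Phi> (TT n) < \<phi>" by simp
    have "p * (exp (- 2 * A\<^sub>0 * \<phi> ^ (eH - 1)) - A\<^sub>0 * p ^ (eH - 1) * \<epsilon>) \<le> \<Phi> (TT n)"
      unfolding p_def by (rule Phi_lower_bound[OF n _ small]) (use lt in simp)
    moreover have "exp (- 2 * A\<^sub>0 * \<phi> ^ (eH - 1)) = ?K powr (- 1 / 2)"
      using exponent K1 by (simp add: powr_def)
    ultimately have "p * (?K powr (- 1 / 2) - A\<^sub>0 * p ^ (eH - 1) * \<epsilon>) \<le> \<Phi> (TT n)" by simp
    moreover have "p * (?K powr (- 1 / 2) / 2) \<le> p * (?K powr (- 1 / 2) - A\<^sub>0 * p ^ (eH - 1) * \<epsilon>)"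
      using p0 error by (intro mult_left_mono) auto
    moreover have "(?K * real n powr (- al) / 2) * (?K powr (- 1 / 2) / 2) \<le> p * (?K powr (- 1 / 2) / 2)"
      using pge by (intro mult_right_mono) auto
    moreover have "(?K * real n powr (- al) / 2) * (?K powr (- 1 / 2) / 2) = real n powr (- al) * (?K powr (1 / 2) / 4)"
    proof -
      have "?K powr 1 * ?K powr (- 1 / 2) = ?K powr (1 / 2)" unfolding powr_add[symmetric] by simp
      then have "?K * ?K powr (- 1 / 2) = ?K powr (1 / 2)" using K1 by simp
      then show ?thesis by (simp add: mult_ac)
    qed
    moreover have "\<phi> \<le> real n powr (- al) * ?l powr (1 / kk)"
    proof -
      have "\<phi> = kap * (real n powr (- al) * ?l powr (1 / kk))" by (simp add: \<phi>_def)
      also have "\<dots> \<le> 1 * (real n powr (- al) * ?l powr (1 / kk))" using kap_bounds by (intro mult_right_mono) auto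
      finally show ?thesis by simp
    qed
    moreover have "real n powr (- al) * ?l powr (1 / kk) < real n powr (- al) * (?K powr (1 / 2) / 4)"
      using win n0 by (intro mult_strict_left_mono) auto
    ultimately show False using lt by linarith
  qed
  then have each: "\<phi> \<le> pr \<Omega> (\<lambda>\<beta>. Acc n \<beta> f)" if "f \<in> Kn_edges n" for f
    using acceptance_probability[OF n that] by linarith
  have "real n ^ 2 / 4 * \<phi> \<le> real (card (Kn_edges n)) * \<phi>"
    using card_Kn_edges_ge[OF n] phi0 by (rule mult_right_mono)
  also have "\<dots> = (\<Sum>f\<in>Kn_edges n. \<phi>)" by simp
  also have "\<dots> \<le> (\<Sum>f\<in>Kn_edges n. pr \<Omega> (\<lambda>\<beta>. Acc n \<beta> f))" using each by (intro sum_mono)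
  finally have "real n ^ 2 / 4 * \<phi> - real n ^ 6 / real (NN n) \<le> expected_edges VH EH n"
    using expected_edges_ge[OF N_pos, of n] by linarith
  moreover have "real n ^ 6 / real (NN n) \<le> 1"
  proof -
    have "real n ^ 6 \<le> real n ^ (vH + 7)" using n by (intro power_increasing) auto
    then show ?thesis using n0 by (simp add: NN_def)
  qed
  ultimately show ?thesis by (simp add: \<phi>_def)
qed

lemma eventually_ln: "eventually P at_top \<Longrightarrow> \<forall>\<^sub>F n in sequentially. P (ln (real n))"
  using filterlim_compose[OF ln_at_top filterlim_real_sequentially] by (auto simp: filterlim_iff)

theorem expected_edges_lower_bound:
  "\<exists>c>0. \<forall>\<^sub>F n in sequentially.
     expected_edges VH EH n \<ge> c * real n powr (2 - al) * ln (ln (real n)) powr (1 / kk)"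
proof -
  obtain \<delta> where d: "0 < \<delta>" "2 * \<delta> \<le> al"
      "\<And>S. S \<subseteq> VH \<Longrightarrow> 3 \<le> card S \<Longrightarrow> card S < vH \<Longrightarrow>
       (real vH - real (card S)) - al * (real eH - real (card {e\<in>EH. e \<subseteq> S})) \<le> - 2 * \<delta>"
    using overlap_exponent by blast
  define a where "a = 1 / (2 * kk)"
  have a: "0 < a" using kk_ge by (simp add: a_def)
  \<comment> \<open>\<open>kap / 4\<close> comes from the at least \<open>n ^ 2 / 4\<close> edges
    and is halved to absorb the subtracted 1; \<open>a powr (1 / kk)\<close> comes from
    \<open>ln (KK n) = a * ln (ln n)\<close>.\<close>
  define c where "c = kap / 8 * a powr (1 / kk)"
  have c: "0 < c" using kap_bounds a by (simp add: c_def)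
  have lnK: "ln (KK n) = a * ln (ln (real n))" if "ln (real n) \<ge> 1" for n
    using that by (simp add: KK_def a_def ln_powr)
  have "0 < 1 / (8 * real eH * kk)" using eH_ge kk_ge by simp
  note err = eventually_ln[OF eventually_eps_small[OF d(1) this]]
  have "\<forall>\<^sub>F r in at_top. (1::real) \<le> r" by (rule eventually_ge_at_top)
  note r1 = eventually_ln[OF this]
  have "\<forall>\<^sub>F r in at_top. 1 \<le> a * ln r" using a by real_asymp
  note l1 = eventually_ln[OF this]
  have "\<forall>\<^sub>F r in at_top. real eH * ln (2 * r powr a) \<le> \<delta> * r" using a d(1) eH_ge by real_asymp
  note K1 = eventually_ln[OF this]
  have "\<forall>\<^sub>F r in at_top. a * ln r < r powr (a / 2) / 4" using a by real_asymp
  note win = eventually_ln[OF this]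
  have "\<forall>\<^sub>F n in sequentially. a * ln (ln (real n)) \<le> real n powr al" using a al_bounds by real_asymp
  note phi = this
  have "\<forall>\<^sub>F n in sequentially. 8 / kap \<le> real n powr (2 - al)" using al_bounds kap_bounds(1) by real_asymp
  note one = this
  have n2: "\<forall>\<^sub>F n in sequentially. 8 * eH ^ 2 + 2 \<le> n" by (rule eventually_ge_at_top)
  show ?thesis
  proof (intro exI[of _ c] conjI c)
    show "\<forall>\<^sub>F n in sequentially. c * real n powr (2 - al) * ln (ln (real n)) powr (1 / kk) \<le> expected_edges VH EH n"
      using err r1 l1 K1 win phi one n2
    proof eventually_elim
      case (elim n)
      have n: "n \<ge> 2" and n0: "real n > 0" using elim(8) by auto
      have r: "ln (real n) \<ge> 1" using elim(2) .
      note lk = lnK[OF r]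
      have l: "ln (KK n) \<ge> 1" using elim(3) lk by simp
      have K: "KK n = ln (real n) powr a" by (simp add: KK_def a_def)
      have "(2 * KK n) ^ eH = exp (real eH * ln (2 * ln (real n) powr a))"
        unfolding K exp_of_nat_mult using r by simp
      also have "\<dots> \<le> exp (\<delta> * ln (real n))" using elim(4) by simp
      also have "\<dots> = real n powr \<delta>" using n0 by (simp add: powr_def)
      finally have Kd: "(2 * KK n) ^ eH \<le> real n powr \<delta>" .
      have le_l: "ln (KK n) powr (1 / kk) \<le> ln (KK n)"
        using powr_mono[of "1 / kk" 1 "ln (KK n)"] l kk_ge by simp
      have "real n ^ 2 / 4 * (kap * real n powr (- al) * ln (KK n) powr (1 / kk)) - 1 \<le> expected_edges VH EH n"
      proof (rule expected_edges_at[OF _ n r l])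
        show "sparse_scale VH EH n (NN n) (TT n) (2 ^ (eH - 1) * sqrt (ln (real n))) (real n powr (- \<delta>))"
          by (rule scale_exists[OF d(1,2) _ n r Kd]) (rule d(3))
        have "real (8 * eH ^ 2) \<le> real n" using elim(8) by (intro of_nat_mono) linarith
        then have "8 * real eH ^ 2 \<le> real n" by simp
        then have "8 * real eH ^ 2 * real n ^ (vH - 2) \<le> real n * real n ^ (vH - 2)" by (intro mult_right_mono) auto
        also have "\<dots> = real n ^ Suc (vH - 2)" by simp
        also have "\<dots> \<le> real n ^ (vH + 7)" using n by (intro power_increasing) auto
        finally show "8 * real eH ^ 2 * real n ^ (vH - 2) \<le> real (NN n)" by (simp add: NN_def)
        have "real n powr (- al) * ln (KK n) powr (1 / kk) \<le> real n powr (- al) * real n powr al"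
          using le_l elim(6) lk by (intro mult_left_mono) auto
        also have "\<dots> = 1" using n0 by (simp flip: powr_add)
        finally show "real n powr (- al) * ln (KK n) powr (1 / kk) \<le> 1" .
        have "KK n powr (1 / 2) = ln (real n) powr (a / 2)" by (simp add: K powr_powr)
        then show "ln (KK n) powr (1 / kk) < KK n powr (1 / 2) / 4" using le_l elim(5) lk by simp
      qed (rule elim(1))
      moreover have "real n ^ 2 * real n powr (- al) = real n powr (2 - al)"
      proof -
        have "real n ^ 2 = real n powr 2" using n0 by simp
        then show ?thesis using powr_add[of "real n" 2 "- al"] by simp
      qed
      moreover have "real n ^ 2 / 4 * (kap * real n powr (- al) * ln (KK n) powr (1 / kk)) =
          kap / 4 * (real n ^ 2 * real n powr (- al)) * ln (KK n) powr (1 / kk)" by simp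
      ultimately have ge: "kap / 4 * real n powr (2 - al) * ln (KK n) powr (1 / kk) - 1 \<le> expected_edges VH EH n"
        by (simp only:)
      have "1 \<le> ln (KK n) powr (1 / kk)" using l kk_ge by (intro ge_one_powr_ge_zero) auto
      moreover have "1 \<le> kap / 8 * real n powr (2 - al)" using elim(7) kap_bounds(1) by (simp add: field_simps)
      ultimately have "1 * 1 \<le> (kap / 8 * real n powr (2 - al)) * ln (KK n) powr (1 / kk)" by (intro mult_mono) auto
      moreover have "ln (KK n) powr (1 / kk) = a powr (1 / kk) * ln (ln (real n)) powr (1 / kk)"
        unfolding lk using a r by (intro powr_mult)
      then have "c * real n powr (2 - al) * ln (ln (real n)) powr (1 / kk) = (kap / 8 * real n powr (2 - al)) * ln (KK n) powr (1 / kk)"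
        by (simp add: c_def mult_ac)
      moreover have "kap / 4 * real n powr (2 - al) * ln (KK n) powr (1 / kk)
          = 2 * ((kap / 8 * real n powr (2 - al)) * ln (KK n) powr (1 / kk))" by simp
      ultimately show ?case using ge by linarith
    qed
  qed
qed

end

theorem theorem1:
  fixes VH :: "'a set" and EH :: "'a set set"
  assumes "graph VH EH" and "regular VH EH" and "strictly_2_balanced VH EH"
  shows "\<exists>c>0. \<forall>\<^sub>F n in sequentially.
           expected_edges VH EH n \<ge>
             c * real n powr (2 - (real (card VH) - 2) / (real (card EH) - 1))
               * ln (ln (real n)) powr (1 / (real (card EH) - 1))"
proof -
  interpret balanced_graph VH EH using assms by unfold_locales
  show ?thesis using expected_edges_lower_bound by (simp add: al_def kk_def vH_def eH_def)
qed

end
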